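(* Let $n_1,n_2$ be positive integers and $n=\max\{n_1,n_2\}$. Let $\tau\in S_{n_1}$ be a $k$-Grassmannian permutation whose associated Young diagram $\lambda$ has exactly $2$ rows, and let $w\in S_{n_2}$. Write \[\mathfrak{S}_{w}\, s_{\lambda}(x_1,\dots,x_k)=\sum_{v} c_{w\tau}^{v}\,\mathfrak{S}_{v}.\] Then: (1) if $k=n_2$, then $c_{w\tau}^{v}\in\{0,1\}$ for all $v$; (2) if $k=n_2-1$, then $c_{w\tau}^{v}\in\{0,1\}$ for all $v$; (3) if $k=n_2-2$, then $c_{w\tau}^{v}\in\{0,1,2\}$ for all $v$.
   Context: For $w\in S_N$, $\mathfrak{S}_w$ denotes the Schubert polynomial: $\mathfrak{S}_{w_0}=x_1^{N-1}x_2^{N-2}\cdots x_{N-1}$ for the longest element $w_0\in S_N$, and $\mathfrak{S}_{ws_i}=\partial_i\mathfrak{S}_w$ whenever $w(i)>w(i+1)$, where $\partial_i f=(f-s_if)/(x_i-x_{i+1})$ and $s_i$ swaps $x_i,x_{i+1}$. Permutations in $S_N$ are regarded as permutations of $S_{N'}$ ($N'\ge N$) fixing $N+1,\dots,N'$; Schubert polynomials are stable under this embedding and form a basis of the polynomial ring, so the coefficients $c^v_{w\tau}$ in the expansion are well defined. A permutation $\tau\in S_{N}$ is $k$-Grassmannian if $\tau(1)<\dots<\tau(k)$ and $\tau(k+1)<\dots<\tau(N)$; its associated Young diagram (partition) is $\lambda=(\tau(k)-k,\dots,\tau(2)-2,\tau(1)-1)$ (zero parts removed), and $\mathfrak{S}_\tau=s_\lambda(x_1,\dots,x_k)$,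 the Schur polynomial in $k$ variables, i.e. the sum over semistandard Young tableaux $T$ of shape $\lambda$ with entries in $\{1,\dots,k\}$ of $\prod_i x_i^{t_i}$, $t_i$ the number of entries equal to $i$. *)

theory Defs
  imports
    "HOL-Library.Poly_Mapping"
    "HOL-Library.FuncSet"
    "HOL-Combinatorics.Permutations"
begin

text \<open>
  Integer polynomials in the variables x_1, x_2, ...: finitely supported functions from
  monomials (exponent vectors) to coefficients. The index 0 is available in the type but is
  never used below.
\<close>

type_synonym zpoly = "(nat \<Rightarrow>\<^sub>0 nat) \<Rightarrow>\<^sub>0 int"

definition X :: "nat \<Rightarrow> zpoly" where
  "X i = Poly_Mapping.single (Poly_Mapping.single i 1) 1"

text \<open>
  The inner \<open>map_key\<close> exchanges the exponents of x_i and x_(i+1) in a monomial; the outer one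
  reads off coefficients along this involution of the monomials.
\<close>

definition swap_vars :: "nat \<Rightarrow> zpoly \<Rightarrow> zpoly" where
  "swap_vars i f =
     Poly_Mapping.map_key (Poly_Mapping.map_key (Transposition.transpose i (Suc i))) f"

text \<open>The quotient is exact, and unique because \<open>zpoly\<close> is an integral domain.\<close>

definition divided_diff :: "nat \<Rightarrow> zpoly \<Rightarrow> zpoly" where
  "divided_diff i f = (THE g. g * (X i - X (Suc i)) = f - swap_vars i f)"

text \<open>
  An element of S_N is a function \<open>w\<close> with \<open>w permutes {1..N}\<close>. Such a function fixes every
  number outside \<open>{1..N}\<close>, so S_N is literally a subset of S_N' for N \<open>\<le>\<close> N'.
\<close>

definition finitary_perms :: "(nat \<Rightarrow> nat) set" where
  "finitary_perms = {w. \<exists>N. w permutes {1..N}}"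

definition longest_perm :: "nat \<Rightarrow> nat \<Rightarrow> nat" where
  "longest_perm N i = (if i \<in> {1..N} then N + 1 - i else i)"

inductive schubert_in :: "nat \<Rightarrow> (nat \<Rightarrow> nat) \<Rightarrow> zpoly \<Rightarrow> bool" for N :: nat where
  longest: "schubert_in N (longest_perm N) (\<Prod>i = 1..N. X i ^ (N - i))"
| descent: "schubert_in N w f \<Longrightarrow> 1 \<le> i \<Longrightarrow> i < N \<Longrightarrow> w i > w (Suc i) \<Longrightarrow>
    schubert_in N (w \<circ> Transposition.transpose i (Suc i)) (divided_diff i f)"

text \<open>
  The description determines the same polynomial for every reduced path down from the longest
  element, and for every N with w in S_N (stability).
\<close>

definition schubert :: "(nat \<Rightarrow> nat) \<Rightarrow> zpoly" where
  "schubert w = (THE f. \<exists>N. schubert_in N w f)"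

text \<open>
  The coefficient of the Schubert polynomial of \<open>v\<close> in the expansion of \<open>f\<close>; the coefficient
  function is unique, and exists for every f not involving the spare variable of index 0, since
  the Schubert polynomials form a basis.
\<close>

definition schubert_coeff :: "zpoly \<Rightarrow> (nat \<Rightarrow> nat) \<Rightarrow> int" where
  "schubert_coeff f =
     (THE c. finite {v. c v \<noteq> 0} \<and> {v. c v \<noteq> 0} \<subseteq> finitary_perms \<and>
             f = (\<Sum>v | c v \<noteq> 0. of_int (c v) * schubert v))"

definition grassmannian :: "nat \<Rightarrow> nat \<Rightarrow> (nat \<Rightarrow> nat) \<Rightarrow> bool" where
  "grassmannian k N \<tau> \<longleftrightarrow> k \<le> N \<and> \<tau> permutes {1..N} \<and>
     strict_mono_on {1..k} \<tau> \<and> strict_mono_on {k+1..N} \<tau>"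

text \<open>
  The parts are \<open>\<tau> k - k, \<dots>, \<tau> 1 - 1\<close> in this order. For Grassmannian \<open>\<tau>\<close> one has
  \<open>j \<le> \<tau> j\<close> for \<open>1 \<le> j \<le> k\<close>, so the subtraction does not truncate.
\<close>

definition grassmannian_shape :: "nat \<Rightarrow> (nat \<Rightarrow> nat) \<Rightarrow> nat list" where
  "grassmannian_shape k \<tau> = filter (\<lambda>p. p \<noteq> 0) (map (\<lambda>j. \<tau> j - j) (rev [1..<k+1]))"

definition young_diagram :: "nat list \<Rightarrow> (nat \<times> nat) set" where
  "young_diagram \<mu> = {(r, c). r < length \<mu> \<and> c < \<mu> ! r}"

text \<open>
  Fillings are taken in \<open>\<rightarrow>\<^sub>E\<close> (constantly \<open>undefined\<close> off the diagram), so that each tableau is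
  counted exactly once.
\<close>

definition ssyt :: "nat list \<Rightarrow> nat \<Rightarrow> (nat \<times> nat \<Rightarrow> nat) set" where
  "ssyt \<mu> k = {T \<in> young_diagram \<mu> \<rightarrow>\<^sub>E {1..k}.
     (\<forall>r c c'. (r, c) \<in> young_diagram \<mu> \<and> (r, c') \<in> young_diagram \<mu> \<and> c < c' \<longrightarrow>
        T (r, c) \<le> T (r, c')) \<and>
     (\<forall>r r' c. (r, c) \<in> young_diagram \<mu> \<and> (r', c) \<in> young_diagram \<mu> \<and> r < r' \<longrightarrow>
        T (r, c) < T (r', c))}"

definition schur :: "nat list \<Rightarrow> nat \<Rightarrow> zpoly" where
  "schur \<mu> k = (\<Sum>T\<in>ssyt \<mu> k. \<Prod>i = 1..k. X i ^ card {b \<in> young_diagram \<mu>. T b = i})"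

end

theory Submission
  imports Defs "HOL-Computational_Algebra.Polynomial"
begin

text \<open>
  The two-row Jacobi-Trudi identity writes the Schur polynomial of shape \<open>(p, q)\<close> as
  \<open>h_p h_q - h_(p+1) h_(q-1)\<close>, and by the Pieri rule the coefficient of the Schubert polynomial of
  \<open>v\<close> in the product of that of \<open>w\<close> with \<open>h_p h_q\<close> counts pairs of Pieri steps from \<open>w\<close> to \<open>v\<close>,
  of lengths \<open>p\<close> and \<open>q\<close>. Suppose that \<open>w\<close> increases after position \<open>k\<close>. For fixed \<open>w\<close> and \<open>v\<close>
  the possible midpoints split into independent choices, so the generating function of the length
  of the first step is a power of \<open>t\<close> times a product of polynomials \<open>1 + t + \<dots> + t^m\<close>. The factors other than the
  one of the topmost moved position are limited by the number \<open>n_2 - k\<close> of values below it that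
  are missing from \<open>w(1), \<dots>, w(k)\<close>. Since the \<open>h_m\<close> commute, the generating function is
  palindromic, which bounds the difference of consecutive coefficients past its centre by 1 or 2.

  The remaining case is \<open>k = n_2 - 2\<close> and \<open>w(k+1) > w(k+2)\<close>. If \<open>v\<close> also has a descent at \<open>k + 1\<close>,
  a divided difference reduces to the case above. Otherwise
  \<open>h_m(x_1, \<dots>, x_k) = h_m(x_1, \<dots>, x_K) - x_K h_(m-1)(x_1, \<dots>, x_K)\<close> with \<open>K = k + 1\<close>, together with
  Monk's rule for \<open>x_K\<close>, expresses the coefficient through midpoints on \<open>K\<close> positions, where only
  one value is missing.
\<close>

section \<open>Divided differences\<close>

text \<open>A permutation that increases after position \<open>k\<close> is an injective word on
  \<open>k\<close> letters, so the Pieri and Monk rules become statements about particles. Both are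
  proved by sorting the word: for a decreasing word the Schubert polynomial is a monomial, and
  divided differences carry the rule to every other word. A descent of \<open>w\<close> at
  \<open>k + 1\<close> destroys this, since the polynomial is then not symmetric in the two
  variables after \<open>x_k\<close>; hence the detour through \<open>K = k + 1\<close>, at the
  price of factors \<open>x_K\<close>. The topmost particle may have arbitrarily many landings, but
  its factor only stretches the plateau of the coefficient sequence. Palindromicity puts the centre
  of the plateau at half the total degree, and \<open>q \<le> p\<close> puts the compared pair past
  it. The constant 2 has two sources: the coefficients 1, 2, 1 of \<open>(1 + t)^2\<close> when two
  values are missing, and a sum of two differences bounded by 1 when one is missing. Coefficients
  are read off by additive functionals made of divided differences, and the products in question are
  shown to lie in the integral span of Schubert polynomials.\<close>

abbreviation adjt :: "nat \<Rightarrow> nat \<Rightarrow> nat" where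
  "adjt i \<equiv> Transposition.transpose i (Suc i)"

lemma monomial_induct [case_names zero step]:
  fixes m :: "nat \<Rightarrow>\<^sub>0 nat"
  assumes "P 0" and step: "\<And>m j. P m \<Longrightarrow> P (Poly_Mapping.single j 1 + m)"
  shows "P m"
proof (induction m rule: update_induct)
  case const
  show ?case by fact
next
  case (update f a b)
  have "P (Poly_Mapping.single a n + f)" for n
  proof (induction n)
    case (Suc n)
    have "Poly_Mapping.single a (Suc n) = Poly_Mapping.single a 1 + Poly_Mapping.single a n"
      by (simp flip: single_add)
    then show ?case using step[OF Suc] by (simp add: add.assoc)
  qed (use update in simp)
  moreover have "Poly_Mapping.update a b f = Poly_Mapping.single a b + f"
    using update by (intro poly_mapping_eqI)
      (auto simp: lookup_update lookup_add lookup_single when_def in_keys_iff)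
  ultimately show ?case by simp
qed

lemma X_mult_single: "X j * Poly_Mapping.single m c = Poly_Mapping.single (Poly_Mapping.single j 1 + m) c"
  by (simp add: X_def mult_single)

text \<open>\<open>zpoly\<close> is the free abelian group on the monomials, so
  \<open>frag_induction\<close> reduces the claim to monomials with coefficient 1, and these arise
  from 1 by multiplication with variables.\<close>

lemma zpoly_induct [case_names zero one mult diff]:
  fixes f :: zpoly
  assumes "P 0" "P 1" and mult: "\<And>j f. P f \<Longrightarrow> P (X j * f)"
    and diff: "\<And>f g. P f \<Longrightarrow> P g \<Longrightarrow> P (f - g)"
  shows "P f"
proof -
  have "P (frag_of m)" for m
  proof (induction m rule: monomial_induct)
    case (step m j)
    then show ?case using mult[of "frag_of m" j] by (simp add: X_mult_single)
  qed (use assms in simp)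
  then show ?thesis
    using frag_induction[of f UNIV P] assms by blast
qed

lemma inj_map_key_adjt: "inj (Poly_Mapping.map_key (adjt i) :: (nat \<Rightarrow>\<^sub>0 nat) \<Rightarrow> _)"
  by (rule inj_on_inverseI[where g = "Poly_Mapping.map_key (adjt i)"])
     (simp add: map_key_compose map_key_id[unfolded id_def[symmetric]] transpose_comp_involutory)

lemma lookup_swap_vars: "Poly_Mapping.lookup (swap_vars i f) m = Poly_Mapping.lookup f (Poly_Mapping.map_key (adjt i) m)"
  by (simp add: swap_vars_def map_key.rep_eq[OF inj_map_key_adjt])

lemma swap_vars_add: "swap_vars i (f + g) = swap_vars i f + swap_vars i g"
  and swap_vars_diff: "swap_vars i (f - g) = swap_vars i f - swap_vars i g"
  and swap_vars_0 [simp]: "swap_vars i 0 = 0"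
  by (rule poly_mapping_eqI; simp add: lookup_swap_vars lookup_add lookup_minus)+

lemma map_key_adjt_single: "Poly_Mapping.map_key (adjt i) (Poly_Mapping.single j c) = Poly_Mapping.single (adjt i j) c"
  using map_key_single[of "adjt i" "adjt i j" c] by simp

lemma swap_vars_single:
  "swap_vars i (Poly_Mapping.single m c) = Poly_Mapping.single (Poly_Mapping.map_key (adjt i) m) c"
proof -
  have "Poly_Mapping.map_key (adjt i) (Poly_Mapping.map_key (adjt i) m) = m"
    by (simp add: map_key_compose map_key_id[unfolded id_def[symmetric]] transpose_comp_involutory)
  then show ?thesis
    using map_key_single[OF inj_map_key_adjt, of i "Poly_Mapping.map_key (adjt i) m" c]
    by (simp add: swap_vars_def)
qed

lemma swap_vars_1 [simp]: "swap_vars i 1 = 1"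
  using swap_vars_single[of i 0 1] by simp

lemma swap_vars_X_mult: "swap_vars i (X j * f) = X (adjt i j) * swap_vars i f"
proof -
  have *: "swap_vars i (X j * frag_of m) = X (adjt i j) * swap_vars i (frag_of m)" for m
    by (simp add: X_mult_single swap_vars_single map_key_plus map_key_adjt_single)
  show ?thesis
    by (rule frag_induction[where c = f and S = UNIV])
       (auto simp: * swap_vars_diff right_diff_distrib)
qed

lemma swap_vars_mult: "swap_vars i (f * g) = swap_vars i f * swap_vars i g"
  by (induction f rule: zpoly_induct)
     (auto simp: swap_vars_diff left_diff_distrib swap_vars_X_mult mult.assoc)

lemma swap_vars_X [simp]: "swap_vars i (X j) = X (adjt i j)"
  using swap_vars_X_mult[of i j 1] by simp

lemma swap_vars_power: "swap_vars i (f ^ n) = swap_vars i f ^ n"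
  by (induction n) (auto simp: swap_vars_mult)

lemma swap_vars_swap_vars [simp]: "swap_vars i (swap_vars i f) = f"
  by (induction f rule: zpoly_induct) (auto simp: swap_vars_diff swap_vars_X_mult)

lemma swap_vars_commute:
  assumes "Suc i < j"
  shows "swap_vars i (swap_vars j f) = swap_vars j (swap_vars i f)"
  using assms by (induction f rule: zpoly_induct)
    (auto simp: swap_vars_diff swap_vars_X_mult transpose_def)

lemma swap_vars_braid:
  "swap_vars i (swap_vars (Suc i) (swap_vars i f)) = swap_vars (Suc i) (swap_vars i (swap_vars (Suc i) f))"
  by (induction f rule: zpoly_induct)
     (auto simp: swap_vars_diff swap_vars_X_mult transpose_def)

lemma X_inject [simp]: "X i = X j \<longleftrightarrow> i = j"
  by (auto simp: X_def frag_of_eq dest: arg_cong[where f = Poly_Mapping.keys])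

text \<open>The Leibniz rule constructs the quotient: the one for \<open>X j\<close> is the constant
  \<open>d\<close>, and a quotient \<open>g\<close> for \<open>f\<close> gives
  \<open>d * f + X (adjt i j) * g\<close> for the product.\<close>

lemma divided_diff_exists: "\<exists>g. g * (X i - X (Suc i)) = f - swap_vars i f"
proof (induction f rule: zpoly_induct)
  case (mult j f)
  then obtain g where g: "g * (X i - X (Suc i)) = f - swap_vars i f" by blast
  define d :: zpoly where "d = (if j = i then 1 else if j = Suc i then - 1 else 0)"
  have d: "d * (X i - X (Suc i)) = X j - X (adjt i j)"
    by (auto simp: d_def transpose_def)
  have "(d * f + X (adjt i j) * g) * (X i - X (Suc i))
      = f * (d * (X i - X (Suc i))) + X (adjt i j) * (g * (X i - X (Suc i)))"
    by (simp add: algebra_simps)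
  also have "\<dots> = X j * f - swap_vars i (X j * f)"
    by (simp only: d g swap_vars_X_mult) (simp add: algebra_simps)
  finally show ?case by blast
next
  case (diff f g)
  then obtain a b where "a * (X i - X (Suc i)) = f - swap_vars i f" "b * (X i - X (Suc i)) = g - swap_vars i g"
    by blast
  then have "(a - b) * (X i - X (Suc i)) = f - g - swap_vars i (f - g)"
    by (simp add: swap_vars_diff left_diff_distrib)
  then show ?case by blast
qed (rule exI[of _ 0], simp)+

lemma divided_diff_eqI:
  assumes "g * (X i - X (Suc i)) = f - swap_vars i f"
  shows "divided_diff i f = g"
  unfolding divided_diff_def
proof (rule the_equality)
  fix g' assume "g' * (X i - X (Suc i)) = f - swap_vars i f"
  with assms have "(g' - g) * (X i - X (Suc i)) = 0" by (simp add: left_diff_distrib)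
  then show "g' = g" by simp
qed fact

lemma divided_diff_mult_cancel: "divided_diff i f * (X i - X (Suc i)) = f - swap_vars i f"
  using divided_diff_exists divided_diff_eqI by blast

lemma divided_diff_add: "divided_diff i (f + g) = divided_diff i f + divided_diff i g"
  by (rule divided_diff_eqI) (simp add: distrib_right divided_diff_mult_cancel swap_vars_add)

lemma divided_diff_diff: "divided_diff i (f - g) = divided_diff i f - divided_diff i g"
  by (rule divided_diff_eqI) (simp add: left_diff_distrib divided_diff_mult_cancel swap_vars_diff)

lemma divided_diff_0 [simp]: "divided_diff i 0 = 0"
  by (rule divided_diff_eqI) simp

lemma divided_diff_1 [simp]: "divided_diff i 1 = 0"
  by (rule divided_diff_eqI) simp

lemma divided_diff_uminus: "divided_diff i (- f) = - divided_diff i f"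
  using divided_diff_diff[of i 0 f] by simp

lemma divided_diff_sum: "divided_diff i (sum f A) = (\<Sum>a\<in>A. divided_diff i (f a))"
  by (induction A rule: infinite_finite_induct) (auto simp: divided_diff_add)

lemma divided_diff_mult:
  "divided_diff i (f * g) = divided_diff i f * g + swap_vars i f * divided_diff i g"
proof (rule divided_diff_eqI)
  have "(divided_diff i f * g + swap_vars i f * divided_diff i g) * (X i - X (Suc i))
      = (divided_diff i f * (X i - X (Suc i))) * g + swap_vars i f * (divided_diff i g * (X i - X (Suc i)))"
    by (simp add: algebra_simps)
  also have "\<dots> = f * g - swap_vars i (f * g)"
    by (simp only: divided_diff_mult_cancel) (simp add: swap_vars_mult algebra_simps)
  finally show "(divided_diff i f * g + swap_vars i f * divided_diff i g) * (X i - X (Suc i)) = f * g - swap_vars i (f * g)" .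
qed

lemma divided_diff_X:
  "divided_diff i (X j) = (if j = i then 1 else if j = Suc i then - 1 else 0)"
  by (rule divided_diff_eqI) (auto simp: transpose_def)

lemma divided_diff_eq_0_iff: "divided_diff i f = 0 \<longleftrightarrow> swap_vars i f = f"
proof
  assume "divided_diff i f = 0"
  then show "swap_vars i f = f" using divided_diff_mult_cancel[of i f] by simp
qed (auto intro: divided_diff_eqI)

lemma swap_vars_divided_diff [simp]: "swap_vars i (divided_diff i f) = divided_diff i f"
proof -
  have "swap_vars i (divided_diff i f * (X i - X (Suc i))) = swap_vars i (f - swap_vars i f)"
    by (simp only: divided_diff_mult_cancel)
  then have "swap_vars i (divided_diff i f) * (X (Suc i) - X i) = swap_vars i f - f"
    by (simp add: swap_vars_mult swap_vars_diff)
  then have "swap_vars i (divided_diff i f) * (X i - X (Suc i)) = f - swap_vars i f"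
    by (metis minus_diff_eq mult_minus_right)
  then show ?thesis by (metis divided_diff_eqI)
qed

lemma divided_diff_divided_diff [simp]: "divided_diff i (divided_diff i f) = 0"
  by (simp add: divided_diff_eq_0_iff)

lemma divided_diff_mult_sym:
  "divided_diff i g = 0 \<Longrightarrow> divided_diff i (f * g) = divided_diff i f * g"
  "divided_diff i g = 0 \<Longrightarrow> divided_diff i (g * f) = g * divided_diff i f"
  by (simp_all add: divided_diff_mult divided_diff_eq_0_iff)

lemma divided_diff_commute:
  assumes "Suc i < j"
  shows "divided_diff i (divided_diff j f) = divided_diff j (divided_diff i f)"
proof -
  let ?u = "X i - X (Suc i)" and ?v = "X j - X (Suc j)"
  have s: "swap_vars i ?v = ?v" "swap_vars j ?u = ?u"
    using assms by (auto simp: swap_vars_diff transpose_def)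
  have "divided_diff i (divided_diff j f) * ?u * ?v = (divided_diff j f - swap_vars i (divided_diff j f)) * ?v"
    by (simp add: divided_diff_mult_cancel)
  also have "\<dots> = divided_diff j f * ?v - swap_vars i (divided_diff j f * ?v)"
    using s by (simp add: swap_vars_mult left_diff_distrib)
  also have "\<dots> = f - swap_vars j f - swap_vars i f + swap_vars i (swap_vars j f)"
    by (simp add: divided_diff_mult_cancel swap_vars_diff)
  finally have 1: "divided_diff i (divided_diff j f) * ?u * ?v = \<dots>" .
  have "divided_diff j (divided_diff i f) * ?v * ?u = (divided_diff i f - swap_vars j (divided_diff i f)) * ?u"
    by (simp add: divided_diff_mult_cancel)
  also have "\<dots> = divided_diff i f * ?u - swap_vars j (divided_diff i f * ?u)"
    using s by (simp add: swap_vars_mult left_diff_distrib)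
  also have "\<dots> = f - swap_vars i f - swap_vars j f + swap_vars j (swap_vars i f)"
    by (simp add: divided_diff_mult_cancel swap_vars_diff)
  finally have "divided_diff i (divided_diff j f) * ?u * ?v = divided_diff j (divided_diff i f) * ?v * ?u"
    using 1 by (simp add: swap_vars_commute[OF assms, of f])
  then have "divided_diff i (divided_diff j f) * ?u * ?v = divided_diff j (divided_diff i f) * ?u * ?v"
    by (simp only: mult.assoc mult.commute[of ?v ?u])
  moreover have "?u \<noteq> 0" "?v \<noteq> 0" by simp_all
  ultimately show ?thesis by (metis mult_right_cancel)
qed

text \<open>Each side of the braid relation is the alternating sum over S_3 divided by the product
  of the three differences \<open>d\<close>, \<open>e\<close>, \<open>d + e\<close>. The letters
  \<open>s\<close> and \<open>t\<close> in the names mark images under the two swaps; the other side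
  of the relation is obtained by exchanging \<open>d\<close> and \<open>e\<close>.\<close>

lemma antisymmetrizer3:
  fixes d e :: "'a :: comm_ring_1"
  assumes k: "k * d = h - sh" and h: "h * e = g - tg" and sh: "sh * (d + e) = g - stg"
    and g: "g * d = f - sf" and tg: "tg * (d + e) = tf - tsf" and stg: "stg * e = stf - stsf"
  shows "k * (d * e * (d + e)) = f - sf - tf + tsf + stf - stsf"
proof -
  have "k * (d * e * (d + e)) = (h - sh) * (e * (d + e))"
    by (simp flip: k add: mult_ac)
  also have "\<dots> = (h * e) * (d + e) - (sh * (d + e)) * e"
    by (simp add: algebra_simps)
  also have "\<dots> = g * d - tg * (d + e) + stg * e"
    by (simp only: h sh) (simp add: algebra_simps)
  finally show ?thesis by (simp only: g tg stg) (simp add: algebra_simps)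
qed

lemma divided_diff_braid:
  "divided_diff i (divided_diff (Suc i) (divided_diff i f)) = divided_diff (Suc i) (divided_diff i (divided_diff (Suc i) f))"
proof -
  define s t where "s = swap_vars i" and "t = swap_vars (Suc i)"
  define d e where "d = X i - X (Suc i)" and "e = X (Suc i) - X (Suc (Suc i))"
  have mult: "s (x * y) = s x * s y" "t (x * y) = t x * t y"
    and diff: "s (x - y) = s x - s y" "t (x - y) = t x - t y" for x y
    by (simp_all add: s_def t_def swap_vars_mult swap_vars_diff)
  have X: "s e = d + e" "s (d + e) = e" "t d = d + e" "t (d + e) = d"
    by (simp_all add: s_def t_def d_def e_def swap_vars_diff transpose_def)
  have cancel: "divided_diff i x * d = x - s x" "divided_diff (Suc i) x * e = x - t x" for x
    by (simp_all only: s_def t_def d_def e_def divided_diff_mult_cancel)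
  have inv: "s (divided_diff i x) = divided_diff i x" "t (divided_diff (Suc i) x) = divided_diff (Suc i) x" for x
    by (simp_all add: s_def t_def)
  have 1: "divided_diff i (divided_diff (Suc i) (divided_diff i f)) * (d * e * (d + e))
    = f - s f - t f + t (s f) + s (t f) - s (t (s f))"
  proof (rule antisymmetrizer3)
    let ?g = "divided_diff i f"
    show "divided_diff i (divided_diff (Suc i) ?g) * d = divided_diff (Suc i) ?g - s (divided_diff (Suc i) ?g)"
      "divided_diff (Suc i) ?g * e = ?g - t ?g" "?g * d = f - s f" by (simp_all only: cancel)
    show "s (divided_diff (Suc i) ?g) * (d + e) = ?g - s (t ?g)"
      using arg_cong[OF cancel(2), of s ?g] by (simp only: mult diff X inv)
    show t': "t ?g * (d + e) = t f - t (s f)"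
      using arg_cong[OF cancel(1), of t f] by (simp only: mult diff X inv)
    show "s (t ?g) * e = s (t f) - s (t (s f))"
      using arg_cong[OF t', of s] by (simp only: mult diff X inv)
  qed
  have 2: "divided_diff (Suc i) (divided_diff i (divided_diff (Suc i) f)) * (e * d * (e + d))
    = f - t f - s f + s (t f) + t (s f) - t (s (t f))"
  proof (rule antisymmetrizer3)
    let ?g = "divided_diff (Suc i) f"
    show "divided_diff (Suc i) (divided_diff i ?g) * e = divided_diff i ?g - t (divided_diff i ?g)"
      "divided_diff i ?g * d = ?g - s ?g" "?g * e = f - t f" by (simp_all only: cancel)
    show "t (divided_diff i ?g) * (e + d) = ?g - t (s ?g)"
      using arg_cong[OF cancel(1), of t ?g] by (simp only: mult diff X inv add.commute)
    show t': "s ?g * (e + d) = s f - s (t f)"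
      using arg_cong[OF cancel(2), of s f] by (simp only: mult diff X inv add.commute)
    show "t (s ?g) * d = t (s f) - t (s (t f))"
      using arg_cong[OF t', of t] by (simp only: mult diff X inv add.commute[of e d])
  qed
  have "s (t (s f)) = t (s (t f))" by (simp add: s_def t_def swap_vars_braid)
  with 1 2 have "divided_diff i (divided_diff (Suc i) (divided_diff i f)) * (d * e * (d + e))
    = divided_diff (Suc i) (divided_diff i (divided_diff (Suc i) f)) * (d * e * (d + e))"
    by (simp only: mult.commute[of e d] add.commute[of e d]) simp
  moreover have "d * e * (d + e) \<noteq> 0"
    by (simp add: d_def e_def)
  ultimately show ?thesis by (metis mult_right_cancel)
qed

section \<open>Homogeneous polynomials\<close>

text \<open>Generated along the lines of \<open>zpoly_induct\<close>, so that the drop of the degree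
  under divided differences follows by rule induction. The purpose is \<open>schubert_const\<close>:
  a homogeneous polynomial with nonzero divided difference has positive degree and hence no constant
  term.\<close>

inductive homog :: "nat \<Rightarrow> zpoly \<Rightarrow> bool" where
  zero: "homog d 0"
| one: "homog 0 1"
| mult: "homog d f \<Longrightarrow> homog (Suc d) (X j * f)"
| diff: "homog d f \<Longrightarrow> homog d g \<Longrightarrow> homog d (f - g)"

lemma homog_uminus: "homog d f \<Longrightarrow> homog d (- f)"
  using homog.diff[OF homog.zero] by fastforce

lemma homog_add: "homog d f \<Longrightarrow> homog d g \<Longrightarrow> homog d (f + g)"
  using homog.diff[OF _ homog_uminus] by fastforce

lemma homog_X: "homog 1 (X j)"
  using homog.mult[OF homog.one] by simp

lemma homog_times: "homog d f \<Longrightarrow> homog e g \<Longrightarrow> homog (d + e) (f * g)"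
  by (induction rule: homog.induct)
     (auto simp: mult.assoc left_diff_distrib intro: homog.intros)

lemma homog_power: "homog d f \<Longrightarrow> homog (n * d) (f ^ n)"
  by (induction n) (auto intro: homog.one homog_times)

lemma homog_prod: "finite A \<Longrightarrow> (\<And>a. a \<in> A \<Longrightarrow> homog (d a) (f a)) \<Longrightarrow> homog (sum d A) (prod f A)"
  by (induction A rule: finite_induct) (auto intro: homog.one homog_times)

lemma homog_divided_diff_aux:
  "homog d f \<Longrightarrow> (d = 0 \<longrightarrow> divided_diff i f = 0) \<and> (0 < d \<longrightarrow> homog (d - 1) (divided_diff i f))"
proof (induction rule: homog.induct)
  case (mult d f j)
  have "homog d (divided_diff i (X j) * f)"
    using mult.hyps by (auto simp: divided_diff_X intro: homog.zero homog_uminus)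
  moreover have "homog d (X (adjt i j) * divided_diff i f)"
  proof (cases d)
    case 0
    then show ?thesis using mult.IH by (auto intro: homog.zero)
  next
    case (Suc d')
    then show ?thesis using mult.IH homog.mult[of d'] by auto
  qed
  ultimately show ?case by (simp add: divided_diff_mult homog_add)
qed (auto intro: homog.intros simp: divided_diff_diff)

lemma homog_0_divided_diff: "homog 0 f \<Longrightarrow> divided_diff i f = 0"
  using homog_divided_diff_aux by blast

lemma homog_Suc_divided_diff: "homog (Suc d) f \<Longrightarrow> homog d (divided_diff i f)"
  using homog_divided_diff_aux[of "Suc d" f i] by simp

lemma lookup_X_mult_0: "Poly_Mapping.lookup (X j * f) 0 = 0"
proof -
  have *: "Poly_Mapping.lookup (X j * frag_of m) 0 = 0" for m :: "nat \<Rightarrow>\<^sub>0 nat"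
  proof -
    have "Poly_Mapping.lookup (Poly_Mapping.single j 1 + m) j \<noteq> 0" by (simp add: lookup_add)
    then have "Poly_Mapping.single j 1 + m \<noteq> 0" by (metis lookup_zero)
    then show ?thesis by (simp add: X_mult_single lookup_single)
  qed
  show ?thesis
    by (rule frag_induction[where c = f and S = UNIV])
       (auto simp: * right_diff_distrib lookup_minus)
qed

lemma homog_Suc_const: "homog d f \<Longrightarrow> d \<noteq> 0 \<Longrightarrow> Poly_Mapping.lookup f 0 = 0"
  by (induction rule: homog.induct) (auto simp: lookup_X_mult_0 lookup_minus)

declare o_apply [simp del]

lemma comp_adjt_simps [simp]: "(w \<circ> adjt i) i = w (Suc i)" "(w \<circ> adjt i) (Suc i) = w i"
  by (simp_all add: o_apply)

lemma comp_adjt_adjt [simp]: "w \<circ> adjt i \<circ> adjt i = w"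
  by (simp add: comp_assoc)

lemma swap_vars_prod: "swap_vars i (prod f A) = (\<Prod>a\<in>A. swap_vars i (f a))"
  by (induction A rule: infinite_finite_induct) (auto simp: swap_vars_mult)

lemma adjt_image: "i \<in> A \<longleftrightarrow> Suc i \<in> A \<Longrightarrow> adjt i ` A = A"
  by (simp add: transpose_image_eq)

lemma swap_vars_monomial:
  assumes "i \<in> A \<longleftrightarrow> Suc i \<in> A"
  shows "swap_vars i (\<Prod>a\<in>A. X a ^ c a) = (\<Prod>a\<in>A. X a ^ c (adjt i a))"
proof -
  have "swap_vars i (\<Prod>a\<in>A. X a ^ c a) = (\<Prod>a\<in>A. X (adjt i a) ^ c a)"
    by (simp add: swap_vars_prod swap_vars_power)
  also have "\<dots> = (\<Prod>a\<in>A. X a ^ c (adjt i a))"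
    by (rule prod.reindex_bij_witness[where i = "adjt i" and j = "adjt i"])
       (use adjt_image[OF assms] in \<open>auto\<close>)
  finally show ?thesis .
qed

lemma divided_diff_monomial_sym:
  assumes "i \<in> A \<longleftrightarrow> Suc i \<in> A" and "c i = c (Suc i)"
  shows "divided_diff i (\<Prod>a\<in>A. X a ^ c a) = 0"
  unfolding divided_diff_eq_0_iff swap_vars_monomial[OF assms(1)]
  using assms(2) by (intro prod.cong) (auto simp: transpose_def)

text \<open>Splitting off one factor \<open>X i\<close> leaves a monomial symmetric in the two
  variables, and the divided difference of \<open>X i\<close> is 1. Monomials thus stay monomials
  along staircases of exponents.\<close>

lemma divided_diff_monomial_step:
  assumes "finite A" "i \<in> A" "Suc i \<in> A" and "c i = Suc (c (Suc i))"
  shows "divided_diff i (\<Prod>a\<in>A. X a ^ c a) = (\<Prod>a\<in>A. X a ^ (c(i := c (Suc i))) a)"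
proof -
  let ?c = "c(i := c (Suc i))"
  have "(\<Prod>a\<in>A. X a ^ c a) = X i * (\<Prod>a\<in>A. X a ^ ?c a)"
    using assms by (simp add: prod.remove[of A i] mult.assoc)
  moreover have "divided_diff i (\<Prod>a\<in>A. X a ^ ?c a) = 0"
    using assms by (intro divided_diff_monomial_sym) auto
  ultimately show ?thesis
    by (simp add: divided_diff_mult divided_diff_X)
qed

section \<open>Schubert polynomials\<close>

lemma finitary_perms_ge:
  assumes "w \<in> finitary_perms"
  obtains N where "M \<le> N" "w permutes {1..N}"
proof -
  from assms obtain N where "w permutes {1..N}" by (auto simp: finitary_perms_def)
  then have "w permutes {1..max M N}" by (rule permutes_subset) auto
  then show ?thesis using that[of "max M N"] by auto
qed

lemma finitary_perms_comp_adjt: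
  assumes "w \<in> finitary_perms" "1 \<le> i"
  shows "w \<circ> adjt i \<in> finitary_perms"
proof -
  obtain N where "Suc i \<le> N" "w permutes {1..N}" using assms(1) finitary_perms_ge by blast
  then have "w \<circ> adjt i permutes {1..N}"
    using assms(2) by (intro permutes_compose permutes_swap_id) auto
  then show ?thesis by (auto simp: finitary_perms_def)
qed

lemma finitary_perms_inj: "w \<in> finitary_perms \<Longrightarrow> inj w"
  by (auto simp: finitary_perms_def permutes_inj)

lemma finitary_perms_0: "w \<in> finitary_perms \<Longrightarrow> w 0 = 0"
  by (auto simp: finitary_perms_def permutes_def)

lemma finitary_perms_pos: "w \<in> finitary_perms \<Longrightarrow> 0 < w a \<longleftrightarrow> 0 < a"
  by (metis finitary_perms_0 finitary_perms_inj injD neq0_conv)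

lemma id_finitary_perms: "id \<in> finitary_perms"
  by (auto simp: finitary_perms_def permutes_id)

text \<open>A potential in place of the number of inversions: undoing a descent strictly increases
  it, and it is bounded on the permutations of \<open>{1..N}\<close>, so it drives inductions in
  both directions.\<close>

definition weighted_sum :: "nat \<Rightarrow> (nat \<Rightarrow> nat) \<Rightarrow> nat" where
  "weighted_sum N w = (\<Sum>i=1..N. i * w i)"

lemma weighted_sum_swap:
  assumes "1 \<le> i" "i < N" "w i > w (Suc i)"
  shows "weighted_sum N w < weighted_sum N (w \<circ> adjt i)"
proof -
  let ?B = "{1..N} - {i, Suc i}"
  have split: "weighted_sum N u = (\<Sum>j\<in>?B. j * u j) + (i * u i + Suc i * u (Suc i))" for u
  proof -
    have "sum (\<lambda>j. j * u j) {1..N} = sum (\<lambda>j. j * u j) ?B + sum (\<lambda>j. j * u j) {i, Suc i}"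
      using assms by (intro sum.subset_diff) auto
    then show ?thesis by (simp add: weighted_sum_def)
  qed
  have "(\<Sum>j\<in>?B. j * (w \<circ> adjt i) j) = (\<Sum>j\<in>?B. j * w j)"
    by (intro sum.cong) (auto simp: transpose_def o_apply)
  then show ?thesis
    using assms(3) by (simp add: split)
qed

lemma permutes_no_ascent:
  assumes w: "w permutes {1..N}" and asc: "\<And>i. 1 \<le> i \<Longrightarrow> i < N \<Longrightarrow> w i > w (Suc i)"
  shows "w = longest_perm N"
proof -
  have img: "w i \<in> {1..N}" if "i \<in> {1..N}" for i
    using permutes_in_image[OF w] that by blast
  have ub: "w i \<le> N + 1 - i" if "1 \<le> i" "i \<le> N" for i
    using that
  proof (induction i rule: nat_induct_at_least)
    case base
    then show ?case using img[of 1] by simp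
  next
    case (Suc i)
    then show ?case using asc[of i] by auto
  qed
  have lb: "w (N - j) \<ge> Suc j" if "j < N" for j
    using that
  proof (induction j)
    case 0
    then show ?case using img[of N] by simp
  next
    case (Suc j)
    then have "Suc (N - Suc j) = N - j" "1 \<le> N - Suc j" by simp_all
    then show ?case using Suc asc[of "N - Suc j"] by auto
  qed
  show ?thesis
  proof
    fix i
    show "w i = longest_perm N i"
    proof (cases "i \<in> {1..N}")
      case True
      then show ?thesis using ub[of i] lb[of "N - i"] by (auto simp: longest_perm_def)
    next
      case False
      then show ?thesis using w by (auto simp: longest_perm_def permutes_def)
    qed
  qed
qed

lemma permutes_no_descent:
  assumes w: "w permutes {1..N}" and asc: "\<And>i. 1 \<le> i \<Longrightarrow> i < N \<Longrightarrow> \<not> w i > w (Suc i)"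
  shows "w = id"
proof -
  have inj: "inj w" using w by (rule permutes_inj)
  have img: "w i \<in> {1..N}" if "i \<in> {1..N}" for i
    using permutes_in_image[OF w] that by blast
  have asc': "w i < w (Suc i)" if "1 \<le> i" "i < N" for i
    using asc[OF that] inj_eq[OF inj, of i "Suc i"] by auto
  have lb: "i \<le> w i" if "1 \<le> i" "i \<le> N" for i
    using that
  proof (induction i rule: nat_induct_at_least)
    case base
    then show ?case using img[of 1] by simp
  next
    case (Suc i)
    then show ?case using asc'[of i] by auto
  qed
  have ub: "w (N - j) \<le> N - j" if "j < N" for j
    using that
  proof (induction j)
    case 0
    then show ?case using img[of N] by simp
  next
    case (Suc j)
    then have "Suc (N - Suc j) = N - j" "1 \<le> N - Suc j" by simp_all
    then show ?case using Suc asc'[of "N - Suc j"] by auto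
  qed
  show ?thesis
  proof
    fix i
    show "w i = id i"
    proof (cases "i \<in> {1..N}")
      case True
      then show ?thesis using lb[of i] ub[of "N - i"] by (auto simp: id_apply)
    next
      case False
      then show ?thesis using w by (auto simp: permutes_def id_apply)
    qed
  qed
qed

text \<open>Undoing descents ends at the identity. The potential never exceeds
  \<open>N * N * N\<close>, so its distance from this bound is a measure.\<close>

lemma finitary_perms_induct [consumes 1, case_names id descent]:
  assumes "w \<in> finitary_perms" and "P id"
    and step: "\<And>w i. w \<in> finitary_perms \<Longrightarrow> 1 \<le> i \<Longrightarrow> w i > w (Suc i) \<Longrightarrow> P (w \<circ> adjt i) \<Longrightarrow> P w"
  shows "P w"
proof -
  obtain N where "w permutes {1..N}" using assms(1) by (auto simp: finitary_perms_def)
  then show ?thesis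
  proof (induction "N * N * N - weighted_sum N w" arbitrary: w rule: less_induct)
    case less
    show ?case
    proof (cases "\<exists>i. 1 \<le> i \<and> i < N \<and> w i > w (Suc i)")
      case False
      then have "w = id" using permutes_no_descent[OF less.prems] by blast
      then show ?thesis using assms(2) by simp
    next
      case True
      then obtain i where i: "1 \<le> i" "i < N" "w i > w (Suc i)" by blast
      have p: "w \<circ> adjt i permutes {1..N}"
        using i less.prems by (intro permutes_compose permutes_swap_id) auto
      have "weighted_sum N v \<le> N * N * N" if "v permutes {1..N}" for v
      proof -
        have "weighted_sum N v \<le> (\<Sum>i=1..N. N * N)"
          unfolding weighted_sum_def
        proof (intro sum_mono mult_le_mono)
          fix j assume "j \<in> {1..N}"
          then show "v j \<le> N" using permutes_in_image[OF that, of j] by simp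
        qed auto
        then show ?thesis by simp
      qed
      from this[OF p] have "P (w \<circ> adjt i)"
        using weighted_sum_swap[OF i] by (intro less.hyps p) auto
      moreover have "w \<in> finitary_perms" using less.prems by (auto simp: finitary_perms_def)
      ultimately show ?thesis using step i by blast
    qed
  qed
qed

section \<open>Existence, uniqueness and stability of Schubert polynomials\<close>

lemma longest_perm_permutes: "longest_perm N permutes {1..N}"
proof (rule bij_imp_permutes)
  show "bij_betw (longest_perm N) {1..N} {1..N}"
    by (rule bij_betwI[where g = "longest_perm N"]) (auto simp: longest_perm_def)
qed (auto simp: longest_perm_def)

lemma schubert_in_permutes: "schubert_in N w f \<Longrightarrow> w permutes {1..N}"
proof (induction rule: schubert_in.induct)
  case (descent w f i)
  then show ?case by (intro permutes_compose permutes_swap_id) auto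
qed (rule longest_perm_permutes)

lemma schubert_in_exists: "w permutes {1..N} \<Longrightarrow> \<exists>f. schubert_in N w f"
proof (induction "weighted_sum N w" arbitrary: w rule: less_induct)
  case less
  show ?case
  proof (cases "\<exists>i. 1 \<le> i \<and> i < N \<and> w i < w (Suc i)")
    case True
    then obtain i where i: "1 \<le> i" "i < N" "w i < w (Suc i)" by blast
    let ?u = "w \<circ> adjt i"
    have p: "?u permutes {1..N}"
      using i less.prems by (intro permutes_compose permutes_swap_id) auto
    have d: "?u i > ?u (Suc i)" using i by simp
    have "weighted_sum N ?u < weighted_sum N w"
      using weighted_sum_swap[OF i(1,2) d] by simp
    then obtain f where "schubert_in N ?u f" using less.hyps p by blast
    from schubert_in.descent[OF this i(1,2) d] show ?thesis by auto
  next
    case False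
    have "w i > w (Suc i)" if "1 \<le> i" "i < N" for i
      using False that permutes_inj[OF less.prems] by (metis injD n_not_Suc_n nat_neq_iff)
    then have "w = longest_perm N" using permutes_no_ascent[OF less.prems] by blast
    then show ?thesis using schubert_in.longest by blast
  qed
qed

lemma schubert_in_cases:
  assumes "schubert_in N w f"
  obtains "w = longest_perm N" "f = (\<Prod>i = 1..N. X i ^ (N - i))"
  | i g where "1 \<le> i" "i < N" "w i < w (Suc i)" "schubert_in N (w \<circ> adjt i) g" "f = divided_diff i g"
  using assms
proof (cases rule: schubert_in.cases)
  case (descent u g i)
  then show ?thesis using that(2)[of i g] by simp
qed (use that in blast)

text \<open>Confluence: two different last steps \<open>i\<close> and \<open>j\<close> are completed
  upwards to a square or, for neighbours, a hexagon of permutations. The induction hypothesis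
  identifies the polynomials along its sides, and commutation or the braid relation of divided
  differences closes it. Induction is on \<open>weighted_sum\<close>, which decreases towards the
  longest element.\<close>

lemma schubert_in_unique:
  "schubert_in N w f \<Longrightarrow> schubert_in N w g \<Longrightarrow> f = g"
proof (induction "weighted_sum N w" arbitrary: w f g rule: less_induct)
  case less
  have IH: "f' = g'" if "1 \<le> i" "i < N" "w i < w (Suc i)" "schubert_in N (w \<circ> adjt i) f'" "schubert_in N (w \<circ> adjt i) g'" for i f' g'
    using weighted_sum_swap[of i N "w \<circ> adjt i"] that by (intro less.hyps[OF _ that(4,5)]) auto
  have p: "w permutes {1..N}" using schubert_in_permutes less.prems by blast
  have perm: "u \<circ> adjt i permutes {1..N}" if "u permutes {1..N}" "1 \<le> i" "i < N" for u i
    using that by (intro permutes_compose permutes_swap_id) auto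
  have diamond: "divided_diff i f' = divided_diff j g'"
    if ij: "i < j" "1 \<le> i" "j < N" "w i < w (Suc i)" "w j < w (Suc j)"
      and f': "schubert_in N (w \<circ> adjt i) f'" and g': "schubert_in N (w \<circ> adjt j) g'" for i j f' g'
  proof (cases "j = Suc i")
    case False
    let ?u = "w \<circ> adjt i \<circ> adjt j"
    obtain q where q: "schubert_in N ?u q"
      using schubert_in_exists[OF perm[OF perm[OF p]], of i j] ij by auto
    have e: "?u \<circ> adjt i = w \<circ> adjt j" using ij False by (auto simp: fun_eq_iff transpose_def o_apply)
    have "schubert_in N (?u \<circ> adjt j) (divided_diff j q)" "schubert_in N (?u \<circ> adjt i) (divided_diff i q)"
      using ij False by (intro schubert_in.descent[OF q]; auto simp: transpose_def o_apply)+
    then have "f' = divided_diff j q" "g' = divided_diff i q"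
      using IH[OF _ _ _ f'] IH[OF _ _ _ g'] ij unfolding e comp_adjt_adjt by auto
    then show ?thesis using divided_diff_commute[of i j q] ij False by simp
  next
    case True
    let ?u = "w \<circ> adjt i \<circ> adjt j \<circ> adjt i"
    obtain q where q: "schubert_in N ?u q"
      using schubert_in_exists[OF perm[OF perm[OF perm[OF p]]], of i j i] ij by auto
    have e: "?u \<circ> adjt i \<circ> adjt j = w \<circ> adjt i" "?u \<circ> adjt j \<circ> adjt i = w \<circ> adjt j"
      using True by (auto simp: fun_eq_iff transpose_def o_apply)
    have "schubert_in N (?u \<circ> adjt i \<circ> adjt j) (divided_diff j (divided_diff i q))"
      using ij True by (intro schubert_in.descent q) (auto simp: transpose_def o_apply)
    moreover have "schubert_in N (?u \<circ> adjt j \<circ> adjt i) (divided_diff i (divided_diff j q))"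
      using ij True by (intro schubert_in.descent q) (auto simp: transpose_def o_apply)
    ultimately have "f' = divided_diff j (divided_diff i q)" "g' = divided_diff i (divided_diff j q)"
      using IH[OF _ _ _ f'] IH[OF _ _ _ g'] ij unfolding e by auto
    then show ?thesis using divided_diff_braid[of i q] True by simp
  qed
  have no_asc: "\<not> longest_perm N i < longest_perm N (Suc i)" if "1 \<le> i" "i < N" for i
    using that by (auto simp: longest_perm_def)
  from less.prems(1) show ?case
  proof (cases rule: schubert_in_cases)
    case 1
    from less.prems(2) show ?thesis
      by (cases rule: schubert_in_cases) (use 1 no_asc in auto)
  next
    case f: (2 i f')
    from less.prems(2) show ?thesis
    proof (cases rule: schubert_in_cases)
      case 1
      then show ?thesis using f no_asc by auto
    next
      case g: (2 j g')
      consider "i = j" | "i < j" | "j < i" by linarith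
      then show ?thesis
      proof cases
        case 1
        then show ?thesis using f g IH by auto
      next
        case 2
        then show ?thesis using f g diamond[of i j f' g'] by auto
      next
        case 3
        then show ?thesis using f g diamond[of j i g' f'] by auto
      qed
    qed
  qed
qed

text \<open>Starting from the longest element of S_(N+1), the value \<open>Suc N\<close> travels
  from the first position to the last. The step numbered \<open>r\<close> lowers the exponent of
  \<open>X r\<close> by one, which turns the staircase for \<open>Suc N\<close> into that for
  \<open>N\<close>; \<open>p r\<close> is the permutation reached after \<open>r\<close>
  steps.\<close>

lemma schubert_in_longest_Suc:
  "schubert_in (Suc N) (longest_perm N) (\<Prod>i = 1..N. X i ^ (N - i))"
proof -
  define p where "p r i = (if i = 0 \<or> Suc N < i then i else if i \<le> r then N + 1 - i else
    if i = Suc r then Suc N else N + 2 - i)" for r i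
  have "schubert_in (Suc N) (p r) (\<Prod>i = 1..Suc N. X i ^ (if i \<le> r then N - i else Suc N - i))" if "r \<le> N" for r
    using that
  proof (induction r)
    case 0
    have "p 0 = longest_perm (Suc N)" by (auto simp: p_def longest_perm_def fun_eq_iff)
    moreover have "(\<Prod>i = 1..Suc N. X i ^ (if i \<le> 0 then N - i else Suc N - i)) = (\<Prod>i = 1..Suc N. X i ^ (Suc N - i))"
      by (intro prod.cong) auto
    ultimately show ?case using schubert_in.longest[of "Suc N"] by simp
  next
    case (Suc r)
    let ?c = "\<lambda>i. if i \<le> r then N - i else Suc N - i"
    have "schubert_in (Suc N) (p r \<circ> adjt (Suc r)) (divided_diff (Suc r) (\<Prod>i = 1..Suc N. X i ^ ?c i))"
      using Suc by (intro schubert_in.descent Suc.IH) (auto simp: p_def)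
    moreover have "p r \<circ> adjt (Suc r) = p (Suc r)"
      using Suc.prems by (auto simp: fun_eq_iff p_def transpose_def o_apply)
    moreover have "divided_diff (Suc r) (\<Prod>i = 1..Suc N. X i ^ ?c i) = (\<Prod>i = 1..Suc N. X i ^ (?c(Suc r := ?c (Suc (Suc r)))) i)"
      using Suc.prems by (intro divided_diff_monomial_step) auto
    moreover have "\<dots> = (\<Prod>i = 1..Suc N. X i ^ (if i \<le> Suc r then N - i else Suc N - i))"
      by (intro prod.cong) auto
    ultimately show ?case by simp
  qed
  from this[of N] have "schubert_in (Suc N) (p N) (\<Prod>i = 1..Suc N. X i ^ (if i \<le> N then N - i else Suc N - i))"
    by simp
  moreover have "p N = longest_perm N" by (auto simp: p_def longest_perm_def fun_eq_iff)
  moreover have "(\<Prod>i = 1..Suc N. X i ^ (if i \<le> N then N - i else Suc N - i)) = (\<Prod>i = 1..N. X i ^ (N - i))"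
    by simp
  ultimately show ?thesis by metis
qed

lemma schubert_in_Suc: "schubert_in N w f \<Longrightarrow> schubert_in (Suc N) w f"
proof (induction rule: schubert_in.induct)
  case (descent w f i)
  then show ?case by (intro schubert_in.descent) auto
qed (rule schubert_in_longest_Suc)

lemma schubert_in_mono: "N \<le> M \<Longrightarrow> schubert_in N w f \<Longrightarrow> schubert_in M w f"
  by (induction M rule: dec_induct) (auto intro: schubert_in_Suc)

lemma schubert_eqI: "schubert_in N w f \<Longrightarrow> schubert w = f"
  unfolding schubert_def
proof (rule the_equality)
  fix g assume "schubert_in N w f" "\<exists>M. schubert_in M w g"
  then obtain M where "schubert_in M w g" by blast
  with \<open>schubert_in N w f\<close> have "schubert_in (max N M) w f" "schubert_in (max N M) w g"
    by (auto intro: schubert_in_mono[OF max.cobounded1] schubert_in_mono[OF max.cobounded2])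
  then show "g = f" by (rule schubert_in_unique[symmetric])
qed blast

lemma schubert_in_schubert: "w permutes {1..N} \<Longrightarrow> schubert_in N w (schubert w)"
  using schubert_in_exists schubert_eqI by metis

lemma schubert_longest: "schubert (longest_perm N) = (\<Prod>i = 1..N. X i ^ (N - i))"
  by (rule schubert_eqI) (rule schubert_in.longest)

lemma schubert_id [simp]: "schubert id = 1"
proof -
  have "longest_perm 0 = id" by (auto simp: longest_perm_def id_apply)
  then show ?thesis using schubert_longest[of 0] by simp
qed

section \<open>Divided differences of Schubert polynomials\<close>

lemma divided_diff_schubert_descent:
  assumes "w \<in> finitary_perms" "1 \<le> i" "w i > w (Suc i)"
  shows "divided_diff i (schubert w) = schubert (w \<circ> adjt i)"
proof -
  obtain N where "Suc i \<le> N" "w permutes {1..N}" using assms(1) finitary_perms_ge by blast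
  then have "schubert_in N (w \<circ> adjt i) (divided_diff i (schubert w))"
    using assms by (intro schubert_in.descent schubert_in_schubert) auto
  then show ?thesis by (rule schubert_eqI[symmetric])
qed

lemma divided_diff_schubert_ascent:
  assumes "w \<in> finitary_perms" "1 \<le> i" "w i < w (Suc i)"
  shows "divided_diff i (schubert w) = 0"
proof -
  have "schubert w = divided_diff i (schubert (w \<circ> adjt i))"
    using divided_diff_schubert_descent[of "w \<circ> adjt i" i] assms by (simp add: finitary_perms_comp_adjt)
  then show ?thesis by simp
qed

lemma schubert_nonzero: "w \<in> finitary_perms \<Longrightarrow> schubert w \<noteq> 0"
proof (induction rule: finitary_perms_induct)
  case id
  show ?case by (metis schubert_id zero_neq_one)
next
  case (descent w i)
  then show ?case using divided_diff_schubert_descent[of w i] by auto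
qed

lemma schubert_homog: "w \<in> finitary_perms \<Longrightarrow> \<exists>d. homog d (schubert w)"
proof -
  have "\<exists>d. homog d f" if "schubert_in N w f" for N w f
    using that
  proof (induction rule: schubert_in.induct)
    case longest
    have "homog (\<Sum>i = 1..N. (N - i) * 1) (\<Prod>i = 1..N. X i ^ (N - i))"
      by (intro homog_prod homog_power homog_X) auto
    then show ?case by blast
  next
    case (descent w f i)
    then obtain d where "homog d f" by blast
    then show ?case
      using homog_0_divided_diff homog_Suc_divided_diff homog.zero by (cases "d = 0") (metis, metis not0_implies_Suc)
  qed
  then show "w \<in> finitary_perms \<Longrightarrow> \<exists>d. homog d (schubert w)"
    using schubert_in_schubert unfolding finitary_perms_def by blast
qed

lemma schubert_const:
  assumes "w \<in> finitary_perms" "w \<noteq> id"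
  shows "Poly_Mapping.lookup (schubert w) 0 = 0"
proof -
  obtain i where i: "1 \<le> i" "w i > w (Suc i)"
    using assms permutes_no_descent[of w] unfolding finitary_perms_def by blast
  have "divided_diff i (schubert w) \<noteq> 0"
    using divided_diff_schubert_descent[OF assms(1) i] schubert_nonzero[OF finitary_perms_comp_adjt] assms i by simp
  moreover obtain d where "homog d (schubert w)" using schubert_homog[OF assms(1)] by blast
  ultimately show ?thesis
    using homog_0_divided_diff homog_Suc_const by (cases "d = 0") auto
qed

section \<open>Coefficient functionals\<close>

text \<open>The coefficient of \<open>v\<close> is the constant term left after divided differences
  along a chain of descents from \<open>v\<close> to \<open>id\<close>. Each of them kills the
  Schubert polynomials without that descent and is injective on the remaining indices, and at the
  end only \<open>id\<close> has a nonzero constant term.\<close>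

lemma dual_functional_exists:
  assumes "v \<in> finitary_perms"
  shows "\<exists>L :: zpoly \<Rightarrow> int. (\<forall>f g. L (f + g) = L f + L g) \<and>
    (\<forall>w\<in>finitary_perms. L (schubert w) = (if w = v then 1 else 0))"
  using assms
proof (induction rule: finitary_perms_induct)
  case id
  have "Poly_Mapping.lookup (schubert w) 0 = (if w = id then 1 else 0)" if "w \<in> finitary_perms" for w
    using schubert_const[OF that] schubert_id lookup_one_zero by metis
  then show ?case
    by (intro exI[of _ "\<lambda>f. Poly_Mapping.lookup f 0"]) (metis lookup_add)
next
  case (descent v i)
  then obtain L :: "zpoly \<Rightarrow> int" where L: "\<And>f g. L (f + g) = L f + L g"
    "\<And>w. w \<in> finitary_perms \<Longrightarrow> L (schubert w) = (if w = v \<circ> adjt i then 1 else 0)"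
    by blast
  have L0: "L 0 = 0" using L(1)[of 0 0] by simp
  have "L (divided_diff i (schubert w)) = (if w = v then 1 else 0)" if w: "w \<in> finitary_perms" for w
  proof (cases "w i > w (Suc i)")
    case True
    have "w \<circ> adjt i = v \<circ> adjt i \<longleftrightarrow> w = v"
      by (metis comp_adjt_adjt)
    then show ?thesis
      using True w descent.hyps
      by (simp add: divided_diff_schubert_descent L(2) finitary_perms_comp_adjt)
  next
    case False
    then have "w i < w (Suc i)"
      using finitary_perms_inj[OF w] by (metis injD n_not_Suc_n nat_neq_iff)
    then show ?thesis
      using w descent.hyps by (auto simp: divided_diff_schubert_ascent L0)
  qed
  then show ?case
    by (intro exI[of _ "\<lambda>f. L (divided_diff i f)"]) (auto simp: divided_diff_add L(1))
qed

text \<open>One chosen functional for each index. The conditions fix its values on the integral span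
  of the Schubert polynomials; the zero functional at other indices keeps additivity
  unconditional.\<close>

definition scoef :: "(nat \<Rightarrow> nat) \<Rightarrow> zpoly \<Rightarrow> int" where
  "scoef v = (if v \<in> finitary_perms then (SOME L. (\<forall>f g. L (f + g) = L f + L g) \<and>
    (\<forall>w\<in>finitary_perms. L (schubert w) = (if w = v then 1 else 0))) else (\<lambda>_. 0))"

lemma scoef_add: "scoef v (f + g) = scoef v f + scoef v g"
  using someI_ex[OF dual_functional_exists[of v]] by (auto simp: scoef_def)

lemma scoef_schubert: "w \<in> finitary_perms \<Longrightarrow> scoef v (schubert w) = (if w = v then 1 else 0)"
  using someI_ex[OF dual_functional_exists[of v]] by (auto simp: scoef_def)

lemma scoef_0 [simp]: "scoef v 0 = 0"
  using scoef_add[of v 0 0] by simp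

lemma scoef_uminus: "scoef v (- f) = - scoef v f"
  using scoef_add[of v f "- f"] by simp

lemma scoef_diff: "scoef v (f - g) = scoef v f - scoef v g"
  using scoef_add[of v f "- g"] by (simp add: scoef_uminus)

lemma scoef_sum: "scoef v (sum f A) = (\<Sum>a\<in>A. scoef v (f a))"
  by (induction A rule: infinite_finite_induct) (auto simp: scoef_add)

lemma scoef_of_int: "scoef v (of_int c * f) = c * scoef v f"
proof (induction c rule: int_induct[where k = 0])
  case (step1 i)
  then show ?case by (simp add: distrib_right scoef_add)
next
  case (step2 i)
  then show ?case by (simp add: left_diff_distrib scoef_diff)
qed simp

text \<open>The integral span, generated so that identities between additive maps can be checked on
  Schubert polynomials by rule induction. The parameter records which permutations may
  occur.\<close>

inductive_set schubert_span :: "(nat \<Rightarrow> nat) set \<Rightarrow> zpoly set" for S where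
  zero: "0 \<in> schubert_span S"
| base: "w \<in> S \<Longrightarrow> schubert w \<in> schubert_span S"
| add: "f \<in> schubert_span S \<Longrightarrow> g \<in> schubert_span S \<Longrightarrow> f + g \<in> schubert_span S"
| uminus: "f \<in> schubert_span S \<Longrightarrow> - f \<in> schubert_span S"

lemma schubert_span_diff: "f \<in> schubert_span S \<Longrightarrow> g \<in> schubert_span S \<Longrightarrow> f - g \<in> schubert_span S"
  using schubert_span.add[OF _ schubert_span.uminus] by fastforce

lemma schubert_span_sum: "(\<And>a. a \<in> A \<Longrightarrow> f a \<in> schubert_span S) \<Longrightarrow> sum f A \<in> schubert_span S"
  by (induction A rule: infinite_finite_induct) (auto intro: schubert_span.intros)

lemma schubert_span_mono: "f \<in> schubert_span S \<Longrightarrow> S \<subseteq> T \<Longrightarrow> f \<in> schubert_span T"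
  by (induction rule: schubert_span.induct) (auto intro: schubert_span.intros)

lemma schubert_span_mult:
  assumes "f \<in> schubert_span S" and "\<And>w. w \<in> S \<Longrightarrow> schubert w * g \<in> schubert_span T"
  shows "f * g \<in> schubert_span T"
  using assms(1)
  by (induction rule: schubert_span.induct)
     (auto intro: schubert_span.intros assms(2) simp: distrib_right)

lemma schubert_span_expansion:
  assumes "f \<in> schubert_span S" "S \<subseteq> finitary_perms"
  shows "\<exists>T. finite T \<and> T \<subseteq> S \<and> (\<forall>v. v \<notin> T \<longrightarrow> scoef v f = 0) \<and>
    f = (\<Sum>v\<in>T. of_int (scoef v f) * schubert v)"
  using assms(1)
proof (induction rule: schubert_span.induct)
  case (base w)
  then show ?case using assms(2)
    by (intro exI[of _ "{w}"]) (auto simp: scoef_schubert)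
next
  case (add f g)
  then obtain T U where T: "finite T" "T \<subseteq> S" "\<forall>v. v \<notin> T \<longrightarrow> scoef v f = 0" "f = (\<Sum>v\<in>T. of_int (scoef v f) * schubert v)"
    and U: "finite U" "U \<subseteq> S" "\<forall>v. v \<notin> U \<longrightarrow> scoef v g = 0" "g = (\<Sum>v\<in>U. of_int (scoef v g) * schubert v)"
    by blast
  have "f = (\<Sum>v\<in>T\<union>U. of_int (scoef v f) * schubert v)"
    using T U by (subst T(4), intro sum.mono_neutral_left) auto
  moreover have "g = (\<Sum>v\<in>T\<union>U. of_int (scoef v g) * schubert v)"
    using T U by (subst U(4), intro sum.mono_neutral_left) auto
  ultimately have "f + g = (\<Sum>v\<in>T\<union>U. of_int (scoef v f) * schubert v) + (\<Sum>v\<in>T\<union>U. of_int (scoef v g) * schubert v)"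
    by (rule arg_cong2[where f = "(+)"])
  also have "\<dots> = (\<Sum>v\<in>T\<union>U. of_int (scoef v (f + g)) * schubert v)"
    by (simp add: scoef_add distrib_right sum.distrib)
  finally have "f + g = (\<Sum>v\<in>T\<union>U. of_int (scoef v (f + g)) * schubert v)" .
  moreover have "\<forall>v. v \<notin> T \<union> U \<longrightarrow> scoef v (f + g) = 0"
    using T(3) U(3) by (simp add: scoef_add)
  ultimately show ?case using T(1,2) U(1,2) by (intro exI[of _ "T \<union> U"]) blast
next
  case (uminus f)
  then obtain T where T: "finite T" "T \<subseteq> S" "\<forall>v. v \<notin> T \<longrightarrow> scoef v f = 0" "f = (\<Sum>v\<in>T. of_int (scoef v f) * schubert v)"
    by blast
  have "- f = - (\<Sum>v\<in>T. of_int (scoef v f) * schubert v)"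
    using T(4) by (rule arg_cong[where f = uminus])
  also have "\<dots> = (\<Sum>v\<in>T. of_int (scoef v (- f)) * schubert v)"
    by (simp add: scoef_uminus sum_negf)
  finally have "- f = (\<Sum>v\<in>T. of_int (scoef v (- f)) * schubert v)" .
  moreover have "\<forall>v. v \<notin> T \<longrightarrow> scoef v (- f) = 0"
    using T(3) by (simp add: scoef_uminus)
  ultimately show ?case using T(1,2) by blast
qed auto

text \<open>Membership in the span provides one expansion, and applying \<open>scoef\<close> to any
  other expansion returns its coefficients. This resolves the definite description in
  \<open>schubert_coeff\<close>.\<close>

lemma schubert_coeff_eq_scoef:
  assumes "f \<in> schubert_span finitary_perms"
  shows "schubert_coeff f v = scoef v f"
proof -
  obtain T where T: "finite T" "T \<subseteq> finitary_perms" "\<forall>v. v \<notin> T \<longrightarrow> scoef v f = 0"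
    "f = (\<Sum>v\<in>T. of_int (scoef v f) * schubert v)"
    using schubert_span_expansion[OF assms] by blast
  have "schubert_coeff f = (\<lambda>v. scoef v f)"
    unfolding schubert_coeff_def
  proof (rule the_equality, intro conjI)
    have sub: "{v. scoef v f \<noteq> 0} \<subseteq> T" using T by auto
    then show "finite {v. scoef v f \<noteq> 0}" "{v. scoef v f \<noteq> 0} \<subseteq> finitary_perms"
      using T finite_subset by auto
    show "f = (\<Sum>v | scoef v f \<noteq> 0. of_int (scoef v f) * schubert v)"
      using T sub by (subst T(4), intro sum.mono_neutral_right) auto
  next
    fix c assume c: "finite {v. c v \<noteq> 0} \<and> {v. c v \<noteq> 0} \<subseteq> finitary_perms \<and>
      f = (\<Sum>v | c v \<noteq> 0. of_int (c v) * schubert v)"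
    show "c = (\<lambda>v. scoef v f)"
    proof
      fix v
      have "scoef v f = scoef v (\<Sum>v | c v \<noteq> 0. of_int (c v) * schubert v)"
        using c by metis
      also have "\<dots> = (\<Sum>u | c u \<noteq> 0. c u * (if u = v then 1 else 0))"
        using c by (auto simp: scoef_sum scoef_of_int scoef_schubert intro!: sum.cong)
      also have "\<dots> = c v"
        using c by (simp add: if_distrib[of "\<lambda>x. _ * x"] cong: if_cong)
      finally show "c v = scoef v f" by simp
    qed
  qed
  then show ?thesis by simp
qed

lemma scoef_divided_diff:
  assumes "f \<in> schubert_span finitary_perms" "v \<in> finitary_perms" "1 \<le> i" "v i > v (Suc i)"
  shows "scoef v f = scoef (v \<circ> adjt i) (divided_diff i f)"
  using assms(1)
proof (induction rule: schubert_span.induct)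
  case (base w)
  show ?case
  proof (cases "w i > w (Suc i)")
    case True
    have "w \<circ> adjt i = v \<circ> adjt i \<longleftrightarrow> w = v" by (metis comp_adjt_adjt)
    then show ?thesis using True base assms
      by (simp add: divided_diff_schubert_descent finitary_perms_comp_adjt scoef_schubert)
  next
    case False
    then have "w i < w (Suc i)"
      using finitary_perms_inj[OF base] by (metis injD n_not_Suc_n nat_neq_iff)
    then show ?thesis using base assms by (auto simp: divided_diff_schubert_ascent scoef_schubert)
  qed
qed (auto simp: scoef_add scoef_uminus divided_diff_add divided_diff_uminus)

section \<open>Permutations that increase after position k\<close>

text \<open>All descents lie among the first \<open>k\<close> positions. The tail then lists the
  remaining values in increasing order, so the first \<open>k\<close> values encode the
  permutation.\<close>

definition fronts :: "nat \<Rightarrow> (nat \<Rightarrow> nat) set" where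
  "fronts k = {w \<in> finitary_perms. \<forall>i>k. w i < w (Suc i)}"

lemma fronts_finitary: "w \<in> fronts k \<Longrightarrow> w \<in> finitary_perms"
  by (simp add: fronts_def)

lemma fronts_tail_less:
  assumes "w \<in> fronts k" "k < i" "i < j"
  shows "w i < w j"
  using assms(3)
proof (induction j)
  case (Suc j)
  have "w j < w (Suc j)" if "i \<le> j" using assms(1,2) that by (auto simp: fronts_def)
  then show ?case using Suc by (cases "i = j") auto
qed simp

lemma fronts_inj: "w \<in> fronts k \<Longrightarrow> inj w"
  using fronts_finitary finitary_perms_inj by blast

lemma fronts_inj_eq: "w \<in> fronts k \<Longrightarrow> w a = w b \<longleftrightarrow> a = b"
  using fronts_inj inj_eq by metis

lemma fronts_pos: "w \<in> fronts k \<Longrightarrow> 0 < a \<Longrightarrow> 0 < w a"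
  using fronts_finitary finitary_perms_pos by blast

lemma finitary_perms_surj: "w \<in> finitary_perms \<Longrightarrow> \<exists>j. w j = y"
  unfolding finitary_perms_def using permutes_surj[of w] surjD[of w y] by fastforce

text \<open>At the first disagreement beyond \<open>k\<close>, the smaller of the two values has to
  occur in the other permutation at a later position, against its increasing tail.\<close>

lemma fronts_eqI:
  assumes w: "w \<in> fronts k" and v: "v \<in> fronts k" and eq: "\<And>a. 1 \<le> a \<Longrightarrow> a \<le> k \<Longrightarrow> w a = v a"
  shows "w = v"
proof
  fix i
  show "w i = v i"
  proof (induction i rule: less_induct)
    case (less i)
    have less_False: "\<not> x i < y i" if x: "x \<in> fronts k" and y: "y \<in> fronts k"
      and IH: "\<And>j. j < i \<Longrightarrow> x j = y j" and "k < i" for x y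
    proof
      assume *: "x i < y i"
      obtain j where j: "y j = x i" using finitary_perms_surj[OF fronts_finitary[OF y]] by blast
      have "\<not> j < i" using IH[of j] j fronts_inj_eq[OF x, of i j] by auto
      moreover have "\<not> i < j" using fronts_tail_less[OF y \<open>k < i\<close>, of j] j * by auto
      ultimately show False using j * by (metis less_irrefl nat_neq_iff)
    qed
    consider "i = 0" | "1 \<le> i" "i \<le> k" | "k < i" by linarith
    then show ?case
    proof cases
      case 1
      then show ?thesis using w v by (simp add: finitary_perms_0 fronts_finitary)
    next
      case 3
      then show ?thesis using less_False[OF w v] less_False[OF v w] less by (metis nat_neq_iff)
    qed (use eq in auto)
  qed
qed

text \<open>Among the permutations of \<open>{1..N}\<close> with the prescribed front, one of
  maximal \<open>weighted_sum\<close> has an increasing tail, because undoing a descent there would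
  increase the potential.\<close>

lemma fronts_ext:
  assumes inj: "inj_on f {1..k}" and pos: "\<And>a. 1 \<le> a \<Longrightarrow> a \<le> k \<Longrightarrow> 1 \<le> f a"
  shows "\<exists>w\<in>fronts k. \<forall>a\<in>{1..k}. w a = f a"
proof -
  define N where "N = max k (Max (insert 0 (f ` {1..k})))"
  have fN: "f ` {1..k} \<subseteq> {1..N}"
  proof (rule image_subsetI)
    fix a assume a: "a \<in> {1..k}"
    then have "f a \<le> Max (insert 0 (f ` {1..k}))" by (intro Max_ge) auto
    then have "f a \<le> N" unfolding N_def by (rule le_trans) simp
    then show "f a \<in> {1..N}" using pos[of a] a by simp
  qed
  have "card ({1..N} - {1..k}) = card ({1..N} - f ` {1..k})"
  proof -
    have "card (f ` {1..k}) = k" using card_image[OF inj] by simp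
    moreover have "{1..k} \<subseteq> {1..N}" by (simp add: N_def)
    ultimately show ?thesis using fN by (simp add: card_Diff_subset)
  qed
  then obtain g where g: "bij_betw g ({1..N} - {1..k}) ({1..N} - f ` {1..k})"
    using finite_same_card_bij[OF finite_Diff[OF finite_atLeastAtMost] finite_Diff[OF finite_atLeastAtMost]] by blast
  define w0 where "w0 a = (if a \<in> {1..k} then f a else if a \<in> {1..N} then g a else a)" for a
  have "bij_betw w0 ({1..k} \<union> ({1..N} - {1..k})) (f ` {1..k} \<union> ({1..N} - f ` {1..k}))"
  proof (rule bij_betw_combine)
    show "bij_betw w0 {1..k} (f ` {1..k})"
      using inj_on_imp_bij_betw[OF inj] by (rule bij_betw_cong[THEN iffD1, rotated]) (auto simp: w0_def)
    show "bij_betw w0 ({1..N} - {1..k}) ({1..N} - f ` {1..k})"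
      using g by (rule bij_betw_cong[THEN iffD1, rotated]) (auto simp: w0_def)
  qed auto
  moreover have "{1..k} \<union> ({1..N} - {1..k}) = {1..N}" "f ` {1..k} \<union> ({1..N} - f ` {1..k}) = {1..N}"
    using fN by (auto simp: N_def)
  ultimately have "bij_betw w0 {1..N} {1..N}" by simp
  then have "w0 permutes {1..N}"
    by (rule bij_imp_permutes) (auto simp: w0_def N_def)
  define S where "S = {w. w permutes {1..N} \<and> (\<forall>a\<in>{1..k}. w a = f a)}"
  have "finite S" unfolding S_def by (rule finite_subset[OF _ finite_permutations[of "{1..N}"]]) auto
  moreover have "w0 \<in> S" using \<open>w0 permutes {1..N}\<close> by (auto simp: S_def w0_def)
  ultimately obtain w where w: "w \<in> S" and max: "\<And>u. u \<in> S \<Longrightarrow> weighted_sum N u \<le> weighted_sum N w"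
  proof -
    have "Max (weighted_sum N ` S) \<in> weighted_sum N ` S"
      using \<open>finite S\<close> \<open>w0 \<in> S\<close> by (intro Max_in) auto
    then obtain w where "w \<in> S" "weighted_sum N w = Max (weighted_sum N ` S)" by auto
    then show ?thesis using that[of w] \<open>finite S\<close> by simp
  qed
  have p: "w permutes {1..N}" using w by (simp add: S_def)
  have "w i < w (Suc i)" if "k < i" for i
  proof (rule ccontr)
    assume "\<not> w i < w (Suc i)"
    then have d: "w (Suc i) < w i" using permutes_inj[OF p] by (metis injD n_not_Suc_n nat_neq_iff)
    show False
    proof (cases "i < N")
      case True
      have "w \<circ> adjt i \<in> S"
        using w True that by (auto simp: S_def o_apply transpose_def intro!: permutes_compose permutes_swap_id)
      then show False using max[of "w \<circ> adjt i"] weighted_sum_swap[of i N w] True d that by auto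
    next
      case False
      then have "w (Suc i) = Suc i" using p by (auto simp: permutes_def)
      moreover have "w i \<le> i"
        using False p permutes_in_image[OF p, of i] by (cases "i = N") (auto simp: permutes_def)
      ultimately show False using d by simp
    qed
  qed
  then have "w \<in> fronts k" using p by (auto simp: fronts_def finitary_perms_def)
  then show ?thesis using w by (auto simp: S_def)
qed

definition ext :: "nat \<Rightarrow> (nat \<Rightarrow> nat) \<Rightarrow> nat \<Rightarrow> nat" where
  "ext k f = (SOME w. w \<in> fronts k \<and> (\<forall>a\<in>{1..k}. w a = f a))"

lemma
  assumes "inj_on f {1..k}" "\<And>a. 1 \<le> a \<Longrightarrow> a \<le> k \<Longrightarrow> 1 \<le> f a"
  shows ext_fronts: "ext k f \<in> fronts k"
    and ext_apply: "\<And>a. 1 \<le> a \<Longrightarrow> a \<le> k \<Longrightarrow> ext k f a = f a"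
proof -
  have "\<exists>w. w \<in> fronts k \<and> (\<forall>a\<in>{1..k}. w a = f a)" using fronts_ext[OF assms] by blast
  from someI_ex[OF this] show "ext k f \<in> fronts k" "\<And>a. 1 \<le> a \<Longrightarrow> a \<le> k \<Longrightarrow> ext k f a = f a"
    by (auto simp: ext_def)
qed

lemma ext_eqI:
  assumes "w \<in> fronts k" "\<And>a. 1 \<le> a \<Longrightarrow> a \<le> k \<Longrightarrow> w a = f a"
  shows "ext k f = w"
proof -
  have "inj_on f {1..k}"
    using fronts_inj_eq[OF assms(1)] assms(2) by (auto simp: inj_on_def) (metis Suc_leI)
  moreover have "1 \<le> f a" if "1 \<le> a" "a \<le> k" for a
    using fronts_pos[OF assms(1), of a] assms(2)[OF that] that by simp
  ultimately show ?thesis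
    using assms by (intro fronts_eqI[of _ k]) (auto simp: ext_fronts ext_apply)
qed

lemma fronts_comp_transpose:
  assumes "w \<in> fronts k" "1 \<le> a" "a \<le> k" "1 \<le> b" "b \<le> k"
  shows "w \<circ> transpose a b \<in> fronts k"
proof -
  obtain N where N: "k \<le> N" "w permutes {1..N}"
    using finitary_perms_ge[OF fronts_finitary[OF assms(1)]] by blast
  have "w \<circ> transpose a b permutes {1..N}"
    using N assms by (intro permutes_compose permutes_swap_id) auto
  then have "w \<circ> transpose a b \<in> finitary_perms" by (auto simp: finitary_perms_def)
  then show ?thesis using assms by (auto simp: fronts_def o_apply transpose_def)
qed

lemma fronts_comp_adjt: "w \<in> fronts k \<Longrightarrow> 1 \<le> i \<Longrightarrow> i < k \<Longrightarrow> w \<circ> adjt i \<in> fronts k"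
  by (rule fronts_comp_transpose) auto

text \<open>Undoing ascents sorts the front into decreasing order. The base case is the dominant
  one, where the Schubert polynomial is a monomial; the step is designed to be proved by one divided
  difference.\<close>

lemma fronts_sort_induct [consumes 1, case_names decreasing swap]:
  assumes "w \<in> fronts k"
    and dec: "\<And>w. w \<in> fronts k \<Longrightarrow> (\<And>i. 1 \<le> i \<Longrightarrow> i < k \<Longrightarrow> w (Suc i) < w i) \<Longrightarrow> P w"
    and swap: "\<And>w i. w \<in> fronts k \<Longrightarrow> 1 \<le> i \<Longrightarrow> i < k \<Longrightarrow> w i < w (Suc i) \<Longrightarrow> P (w \<circ> adjt i) \<Longrightarrow> P w"
  shows "P w"
  using assms(1)
proof (induction "weighted_sum k w" arbitrary: w rule: less_induct)
  case less
  show ?case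
  proof (cases "\<exists>i. 1 \<le> i \<and> i < k \<and> w i < w (Suc i)")
    case True
    then obtain i where i: "1 \<le> i" "i < k" "w i < w (Suc i)" by blast
    have "P (w \<circ> adjt i)"
      using weighted_sum_swap[of i k "w \<circ> adjt i"] i less.prems by (intro less.hyps fronts_comp_adjt) auto
    then show ?thesis using swap[OF less.prems i] by blast
  next
    case False
    then show ?thesis
      using less.prems by (intro dec) (metis fronts_inj_eq n_not_Suc_n nat_neq_iff)+
  qed
qed

lemma divided_diff_fronts_tail: "w \<in> fronts k \<Longrightarrow> k < i \<Longrightarrow> divided_diff i (schubert w) = 0"
  by (rule divided_diff_schubert_ascent) (auto simp: fronts_def)

section \<open>Dominant permutations\<close>

definition move_right :: "(nat \<Rightarrow> nat) \<Rightarrow> nat \<Rightarrow> nat \<Rightarrow> nat \<Rightarrow> nat" where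
  "move_right w q L a = (if q \<le> a \<and> a < q + L then w (Suc a) else if a = q + L then w q else w a)"

text \<open>The large value \<open>w q\<close> is moved right one place at a time. When it stands at
  \<open>q + j\<close>, the exponents there and at the next place still differ by exactly one, so
  \<open>divided_diff_monomial_step\<close> applies again.\<close>

lemma schubert_staircase:
  assumes "w \<in> finitary_perms" "1 \<le> q" "q + L \<le> n"
    and "schubert w = (\<Prod>a=1..n. X a ^ c a)"
    and "\<And>j. j \<le> L \<Longrightarrow> c (q + j) + j = c q"
    and "\<And>j. 1 \<le> j \<Longrightarrow> j \<le> L \<Longrightarrow> w (q + j) < w q"
  shows "move_right w q L \<in> finitary_perms \<and>
    schubert (move_right w q L) = (\<Prod>a=1..n. X a ^ (if q \<le> a \<and> a < q + L then c a - 1 else c a))"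
  using assms(3,5,6)
proof (induction L)
  case 0
  have "move_right w q 0 = w" by (auto simp: move_right_def fun_eq_iff)
  moreover have "(\<Prod>a=1..n. X a ^ (if q \<le> a \<and> a < q + 0 then c a - 1 else c a)) = (\<Prod>a=1..n. X a ^ c a)"
    by (intro prod.cong) auto
  ultimately show ?case using assms by simp
next
  case (Suc L)
  let ?v = "move_right w q L" and ?c = "\<lambda>a. if q \<le> a \<and> a < q + L then c a - 1 else c a"
  have IH: "?v \<in> finitary_perms" "schubert ?v = (\<Prod>a=1..n. X a ^ ?c a)"
    using Suc.IH Suc.prems by auto
  have eq: "move_right w q (Suc L) = ?v \<circ> adjt (q + L)"
    by (auto simp: fun_eq_iff move_right_def transpose_def o_apply)
  have "divided_diff (q + L) (schubert ?v) = schubert (?v \<circ> adjt (q + L))"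
    using IH Suc.prems(3)[of "Suc L"] assms(2)
    by (intro divided_diff_schubert_descent) (auto simp: move_right_def)
  moreover have "divided_diff (q + L) (\<Prod>a=1..n. X a ^ ?c a)
      = (\<Prod>a=1..n. X a ^ (?c(q + L := ?c (Suc (q + L)))) a)"
    using Suc.prems(1) Suc.prems(2)[of L] Suc.prems(2)[of "Suc L"] assms(2)
    by (intro divided_diff_monomial_step) auto
  moreover have "\<dots> = (\<Prod>a=1..n. X a ^ (if q \<le> a \<and> a < q + Suc L then c a - 1 else c a))"
  proof (intro prod.cong refl arg_cong2[where f = "(^)"])
    fix a
    have "c (Suc (q + L)) = c (q + L) - 1" using Suc.prems(2)[of L] Suc.prems(2)[of "Suc L"] by simp
    then show "(?c(q + L := ?c (Suc (q + L)))) a = (if q \<le> a \<and> a < q + Suc L then c a - 1 else c a)"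
      by auto
  qed
  ultimately show ?case
    using IH assms(2) by (simp add: eq finitary_perms_comp_adjt)
qed

lemma strict_decreasing_less:
  fixes w :: "nat \<Rightarrow> nat"
  assumes "\<And>i. m \<le> i \<Longrightarrow> i < n \<Longrightarrow> w (Suc i) < w i" "m \<le> a" "a < b" "b \<le> n"
  shows "w b < w a"
  using assms(3,4)
proof (induction b)
  case (Suc b)
  then show ?case using assms(1)[of b] assms(2) by (cases "a = b") auto
qed simp

text \<open>
  Inserting the smallest missing value into the decreasing block gives a longer decreasing block,
  from which the original permutation is recovered by a staircase move.
\<close>

lemma schubert_dominant:
  assumes "w \<in> fronts k" "\<And>i. 1 \<le> i \<Longrightarrow> i < k \<Longrightarrow> w (Suc i) < w i"
  shows "schubert w = (\<Prod>a=1..k. X a ^ (w a - 1))"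
proof -
  obtain N where "k \<le> N" "w permutes {1..N}"
    using finitary_perms_ge[OF fronts_finitary[OF assms(1)]] by blast
  then show ?thesis
    using assms
  proof (induction "N - k" arbitrary: k w)
    case 0
    then have "w = longest_perm N" by (intro permutes_no_ascent) auto
    then have "schubert w = (\<Prod>i = 1..N. X i ^ (N - i))" by (simp add: schubert_longest)
    also have "\<dots> = (\<Prod>a=1..k. X a ^ (w a - 1))"
      using \<open>w = longest_perm N\<close> 0 by (intro prod.cong) (auto simp: longest_perm_def)
    finally show ?case .
  next
    case (Suc x)
    define t where "t = w (Suc k)"
    have dec: "w b < w a" if "1 \<le> a" "a < b" "b \<le> k" for a b
      using strict_decreasing_less[of 1 k w] Suc.prems(4) that by auto
    define s where "s = card {a\<in>{1..k}. t < w a}"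
    have s: "{a\<in>{1..k}. t < w a} = {1..s}"
    proof -
      obtain s' where s': "{a\<in>{1..k}. t < w a} = {1..s'}"
      proof (cases "\<exists>a\<in>{1..k}. t < w a")
        case True
        define m where "m = Max {a\<in>{1..k}. t < w a}"
        have m: "m \<in> {a\<in>{1..k}. t < w a}" unfolding m_def using True by (intro Max_in) auto
        have le: "a \<le> m" if "a \<in> {a\<in>{1..k}. t < w a}" for a
          unfolding m_def using that by (intro Max_ge) auto
        have gt: "t < w a" if "1 \<le> a" "a \<le> m" for a
          using dec[of a m] that m by (cases "a = m") auto
        have "{a\<in>{1..k}. t < w a} = {1..m}"
        proof (intro equalityI subsetI)
          fix a assume "a \<in> {1..m}"
          then show "a \<in> {a\<in>{1..k}. t < w a}" using gt[of a] m by simp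
        next
          fix a assume "a \<in> {a\<in>{1..k}. t < w a}"
          then show "a \<in> {1..m}" using le[of a] by simp
        qed
        then show ?thesis using that by blast
      next
        case False
        then show ?thesis using that[of 0] by auto
      qed
      then show ?thesis unfolding s_def by simp
    qed
    have mem: "a \<in> {1..s} \<longleftrightarrow> a \<in> {1..k} \<and> t < w a" for a
      unfolding s[symmetric] by simp
    have sk: "s \<le> k" using mem[of s] by (cases "s = 0") simp_all
    have gt: "t < w a" if "1 \<le> a" "a \<le> s" for a using mem[of a] that by simp
    have lt: "w a < t" if "s < a" "a \<le> k" for a
    proof -
      have "\<not> t < w a" using mem[of a] that by simp
      moreover have "w a \<noteq> t" using fronts_inj_eq[OF Suc.prems(3)] that by (auto simp: t_def)
      ultimately show ?thesis by simp
    qed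
    have t1: "1 \<le> t" unfolding t_def using fronts_pos[OF Suc.prems(3), of "Suc k"] by simp
    have "w ` {s<..k} = {1..<t}"
    proof (intro equalityI subsetI)
      fix y assume "y \<in> w ` {s<..k}"
      then obtain a where a: "y = w a" "s < a" "a \<le> k" by auto
      then show "y \<in> {1..<t}" using lt[of a] fronts_pos[OF Suc.prems(3), of a] by auto
    next
      fix y assume y: "y \<in> {1..<t}"
      obtain j where j: "w j = y" using finitary_perms_surj[OF fronts_finitary[OF Suc.prems(3)]] by blast
      have "j \<noteq> 0" using j y finitary_perms_0[OF fronts_finitary[OF Suc.prems(3)]] by (cases j) auto
      moreover have "j \<le> k"
      proof (rule ccontr)
        assume "\<not> j \<le> k"
        then have "w (Suc k) \<le> w j"
          using fronts_tail_less[OF Suc.prems(3), of "Suc k" j] by (cases "j = Suc k") auto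
        then show False using j y by (simp add: t_def)
      qed
      ultimately show "y \<in> w ` {s<..k}" using gt[of j] j y by (cases "j \<le> s") auto
    qed
    \<comment> \<open>The values below the smallest missing value \<open>t\<close> fill exactly the
      positions after \<open>s\<close>. Being decreasing and \<open>t - 1\<close> in number, they
      are \<open>t - 1\<close>, ..., 1, which \<open>val\<close> states.\<close>
    then have "card {s<..k} = card {1..<t}"
      using card_image[of w "{s<..k}"] fronts_inj[OF Suc.prems(3)] by (metis inj_on_subset subset_UNIV)
    then have kst: "k = s + t - 1" "k + 1 = s + t" using sk t1 by auto
    have ub: "w (s + j) \<le> t - j" if "1 \<le> j" "s + j \<le> k" for j
      using that
    proof (induction j rule: nat_induct_at_least)
      case base
      then show ?case using lt[of "Suc s"] by simp
    next
      case (Suc j)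
      then show ?case using Suc.IH dec[of "s + j" "Suc (s + j)"] by auto
    qed
    have lb: "w (k - j) \<ge> Suc j" if "j < k" "s \<le> k - j - 1" for j
      using that
    proof (induction j)
      case 0
      then show ?case using fronts_pos[OF Suc.prems(3), of k] by simp
    next
      case (Suc j)
      then have "w (k - j) < w (k - Suc j)" by (intro dec) auto
      moreover have "Suc j \<le> w (k - j)" using Suc.prems by (intro Suc.IH) linarith+
      ultimately show ?case by linarith
    qed
    have val: "w (s + j) = t - j" if "1 \<le> j" "s + j \<le> k" for j
    proof -
      have "k - (s + j) < k" "s \<le> k - (k - (s + j)) - 1" "k - (k - (s + j)) = s + j" "Suc (k - (s + j)) = t - j"
        using that kst by linarith+
      then show ?thesis using ub[OF that] lb[of "k - (s + j)"] by simp
    qed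
    \<comment> \<open>\<open>\<sigma>\<close> takes \<open>t\<close> from position
      \<open>Suc k\<close> to the place right after the \<open>s\<close> larger values, so that
      \<open>u\<close> decreases on \<open>Suc k\<close> positions.\<close>
    define \<sigma> where "\<sigma> a = (if a = Suc s then Suc k else if Suc s < a \<and> a \<le> Suc k then a - 1 else a)" for a
    define \<sigma>' where "\<sigma>' a = (if a = Suc k then Suc s else if Suc s \<le> a \<and> a \<le> k then Suc a else a)" for a
    have "\<sigma> permutes {1..Suc k}"
    proof (rule bij_imp_permutes)
      show "bij_betw \<sigma> {1..Suc k} {1..Suc k}"
        by (rule bij_betwI[where g = \<sigma>']) (use sk in \<open>auto simp: \<sigma>_def \<sigma>'_def\<close>)
    qed (use sk in \<open>auto simp: \<sigma>_def\<close>)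
    then have "\<sigma> permutes {1..N}" using Suc.hyps(2) by (rule_tac permutes_subset) auto
    define u where "u = w \<circ> \<sigma>"
    have u: "u permutes {1..N}" unfolding u_def
      by (rule permutes_compose) fact+
    have ua: "u a = (if a \<le> s then w a else if a = Suc s then t else if a \<le> Suc k then w (a - 1) else w a)" for a
      using sk by (auto simp: u_def \<sigma>_def o_apply t_def)
    have uf: "u \<in> fronts (Suc k)"
      using u Suc.prems(3) sk by (auto simp: fronts_def finitary_perms_def ua)
    have ud: "u (Suc i) < u i" if "1 \<le> i" "i < Suc k" for i
      using that sk gt[of i] lt[of i] dec[of i "Suc i"] dec[of "i - 1" i]
      by (auto simp: ua not_le less_Suc_eq_le)
    have "schubert u = (\<Prod>a=1..Suc k. X a ^ (u a - 1))"
      using Suc.hyps(2) by (intro Suc.hyps(1) u uf ud) auto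
    then have "schubert (move_right u (Suc s) (t - 1))
      = (\<Prod>a=1..Suc k. X a ^ (if Suc s \<le> a \<and> a < Suc s + (t - 1) then u a - 1 - 1 else u a - 1))"
      using kst t1 val uf lt
      by (intro conjunct2[OF schubert_staircase]) (auto simp: ua fronts_finitary)
    moreover have "move_right u (Suc s) (t - 1) = w"
      using kst t1 by (auto simp: fun_eq_iff move_right_def ua t_def)
    moreover have "(\<Prod>a=1..Suc k. X a ^ (if Suc s \<le> a \<and> a < Suc s + (t - 1) then u a - 1 - 1 else u a - 1))
      = (\<Prod>a=1..k. X a ^ (w a - 1))"
    proof -
      \<comment> \<open>The last value of the longer block is 1, hence contributes exponent 0, and
        the product ends at \<open>k\<close>.\<close>
      have last: "u (Suc k) - 1 = 0"
        using val[of "t - 1"] kst t1 by (cases "t = 1") (auto simp: ua)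
      define e where "e a = (if Suc s \<le> a \<and> a < Suc s + (t - 1) then u a - 1 - 1 else u a - 1)" for a
      have e: "e a = w a - 1" if "a \<in> {1..k}" for a
      proof (cases "a \<le> s")
        case False
        then show ?thesis
          using that kst val[of "a - s"] val[of "a - 1 - s"] by (cases "a = Suc s") (auto simp: ua e_def)
      qed (auto simp: ua e_def)
      have "e (Suc k) = 0" using last kst t1 by (simp add: e_def)
      then have "(\<Prod>a=1..Suc k. X a ^ e a) = (\<Prod>a=1..k. X a ^ e a)" by simp
      also have "\<dots> = (\<Prod>a=1..k. X a ^ (w a - 1))" using e by (intro prod.cong) auto
      finally show ?thesis by (simp add: e_def)
    qed
    ultimately show ?case by simp
  qed
qed

lemma divided_diff_X_power: "j \<noteq> i \<Longrightarrow> j \<noteq> Suc i \<Longrightarrow> divided_diff i (X j ^ n) = 0"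
  by (simp add: divided_diff_eq_0_iff swap_vars_power)

text \<open>For a decreasing front both sides are explicit monomials. The divided differences that
  unsort the front stay below position \<open>k\<close> and do not touch the variable
  \<open>X (Suc k)\<close>.\<close>

lemma schubert_append:
  assumes "v \<in> fronts k" "u \<in> fronts (Suc k)" "\<And>a. 1 \<le> a \<Longrightarrow> a \<le> k \<Longrightarrow> u a = v a"
    and "\<And>a. 1 \<le> a \<Longrightarrow> a \<le> k \<Longrightarrow> u (Suc k) < v a"
  shows "schubert u = schubert v * X (Suc k) ^ (u (Suc k) - 1)"
  using assms
proof (induction arbitrary: u rule: fronts_sort_induct)
  case (decreasing v)
  have "schubert u = (\<Prod>a=1..Suc k. X a ^ (u a - 1))"
  proof (rule schubert_dominant)
    fix i assume "1 \<le> i" "i < Suc k"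
    then show "u (Suc i) < u i" using decreasing by (cases "i = k") auto
  qed (use decreasing in auto)
  moreover have "schubert v = (\<Prod>a=1..k. X a ^ (v a - 1))"
    by (rule schubert_dominant) (use decreasing in auto)
  ultimately show ?case using decreasing by simp
next
  case (swap v i)
  let ?v = "v \<circ> adjt i" and ?u = "u \<circ> adjt i"
  have "schubert ?u = schubert ?v * X (Suc k) ^ (?u (Suc k) - 1)"
  proof (rule swap.IH)
    show "?u \<in> fronts (Suc k)" using swap by (intro fronts_comp_adjt) auto
  qed (use swap in \<open>auto simp: o_apply transpose_def\<close>)
  moreover have "?u (Suc k) = u (Suc k)" using swap by (auto simp: o_apply transpose_def)
  ultimately have "divided_diff i (schubert ?u) = divided_diff i (schubert ?v * X (Suc k) ^ (u (Suc k) - 1))"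
    by simp
  also have "\<dots> = divided_diff i (schubert ?v) * X (Suc k) ^ (u (Suc k) - 1)"
    using swap by (intro divided_diff_mult_sym divided_diff_X_power) auto
  finally show ?case
    using swap divided_diff_schubert_descent[of ?v i] divided_diff_schubert_descent[of ?u i]
      fronts_finitary[OF swap.hyps(1)] fronts_finitary[OF swap.prems(1)]
    by (simp add: finitary_perms_comp_adjt)
qed

declare One_nat_def [simp del]

section \<open>Complete homogeneous symmetric polynomials\<close>

fun hsym_nat :: "nat \<Rightarrow> nat \<Rightarrow> zpoly" where
  "hsym_nat k 0 = 1"
| "hsym_nat 0 (Suc m) = 0"
| "hsym_nat (Suc k) (Suc m) = hsym_nat k (Suc m) + X (Suc k) * hsym_nat (Suc k) m"

text \<open>The index is an integer so that the recursion, the Pieri rule and the Jacobi-Trudi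
  identity hold with shifted indices and without side conditions; negative indices give 0.\<close>

definition hsym :: "nat \<Rightarrow> int \<Rightarrow> zpoly" where
  "hsym k n = (if n < 0 then 0 else hsym_nat k (nat n))"

lemma hsym_neg [simp]: "n < 0 \<Longrightarrow> hsym k n = 0"
  by (simp add: hsym_def)

lemma hsym_0 [simp]: "hsym 0 n = (if n = 0 then 1 else 0)"
  by (cases "nat n") (auto simp: hsym_def)

lemma hsym_Suc: "hsym (Suc k) n = hsym k n + X (Suc k) * hsym (Suc k) (n - 1)"
proof (cases "n > 0")
  case True
  then have "nat n = Suc (nat (n - 1))" by simp
  then show ?thesis using True by (simp add: hsym_def)
qed (auto simp: hsym_def)

lemma int_induct_from_neg [case_names neg step]:
  assumes "\<And>n::int. n < 0 \<Longrightarrow> P n" "\<And>n. 0 \<le> n \<Longrightarrow> P (n - 1) \<Longrightarrow> P n"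
  shows "P n"
proof (cases "n < 0")
  case False
  then have "- 1 \<le> n" by simp
  then show ?thesis
  proof (induction n rule: int_ge_induct)
    case (step i)
    then show ?case using assms(2)[of "i + 1"] by simp
  qed (use assms(1) in simp)
qed (use assms(1) in simp)

lemma hsym_unfold:
  "hsym (Suc k) n = (\<Sum>j<d. X (Suc k) ^ j * hsym k (n - int j)) + X (Suc k) ^ d * hsym (Suc k) (n - int d)"
proof (induction d)
  case (Suc d)
  have "hsym (Suc k) (n - int d) = hsym k (n - int d) + X (Suc k) * hsym (Suc k) (n - int (Suc d))"
    by (subst hsym_Suc) (simp add: algebra_simps)
  then show ?case using Suc by (simp add: algebra_simps)
qed simp

lemma divided_diff_hsym_high: "k < i \<Longrightarrow> divided_diff i (hsym k n) = 0"
proof (induction k arbitrary: n)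
  case (Suc k)
  show ?case
  proof (induction n rule: int_induct_from_neg)
    case (step n)
    then show ?case using Suc
      by (subst hsym_Suc) (simp add: divided_diff_add divided_diff_mult divided_diff_X)
  qed simp
qed simp

text \<open>A divided difference in the last variable adds a variable. This is how the Pieri rule
  for \<open>k\<close> positions yields terms of the rule for \<open>k + 1\<close> positions in
  \<open>pieri_dominant\<close>.\<close>

lemma divided_diff_hsym: "1 \<le> k \<Longrightarrow> divided_diff k (hsym k n) = hsym (Suc k) (n - 1)"
proof -
  assume "1 \<le> k"
  then obtain l where k: "k = Suc l" by (cases k) auto
  let ?s = "swap_vars k"
  have inv: "?s (hsym l n) = hsym l n" for n
    using divided_diff_hsym_high[of l k n] k by (simp add: divided_diff_eq_0_iff)
  have "hsym k n - ?s (hsym k n) = (X k - X (Suc k)) * hsym (Suc k) (n - 1)" for n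
  proof (induction n rule: int_induct_from_neg)
    case (step n)
    have s: "?s (hsym k n) = hsym l n + X (Suc k) * ?s (hsym k (n - 1))"
      by (simp add: k hsym_Suc[of l n] swap_vars_add swap_vars_mult inv[unfolded k])
    have "hsym k n - ?s (hsym k n) = X k * hsym k (n - 1) - X (Suc k) * ?s (hsym k (n - 1))"
      unfolding s by (simp add: k hsym_Suc[of l n])
    also have "\<dots> = (X k - X (Suc k)) * hsym k (n - 1) + X (Suc k) * (hsym k (n - 1) - ?s (hsym k (n - 1)))"
      by (simp add: algebra_simps)
    also have "\<dots> = (X k - X (Suc k)) * (hsym k (n - 1) + X (Suc k) * hsym (Suc k) (n - 1 - 1))"
      unfolding step by (simp add: algebra_simps)
    also have "\<dots> = (X k - X (Suc k)) * hsym (Suc k) (n - 1)"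
      by (simp add: hsym_Suc[of k "n - 1"])
    finally show ?case .
  qed simp
  then show ?thesis by (intro divided_diff_eqI) (simp add: mult.commute)
qed

text \<open>With \<open>Suc i\<close> variables the polynomial is itself a divided difference at
  \<open>i\<close> and thus killed; further variables enter only through factors that are symmetric
  at \<open>i\<close>.\<close>

lemma divided_diff_hsym_low:
  assumes "1 \<le> i" "i < k"
  shows "divided_diff i (hsym k n) = 0"
proof -
  have "Suc i \<le> k" using assms by simp
  then show ?thesis
  proof (induction k arbitrary: n rule: nat_induct_at_least)
    case base
    have "hsym (Suc i) n = divided_diff i (hsym i (n + 1))" using divided_diff_hsym[OF assms(1), of "n + 1"] by simp
    then show ?case by simp
  next
    case (Suc k)
    show ?case
    proof (induction n rule: int_induct_from_neg)
      case (step n)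
      then show ?case using Suc
        by (subst hsym_Suc) (simp add: divided_diff_add divided_diff_mult divided_diff_X)
    qed simp
  qed
qed

section \<open>The Pieri rule\<close>

text \<open>
  The support of the Pieri rule for permutations that increase after the front \<open>A\<close>: the front
  values are particles moving to the right, and one may pass another only if the latter rests and
  stands at an earlier position. The degree of the step is \<open>hops\<close>, the number of initially vacant
  sites that are passed or reached.
\<close>

definition pieri_rel :: "nat set \<Rightarrow> (nat \<Rightarrow> nat) \<Rightarrow> (nat \<Rightarrow> nat) \<Rightarrow> bool" where
  "pieri_rel A V Y \<longleftrightarrow> (\<forall>a\<in>A. V a \<le> Y a) \<and>
     (\<forall>a\<in>A. \<forall>e\<in>A. V a < V e \<longrightarrow> Y a < V e \<or> (e < a \<and> Y e = V e \<and> V e < Y a))"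

definition hops :: "nat set \<Rightarrow> (nat \<Rightarrow> nat) \<Rightarrow> (nat \<Rightarrow> nat) \<Rightarrow> nat" where
  "hops A V Y = (\<Sum>a\<in>A. card ({V a<..Y a} - V ` A))"

lemma pieri_rel_le: "pieri_rel A V Y \<Longrightarrow> a \<in> A \<Longrightarrow> V a \<le> Y a"
  by (simp add: pieri_rel_def)

lemma pieri_relD:
  "pieri_rel A V Y \<Longrightarrow> a \<in> A \<Longrightarrow> e \<in> A \<Longrightarrow> V a < V e \<Longrightarrow> Y a < V e \<or> (e < a \<and> Y e = V e \<and> V e < Y a)"
  by (simp add: pieri_rel_def)

lemma pieri_rel_cong:
  "(\<And>a. a \<in> A \<Longrightarrow> V a = V' a) \<Longrightarrow> (\<And>a. a \<in> A \<Longrightarrow> Y a = Y' a) \<Longrightarrow> pieri_rel A V Y = pieri_rel A V' Y'"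
  by (simp add: pieri_rel_def)

lemma hops_cong:
  assumes "\<And>a. a \<in> A \<Longrightarrow> V a = V' a" "\<And>a. a \<in> A \<Longrightarrow> Y a = Y' a"
  shows "hops A V Y = hops A V' Y'"
proof -
  have "V ` A = V' ` A" using assms(1) by (rule image_cong[OF refl])
  then show ?thesis unfolding hops_def using assms by (intro sum.cong) auto
qed

definition pieri_set :: "nat \<Rightarrow> (nat \<Rightarrow> nat) \<Rightarrow> int \<Rightarrow> (nat \<Rightarrow> nat) set" where
  "pieri_set k w m = {v \<in> fronts k. pieri_rel {1..k} w v \<and> int (hops {1..k} w v) = m}"

lemma finite_fronts_bounded: "finite {v \<in> fronts k. \<forall>a\<in>{1..k}. v a \<le> B}"
proof (rule finite_imageD)
  show "inj_on (\<lambda>v. restrict v {1..k}) {v \<in> fronts k. \<forall>a\<in>{1..k}. v a \<le> B}"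
  proof (rule inj_onI)
    fix v u assume "v \<in> {v \<in> fronts k. \<forall>a\<in>{1..k}. v a \<le> B}" "u \<in> {v \<in> fronts k. \<forall>a\<in>{1..k}. v a \<le> B}"
      and eq: "restrict v {1..k} = restrict u {1..k}"
    moreover have "v a = u a" if "1 \<le> a" "a \<le> k" for a
      using fun_cong[OF eq, of a] that by simp
    ultimately show "v = u" by (intro fronts_eqI[of v k u]) auto
  qed
  show "finite ((\<lambda>v. restrict v {1..k}) ` {v \<in> fronts k. \<forall>a\<in>{1..k}. v a \<le> B})"
    by (rule finite_subset[of _ "{1..k} \<rightarrow>\<^sub>E {..B}"]) (auto intro!: finite_PiE)
qed

lemma finite_pieri_set: "finite (pieri_set k w m)"
proof (rule finite_subset)
  let ?B = "(\<Sum>a\<in>{1..k}. w a) + nat m + k"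
  show "pieri_set k w m \<subseteq> {v \<in> fronts k. \<forall>a\<in>{1..k}. v a \<le> ?B}"
  proof clarify
    fix v assume "v \<in> pieri_set k w m"
    then have v: "v \<in> fronts k" "int (hops {1..k} w v) = m" by (auto simp: pieri_set_def)
    moreover have "v a \<le> ?B" if a: "a \<in> {1..k}" for a
    proof -
      have "card ({w a<..v a} - w ` {1..k}) \<le> hops {1..k} w v"
        unfolding hops_def using a by (intro member_le_sum) auto
      moreover have "card {w a<..v a} - card (w ` {1..k}) \<le> card ({w a<..v a} - w ` {1..k})"
        by (rule diff_card_le_card_Diff) simp
      moreover have "card (w ` {1..k}) \<le> k" using card_image_le[of "{1..k}" w] by simp
      moreover have "w a \<le> (\<Sum>a\<in>{1..k}. w a)" using a by (intro member_le_sum) auto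
      ultimately show ?thesis using v(2) by simp
    qed
    ultimately show "v \<in> fronts k \<and> (\<forall>a\<in>{1..k}. v a \<le> ?B)" by blast
  qed
qed (rule finite_fronts_bounded)

text \<open>The last particle starts lowest and stays below all other starting sites, so it meets
  nobody: it moves independently and each site it advances by is vacant.\<close>

lemma pieri_rel_append_below:
  assumes dec: "\<And>a. 1 \<le> a \<Longrightarrow> a \<le> l \<Longrightarrow> w (Suc l) < w a" and less: "\<And>a. 1 \<le> a \<Longrightarrow> a \<le> l \<Longrightarrow> v (Suc l) < w a"
  shows "pieri_rel {1..Suc l} w v \<longleftrightarrow> pieri_rel {1..l} w v \<and> w (Suc l) \<le> v (Suc l)"
    and "w (Suc l) \<le> v (Suc l) \<Longrightarrow> hops {1..Suc l} w v = hops {1..l} w v + (v (Suc l) - w (Suc l))"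
proof -
  show "pieri_rel {1..Suc l} w v \<longleftrightarrow> pieri_rel {1..l} w v \<and> w (Suc l) \<le> v (Suc l)"
  proof -
    have S: "{1..Suc l} = insert (Suc l) {1..l}" by (simp add: atLeastAtMostSuc_conv)
    have N: "\<forall>a\<in>{1..l}. \<not> w a < w (Suc l)" "\<forall>a\<in>{1..l}. v (Suc l) < w a"
      using assms by (auto simp: not_less intro: less_imp_le)
    show ?thesis unfolding pieri_rel_def S using N less_irrefl[of "w (Suc l)"] by blast
  qed
  assume "w (Suc l) \<le> v (Suc l)"
  have "card ({w a<..v a} - w ` {1..Suc l}) = card ({w a<..v a} - w ` {1..l})" if "a \<in> {1..l}" for a
    using dec[of a] that by (intro arg_cong[where f = card]) (auto simp: atLeastAtMostSuc_conv)
  moreover have "{w (Suc l)<..v (Suc l)} - w ` {1..Suc l} = {w (Suc l)<..v (Suc l)}"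
    using less by (fastforce simp: atLeastAtMostSuc_conv)
  ultimately show "hops {1..Suc l} w v = hops {1..l} w v + (v (Suc l) - w (Suc l))"
    by (simp add: hops_def)
qed

text \<open>The last particle starts lowest, and the next one up is \<open>l\<close>. Passing it
  forces \<open>l\<close> to rest; from there on the mover behaves like particle \<open>l\<close>
  itself. The correction counts the vacant sites strictly between the two starting points.\<close>

lemma pieri_rel_append_pass:
  assumes dec: "\<And>a b. 1 \<le> a \<Longrightarrow> a < b \<Longrightarrow> b \<le> Suc l \<Longrightarrow> w b < w a" and l: "1 \<le> l" and gt: "w l < v (Suc l)"
  shows "pieri_rel {1..Suc l} w v \<longleftrightarrow> pieri_rel {1..l} w (v(l := v (Suc l))) \<and> v l = w l"
    and "v l = w l \<Longrightarrow> hops {1..Suc l} w v = hops {1..l} w (v(l := v (Suc l))) + (w l - w (Suc l) - 1)"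
proof -
  let ?v = "v(l := v (Suc l))"
  show "pieri_rel {1..Suc l} w v \<longleftrightarrow> pieri_rel {1..l} w ?v \<and> v l = w l"
  proof
    assume r: "pieri_rel {1..Suc l} w v"
    then have le: "w a \<le> v a" if "1 \<le> a" "a \<le> Suc l" for a using that by (auto simp: pieri_rel_def)
    have pr: "v a < w e \<or> e < a \<and> v e = w e \<and> w e < v a" if "1 \<le> a" "a \<le> Suc l" "1 \<le> e" "e \<le> Suc l" "w a < w e" for a e
      using r that unfolding pieri_rel_def by (meson atLeastAtMost_iff)
    have vl: "v l = w l" using pr[of "Suc l" l] dec[of l "Suc l"] l gt by auto
    have "pieri_rel {1..l} w ?v"
      unfolding pieri_rel_def
    proof (intro conjI ballI impI)
      fix a assume "a \<in> {1..l}"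
      then show "w a \<le> ?v a" using le[of a] gt by auto
    next
      fix a e assume ae: "a \<in> {1..l}" "e \<in> {1..l}" "w a < w e"
      then have "\<not> a < e" using dec[of a e] by auto
      moreover have "a \<noteq> e" using ae by auto
      ultimately have "e < a" by simp
      show "?v a < w e \<or> e < a \<and> ?v e = w e \<and> w e < ?v a"
      proof (cases "a = l")
        case True
        then show ?thesis using pr[of "Suc l" e] ae dec[of e "Suc l"] \<open>e < a\<close> by auto
      next
        case False
        then show ?thesis using pr[of a e] ae \<open>e < a\<close> by auto
      qed
    qed
    with vl show "pieri_rel {1..l} w ?v \<and> v l = w l" by simp
  next
    assume r: "pieri_rel {1..l} w ?v \<and> v l = w l"
    then have le: "w a \<le> ?v a" if "1 \<le> a" "a \<le> l" for a using that by (auto simp: pieri_rel_def)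
    have pr: "?v a < w e \<or> e < a \<and> ?v e = w e \<and> w e < ?v a" if "1 \<le> a" "a \<le> l" "1 \<le> e" "e \<le> l" "w a < w e" for a e
      using r that unfolding pieri_rel_def by (meson atLeastAtMost_iff)
    show "pieri_rel {1..Suc l} w v"
      unfolding pieri_rel_def
    proof (intro conjI ballI impI)
      fix a assume a: "a \<in> {1..Suc l}"
      consider "a = Suc l" | "a = l" | "a < l" using a by fastforce
      then show "w a \<le> v a"
      proof cases
        case 1
        then show ?thesis using dec[of l "Suc l"] l gt by auto
      qed (use le[of a] a r in auto)
    next
      fix a e assume ae: "a \<in> {1..Suc l}" "e \<in> {1..Suc l}" "w a < w e"
      then have "\<not> a < e" using dec[of a e] by auto
      moreover have "a \<noteq> e" using ae by auto
      ultimately have "e < a" by simp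
      consider "a = Suc l" "e = l" | "a = Suc l" "e < l" | "a = l" | "a < l" using ae \<open>e < a\<close> by fastforce
      then show "v a < w e \<or> e < a \<and> v e = w e \<and> w e < v a"
      proof cases
        case 1
        then show ?thesis using r gt by auto
      next
        case 2
        then show ?thesis using pr[of l e] dec[of e l] ae l by auto
      next
        case 3
        then show ?thesis using r ae by auto
      next
        case 4
        then show ?thesis using pr[of a e] ae \<open>e < a\<close> by auto
      qed
    qed
  qed
  assume vl: "v l = w l"
  let ?W = "w ` {1..l}" and ?W' = "w ` {1..Suc l}"
  obtain m where m: "l = Suc m" using l by (cases l) auto
  have 1: "card ({w a<..v a} - ?W') = card ({w a<..?v a} - ?W)" if "a \<in> {1..m}" for a
    using dec[of a "Suc l"] that m by (intro arg_cong[where f = card]) (auto simp: atLeastAtMostSuc_conv)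
  have "{w (Suc l)<..v (Suc l)} - ?W' = {w (Suc l)<..<w l} \<union> ({w l<..v (Suc l)} - ?W)"
  proof (intro equalityI subsetI)
    fix z assume z: "z \<in> {w (Suc l)<..v (Suc l)} - ?W'"
    then have "z \<noteq> w l" using l by auto
    then show "z \<in> {w (Suc l)<..<w l} \<union> ({w l<..v (Suc l)} - ?W)" using z by auto
  next
    fix z assume z: "z \<in> {w (Suc l)<..<w l} \<union> ({w l<..v (Suc l)} - ?W)"
    have wl: "w (Suc l) < w l" using dec[of l "Suc l"] l by simp
    have "w l \<le> w a" if "a \<in> {1..l}" for a using dec[of a l] that by (cases "a = l") auto
    then have "z \<notin> ?W'" using z wl by (fastforce simp: atLeastAtMostSuc_conv)
    then show "z \<in> {w (Suc l)<..v (Suc l)} - ?W'" using z wl gt by auto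
  qed
  then have 2: "card ({w (Suc l)<..v (Suc l)} - ?W') = (w l - w (Suc l) - 1) + card ({w l<..v (Suc l)} - ?W)"
    by (simp add: card_Un_disjoint disjoint_iff)
  show "hops {1..Suc l} w v = hops {1..l} w ?v + (w l - w (Suc l) - 1)"
    using 1 2 vl by (simp add: hops_def m)
qed

lemma pieri_rel_inj:
  assumes "pieri_rel A V Y" "inj_on V A"
  shows "inj_on Y A"
proof (rule inj_onI)
  have *: "Y a \<noteq> Y e" if "a \<in> A" "e \<in> A" "V a < V e" for a e
    using assms(1) that unfolding pieri_rel_def by (metis leD less_irrefl)
  fix a e assume "a \<in> A" "e \<in> A" "Y a = Y e"
  then show "a = e" using *[of a e] *[of e a] assms(2) by (metis inj_onD linorder_neqE_nat)
qed

lemma fronts_inj_on: "w \<in> fronts k \<Longrightarrow> inj_on w A"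
  using fronts_inj by (metis inj_on_subset subset_UNIV)

lemma fronts_restrict:
  assumes "w \<in> fronts k" "l \<le> k"
  shows "ext l w \<in> fronts l" "\<And>a. 1 \<le> a \<Longrightarrow> a \<le> l \<Longrightarrow> ext l w a = w a"
  using ext_fronts[of w l] ext_apply[of w l] assms fronts_inj_on[OF assms(1)] fronts_pos[OF assms(1)]
  by (simp_all add: Suc_le_eq One_nat_def)

text \<open>Induction on \<open>k\<close>, removing the lowest particle. Unfolding
  \<open>hsym\<close> in the last variable \<open>d\<close> times separates its behaviour: the term
  with \<open>X ?k ^ j\<close> lets it advance by \<open>j\<close> without reaching the next
  particle (set \<open>P\<close>), and the remainder lets it pass (set \<open>Q\<close>). The
  remainder is obtained from the induction hypothesis by a divided difference at
  \<open>l\<close>.\<close>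

lemma pieri_dominant:
  assumes "w \<in> fronts k" "\<And>i. 1 \<le> i \<Longrightarrow> i < k \<Longrightarrow> w (Suc i) < w i"
  shows "schubert w * hsym k m = (\<Sum>v\<in>pieri_set k w m. schubert v)"
  using assms
proof (induction k arbitrary: w m)
  case 0
  have id: "id \<in> fronts 0" by (simp add: fronts_def id_finitary_perms)
  then have "u = id" if "u \<in> fronts 0" for u using fronts_eqI[OF that id] by simp
  then have "w = id" "pieri_set 0 w m = (if m = 0 then {id} else {})"
    using 0 id by (auto simp: pieri_set_def pieri_rel_def hops_def)
  then show ?case by (simp del: id_apply)
next
  case (Suc l)
  let ?k = "Suc l"
  have dec: "w b < w a" if "1 \<le> a" "a < b" "b \<le> ?k" for a b
    using strict_decreasing_less[of 1 ?k w] Suc.prems(2) that by auto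
  have wpos: "1 \<le> w a" if "1 \<le> a" for a using fronts_pos[OF Suc.prems(1), of a] that by simp
  define w' where "w' = ext l w"
  have w': "w' \<in> fronts l" "\<And>a. 1 \<le> a \<Longrightarrow> a \<le> l \<Longrightarrow> w' a = w a"
    unfolding w'_def using fronts_restrict[OF Suc.prems(1), of l] by auto
  have IH: "schubert w' * hsym l n = (\<Sum>v\<in>pieri_set l w' n. schubert v)" for n
    using w' dec by (intro Suc.IH) auto
  have rel': "pieri_rel {1..l} w' v = pieri_rel {1..l} w v" "hops {1..l} w' v = hops {1..l} w v" for v
    using w' by (auto intro!: pieri_rel_cong hops_cong)
  define c where "c = w ?k - 1"
  have sw: "schubert w = schubert w' * X ?k ^ c"
    unfolding c_def using w' dec by (intro schubert_append Suc.prems(1)) auto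
  \<comment> \<open>The number of sites, its start included, that the last particle can occupy
    before the next one. Without another particle, \<open>m + 1\<close> makes the remainder of the
    unfolding vanish.\<close>
  define d where "d = (if l = 0 then nat m + 1 else w l - w ?k)"
  have d_pos: "l \<noteq> 0 \<Longrightarrow> w l = w ?k + d \<and> 0 < d" using dec[of l ?k] by (auto simp: d_def)
  define P where "P = {v \<in> pieri_set ?k w m. l \<noteq> 0 \<longrightarrow> v ?k < w l}"
  define Q where "Q = {v \<in> pieri_set ?k w m. l \<noteq> 0 \<and> w l < v ?k}"
  have PQ: "pieri_set ?k w m = P \<union> Q" "P \<inter> Q = {}"
  proof -
    have "v ?k \<noteq> w l" if "v \<in> pieri_set ?k w m" "l \<noteq> 0" for v
      using that dec[of l ?k] pieri_relD[of "{1..?k}" w v ?k l] by (auto simp: pieri_set_def)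
    then show "pieri_set ?k w m = P \<union> Q" unfolding P_def Q_def by (auto) (meson linorder_neqE_nat)
    show "P \<inter> Q = {}" by (auto simp: P_def Q_def)
  qed
  have P: "(\<Sum>v\<in>P. schubert v) = (\<Sum>j<d. schubert w' * hsym l (m - int j) * X ?k ^ (c + j))"
  proof -
    have "(\<Sum>j<d. schubert w' * hsym l (m - int j) * X ?k ^ (c + j))
       = (\<Sum>j<d. \<Sum>v\<in>pieri_set l w' (m - int j). schubert v * X ?k ^ (c + j))"
      by (simp add: IH sum_distrib_right)
    also have "\<dots> = (\<Sum>(j, v)\<in>(SIGMA j:{..<d}. pieri_set l w' (m - int j)). schubert v * X ?k ^ (c + j))"
      by (rule sum.Sigma) (auto simp: finite_pieri_set)
    also have "\<dots> = (\<Sum>v\<in>P. schubert v)"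
    proof (rule sum.reindex_bij_witness[where i = "\<lambda>v. (v ?k - w ?k, ext l v)" and j = "\<lambda>(j, v). ext ?k (v(?k := w ?k + j))"])
      fix jv assume "jv \<in> (SIGMA j:{..<d}. pieri_set l w' (m - int j))"
      then obtain j v where jv: "jv = (j, v)" "j < d" "v \<in> pieri_set l w' (m - int j)" by auto
      let ?f = "v(?k := w ?k + j)" and ?u = "ext ?k (v(?k := w ?k + j))"
      have v: "v \<in> fronts l" "pieri_rel {1..l} w v" "int (hops {1..l} w v) = m - int j"
        using jv by (auto simp: pieri_set_def rel')
      have less: "w ?k + j < w a" if "1 \<le> a" "a \<le> l" for a
        using d_pos jv(2) that dec[of a l] by (cases "a = l") auto
      have less': "w ?k + j < v a" if "1 \<le> a" "a \<le> l" for a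
        using less[OF that] pieri_rel_le[OF v(2), of a] that by auto
      have "inj_on ?f {1..?k}"
      proof (rule inj_onI)
        fix a b assume "a \<in> {1..?k}" "b \<in> {1..?k}" "?f a = ?f b"
        then show "a = b" using less'[of a] less'[of b] fronts_inj_eq[OF v(1), of a b]
          by (auto split: if_splits simp: le_Suc_eq)
      qed
      moreover have "1 \<le> ?f a" if "1 \<le> a" "a \<le> ?k" for a
        using fronts_pos[OF v(1), of a] wpos[of ?k] that by auto
      ultimately have u: "?u \<in> fronts ?k" "\<And>a. 1 \<le> a \<Longrightarrow> a \<le> ?k \<Longrightarrow> ?u a = ?f a"
        by (auto simp: ext_fronts ext_apply)
      have uk: "?u ?k = w ?k + j" and ul: "\<And>a. 1 \<le> a \<Longrightarrow> a \<le> l \<Longrightarrow> ?u a = v a" using u(2) by auto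
      have ext: "ext l ?u = v" using v(1) ul by (intro ext_eqI) auto
      have relu: "pieri_rel {1..l} w ?u = pieri_rel {1..l} w v" "hops {1..l} w ?u = hops {1..l} w v"
        using ul by (auto intro!: pieri_rel_cong hops_cong)
      have "?u \<in> P"
        using u(1) v relu pieri_rel_append_below[of l w ?u] dec less uk jv(2) d_pos
        by (auto simp: P_def pieri_set_def)
      then show "(case jv of (j, v) \<Rightarrow> ext ?k (v(?k := w ?k + j))) \<in> P" by (simp add: jv)
      show "((case jv of (j, v) \<Rightarrow> ext ?k (v(?k := w ?k + j))) ?k - w ?k, ext l (case jv of (j, v) \<Rightarrow> ext ?k (v(?k := w ?k + j)))) = jv"
        by (simp add: jv uk ext)
      have "schubert ?u = schubert v * X ?k ^ (?u ?k - 1)"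
        using v(1) u(1) ul less' uk by (intro schubert_append) auto
      then show "schubert (case jv of (j, v) \<Rightarrow> ext ?k (v(?k := w ?k + j))) = (case jv of (j, v) \<Rightarrow> schubert v * X ?k ^ (c + j))"
        using wpos[of ?k] by (simp add: jv uk c_def)
    next
      fix v assume "v \<in> P"
      then have v: "v \<in> fronts ?k" "pieri_rel {1..?k} w v" "int (hops {1..?k} w v) = m" "l \<noteq> 0 \<Longrightarrow> v ?k < w l"
        by (auto simp: P_def pieri_set_def)
      have less: "v ?k < w a" if "1 \<le> a" "a \<le> l" for a
        using v(4) that dec[of a l] by (cases "a = l") auto
      have ul: "ext l v \<in> fronts l" "\<And>a. 1 \<le> a \<Longrightarrow> a \<le> l \<Longrightarrow> ext l v a = v a"
        using fronts_restrict[OF v(1), of l] by auto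
      have relu: "pieri_rel {1..l} w (ext l v) = pieri_rel {1..l} w v" "hops {1..l} w (ext l v) = hops {1..l} w v"
        using ul by (auto intro!: pieri_rel_cong hops_cong)
      have r: "pieri_rel {1..l} w v" "w ?k \<le> v ?k" "hops {1..?k} w v = hops {1..l} w v + (v ?k - w ?k)"
        using pieri_rel_append_below[of l w v] dec less v(2) by auto
      have "v ?k - w ?k < d"
      proof (cases "l = 0")
        case True
        have "int (v ?k - w ?k) \<le> m" using v(3) r(3) by linarith
        then show ?thesis using True by (simp add: d_def)
      next
        case False
        then show ?thesis using v(4) d_pos r(2) by linarith
      qed
      then show "(v ?k - w ?k, ext l v) \<in> (SIGMA j:{..<d}. pieri_set l w' (m - int j))"
        using ul(1) r relu v(3) by (simp add: pieri_set_def rel')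
      show "(case (v ?k - w ?k, ext l v) of (j, v) \<Rightarrow> ext ?k (v(?k := w ?k + j))) = v"
        using v(1) ul(2) r(2) by (auto intro!: ext_eqI simp: le_Suc_eq)
    qed
    finally show ?thesis by simp
  qed
  have Q: "(\<Sum>v\<in>Q. schubert v) = schubert w' * X ?k ^ (c + d) * hsym ?k (m - int d)"
  proof (cases "l = 0")
    case True
    then have "m - int d < 0" "Q = {}" by (auto simp: d_def Q_def)
    then show ?thesis by simp
  next
    case False
    then have wl: "w l = w ?k + d" "0 < d" using d_pos by auto
    define e where "e = w l - 1"
    have e: "e = c + d" using wl wpos[of ?k] by (simp add: e_def c_def)
    define n where "n = m - int d + 1"
    define B where "B = {v \<in> pieri_set l w' n. w l < v l}"
    \<comment> \<open>The exponent \<open>e\<close> is that of \<open>X l\<close> in the dominant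
      monomial, so the product is symmetric in \<open>X l\<close> and \<open>X ?k\<close>, and the
      divided difference acts on \<open>hsym l n\<close> alone, where it produces
      \<open>hsym ?k (n - 1)\<close>.\<close>
    have "divided_diff l (X ?k ^ e * schubert w') = 0"
    proof -
      have "schubert w' = (\<Prod>a=1..l. X a ^ (w' a - 1))"
        using w' dec by (intro schubert_dominant) auto
      then have "X ?k ^ e * schubert w' = (\<Prod>a=1..?k. X a ^ (if a = ?k then e else w' a - 1))"
        by (simp add: mult.commute)
      also have "divided_diff l \<dots> = 0"
        using False w'(2)[of l] by (intro divided_diff_monomial_sym) (auto simp: e_def)
      finally show ?thesis .
    qed
    then have "divided_diff l (X ?k ^ e * schubert w' * hsym l n) = X ?k ^ e * schubert w' * hsym ?k (n - 1)"
      using False by (simp add: divided_diff_mult_sym divided_diff_hsym)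
    then have "schubert w' * X ?k ^ (c + d) * hsym ?k (m - int d) = divided_diff l (X ?k ^ e * (schubert w' * hsym l n))"
      by (simp add: e n_def mult_ac)
    also have "\<dots> = (\<Sum>v\<in>pieri_set l w' n. divided_diff l (X ?k ^ e * schubert v))"
      by (simp add: IH sum_distrib_left divided_diff_sum)
    also have "\<dots> = (\<Sum>v\<in>B. divided_diff l (X ?k ^ e * schubert v))"
    proof (rule sum.mono_neutral_right)
      \<comment> \<open>Here particle \<open>l\<close> rests as the lowest one, so its polynomial
        contains \<open>X l\<close> exactly to the power \<open>e\<close>; together with
        \<open>X ?k ^ e\<close> this is symmetric and killed.\<close>
      show "\<forall>v\<in>pieri_set l w' n - B. divided_diff l (X ?k ^ e * schubert v) = 0"
      proof
        fix v assume v: "v \<in> pieri_set l w' n - B"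
        then have vf: "v \<in> fronts l" "pieri_rel {1..l} w v" by (auto simp: pieri_set_def rel')
        have "w l \<le> v l" using pieri_rel_le[OF vf(2), of l] False by simp
        then have vl: "v l = w l" using v by (auto simp: B_def)
        have vgt: "w l < v a" if "1 \<le> a" "a < l" for a
          using pieri_rel_le[OF vf(2), of a] dec[of a l] that by simp
        obtain l' where l': "l = Suc l'" using False by (cases l) auto
        have r: "ext l' v \<in> fronts l'" "\<And>a. 1 \<le> a \<Longrightarrow> a \<le> l' \<Longrightarrow> ext l' v a = v a"
          using fronts_restrict[OF vf(1), of l'] l' by auto
        have "schubert v = schubert (ext l' v) * X l ^ e"
          using schubert_append[of "ext l' v" l' v] r vf(1) vgt vl l' by (auto simp: e_def)
        then have "X ?k ^ e * schubert v = schubert (ext l' v) * (X l * X ?k) ^ e"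
          by (simp add: power_mult_distrib mult_ac)
        moreover have "divided_diff l (schubert (ext l' v)) = 0"
          using r(1) l' by (intro divided_diff_fronts_tail) auto
        moreover have "divided_diff l ((X l * X ?k) ^ e) = 0"
          by (simp add: divided_diff_eq_0_iff swap_vars_power swap_vars_mult mult.commute)
        ultimately show "divided_diff l (X ?k ^ e * schubert v) = 0"
          by (simp add: divided_diff_mult_sym)
      qed
    qed (auto simp: B_def finite_pieri_set)
    also have "\<dots> = (\<Sum>v\<in>Q. schubert v)"
    \<comment> \<open>Multiplying by \<open>X ?k ^ e\<close> appends the value \<open>w l\<close>
      below all others. The divided difference then exchanges the last two entries: \<open>l\<close>
      rests at \<open>w l\<close>, and the last particle takes over its move.\<close>
    proof (rule sum.reindex_bij_witness[where i = "\<lambda>v. ext l (v(l := v ?k))" and j = "\<lambda>v. ext ?k (v(l := w l, ?k := v l))"])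
      fix v assume "v \<in> B"
      then have v: "v \<in> fronts l" "pieri_rel {1..l} w v" "int (hops {1..l} w v) = n" "w l < v l"
        by (auto simp: B_def pieri_set_def rel')
      have vgt: "w l < v a" if "1 \<le> a" "a \<le> l" for a
        using pieri_rel_le[OF v(2), of a] dec[of a l] that v(4) by (cases "a = l") auto
      define p where "p = ext ?k (v(?k := w l))"
      have "inj_on (v(?k := w l)) {1..?k}"
      proof (rule inj_onI)
        fix a b assume "a \<in> {1..?k}" "b \<in> {1..?k}" "(v(?k := w l)) a = (v(?k := w l)) b"
        then show "a = b" using vgt[of a] vgt[of b] fronts_inj_eq[OF v(1), of a b]
          by (auto split: if_splits simp: le_Suc_eq)
      qed
      moreover have "1 \<le> (v(?k := w l)) a" if "1 \<le> a" "a \<le> ?k" for a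
        using fronts_pos[OF v(1), of a] wpos[of l] that False by auto
      ultimately have p: "p \<in> fronts ?k" "\<And>a. 1 \<le> a \<Longrightarrow> a \<le> ?k \<Longrightarrow> p a = (v(?k := w l)) a"
        unfolding p_def by (auto simp: ext_fronts ext_apply)
      have sp: "schubert p = schubert v * X ?k ^ e"
        using schubert_append[OF v(1) p(1)] p(2) vgt by (auto simp: e_def)
      define u where "u = p \<circ> adjt l"
      have u: "u \<in> fronts ?k" unfolding u_def using p(1) False by (intro fronts_comp_adjt) auto
      have ua: "u a = (v(l := w l, ?k := v l)) a" if "1 \<le> a" "a \<le> ?k" for a
        using that p(2) False by (auto simp: u_def o_apply transpose_def)
      have eu: "ext ?k (v(l := w l, ?k := v l)) = u" by (intro ext_eqI u ua)
      have "divided_diff l (schubert p) = schubert u"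
        unfolding u_def using p False v(4) by (intro divided_diff_schubert_descent) (auto simp: fronts_finitary)
      then show "schubert (ext ?k (v(l := w l, ?k := v l))) = divided_diff l (X ?k ^ e * schubert v)"
        by (simp add: eu sp mult.commute)
      have uv: "(u(l := u ?k)) a = v a" if "1 \<le> a" "a \<le> l" for a using ua that False by auto
      then show "ext l ((ext ?k (v(l := w l, ?k := v l)))(l := ext ?k (v(l := w l, ?k := v l)) ?k)) = v"
        unfolding eu using v(1) by (intro ext_eqI) auto
      have relu: "pieri_rel {1..l} w (u(l := u ?k)) = pieri_rel {1..l} w v" "hops {1..l} w (u(l := u ?k)) = hops {1..l} w v"
        using uv by (auto intro!: pieri_rel_cong hops_cong)
      have "w l < u ?k" "u l = w l" using ua[of ?k] ua[of l] v(4) False by auto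
      then have "pieri_rel {1..?k} w u" "hops {1..?k} w u = hops {1..l} w v + (d - 1)"
        using pieri_rel_append_pass[of l w u] dec False v(2) wl by (auto simp: relu)
      then show "ext ?k (v(l := w l, ?k := v l)) \<in> Q"
        unfolding eu using u v(3) \<open>w l < u ?k\<close> False wl by (auto simp: Q_def pieri_set_def n_def)
    next
      fix v assume "v \<in> Q"
      then have v: "v \<in> fronts ?k" "pieri_rel {1..?k} w v" "int (hops {1..?k} w v) = m" "w l < v ?k"
        by (auto simp: Q_def pieri_set_def)
      have r: "pieri_rel {1..l} w (v(l := v ?k))" "v l = w l"
        "hops {1..?k} w v = hops {1..l} w (v(l := v ?k)) + (d - 1)"
        using pieri_rel_append_pass[of l w v] dec False v(2,4) wl by auto
      have "inj_on (v(l := v ?k)) {1..l}"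
        using r(1) fronts_inj_on[OF Suc.prems(1)] by (rule pieri_rel_inj)
      moreover have "1 \<le> (v(l := v ?k)) a" if "1 \<le> a" "a \<le> l" for a
        using fronts_pos[OF v(1), of a] fronts_pos[OF v(1), of ?k] that by auto
      ultimately have u: "ext l (v(l := v ?k)) \<in> fronts l"
        "\<And>a. 1 \<le> a \<Longrightarrow> a \<le> l \<Longrightarrow> ext l (v(l := v ?k)) a = (v(l := v ?k)) a"
        by (auto simp: ext_fronts ext_apply)
      let ?u = "ext l (v(l := v ?k))"
      show "ext ?k (?u(l := w l, ?k := ?u l)) = v"
        using v(1) u(2) r(2) False by (intro ext_eqI) (auto simp: le_Suc_eq)
      have relu: "pieri_rel {1..l} w ?u = pieri_rel {1..l} w (v(l := v ?k))" "hops {1..l} w ?u = hops {1..l} w (v(l := v ?k))"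
        using u by (auto intro!: pieri_rel_cong hops_cong)
      then show "?u \<in> B"
        using u r v(3,4) wl False by (auto simp: B_def pieri_set_def rel' n_def)
    qed
    finally show ?thesis by simp
  qed
  have "schubert w * hsym ?k m = schubert w' * X ?k ^ c * ((\<Sum>j<d. X ?k ^ j * hsym l (m - int j)) + X ?k ^ d * hsym ?k (m - int d))"
    unfolding sw by (subst hsym_unfold[of l m d]) simp
  also have "\<dots> = (\<Sum>v\<in>P. schubert v) + (\<Sum>v\<in>Q. schubert v)"
    unfolding P Q by (simp add: distrib_left sum_distrib_left power_add mult_ac)
  also have "\<dots> = (\<Sum>v\<in>pieri_set ?k w m. schubert v)"
    unfolding PQ(1) using PQ by (subst sum.union_disjoint) (auto simp: P_def Q_def finite_pieri_set)
  finally show ?case .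
qed

text \<open>Only the pair \<open>i\<close>, \<open>Suc i\<close> changes its order of positions. In
  \<open>w\<close> the lower of the two stands later and may pass the other; after the swap it
  stands earlier and may not. The extra condition on \<open>v\<close> says exactly that no passing
  occurs.\<close>

lemma pieri_rel_swap:
  assumes i: "1 \<le> i" "i < k" and d: "w (Suc i) < w i"
  shows "pieri_rel {1..k} (w \<circ> adjt i) (v \<circ> adjt i) \<longleftrightarrow> pieri_rel {1..k} w v \<and> v (Suc i) < v i"
proof
  let ?s = "adjt i"
  have s: "?s a \<in> {1..k}" if "a \<in> {1..k}" for a using that i by (auto simp: transpose_def)
  have ord: "?s e < ?s a" if "e < a" "\<not> (e = i \<and> a = Suc i)" for a e
    using that by (auto simp: transpose_def)
  {
    assume r: "pieri_rel {1..k} w v \<and> v (Suc i) < v i"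
    show "pieri_rel {1..k} (w \<circ> ?s) (v \<circ> ?s)"
      unfolding pieri_rel_def o_apply
    proof (intro conjI ballI impI)
      fix a assume "a \<in> {1..k}"
      then show "w (?s a) \<le> v (?s a)" using r s pieri_rel_le by blast
    next
      fix a e assume ae: "a \<in> {1..k}" "e \<in> {1..k}" "w (?s a) < w (?s e)"
      have "v (?s a) < w (?s e) \<or> ?s e < ?s a \<and> v (?s e) = w (?s e) \<and> w (?s e) < v (?s a)"
        using r pieri_relD[of "{1..k}" w v "?s a" "?s e"] s ae by blast
      moreover have "e < a" if *: "?s e < ?s a" "v (?s e) = w (?s e)" "w (?s e) < v (?s a)"
      proof -
        have "\<not> (?s e = i \<and> ?s a = Suc i)" using * r by auto
        then show ?thesis using ord[of "?s e" "?s a"] *(1) by simp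
      qed
      ultimately show "v (?s a) < w (?s e) \<or> e < a \<and> v (?s e) = w (?s e) \<and> w (?s e) < v (?s a)" by blast
    qed
  }
  assume r: "pieri_rel {1..k} (w \<circ> ?s) (v \<circ> ?s)"
  have le: "w a \<le> v a" if "a \<in> {1..k}" for a
    using pieri_rel_le[OF r s[OF that]] by (simp add: o_apply)
  have pr: "v a < w e \<or> ?s e < ?s a \<and> v e = w e \<and> w e < v a" if "a \<in> {1..k}" "e \<in> {1..k}" "w a < w e" for a e
    using pieri_relD[OF r s[OF that(1)] s[OF that(2)]] that(3) by (simp add: o_apply)
  have "pieri_rel {1..k} w v"
    unfolding pieri_rel_def
  proof (intro conjI ballI impI le)
    fix a e assume ae: "a \<in> {1..k}" "e \<in> {1..k}" "w a < w e"
    have "e < a" if "?s e < ?s a"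
    proof -
      have "\<not> (?s e = i \<and> ?s a = Suc i)"
      proof
        assume "?s e = i \<and> ?s a = Suc i"
        then have "e = Suc i" "a = i" by (metis transpose_apply_first transpose_involutory, metis transpose_apply_second transpose_involutory)
        then show False using ae d by simp
      qed
      then show ?thesis using ord[of "?s e" "?s a"] that by simp
    qed
    then show "v a < w e \<or> e < a \<and> v e = w e \<and> w e < v a" using pr[OF ae] by blast
  qed
  moreover have "v (Suc i) < v i"
    using pr[of "Suc i" i] le[of i] i d by auto
  ultimately show "pieri_rel {1..k} w v \<and> v (Suc i) < v i" by blast
qed

lemma adjt_image_front: "1 \<le> i \<Longrightarrow> i < k \<Longrightarrow> adjt i ` {1..k} = {1..k}"
  by (rule adjt_image) auto

lemma hops_swap:
  assumes "1 \<le> i" "i < k"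
  shows "hops {1..k} (w \<circ> adjt i) (v \<circ> adjt i) = hops {1..k} w v"
proof -
  have im: "(w \<circ> adjt i) ` {1..k} = w ` {1..k}"
    by (simp only: image_comp[symmetric] adjt_image_front[OF assms])
  have "(\<Sum>a\<in>{1..k}. card ({w (adjt i a)<..v (adjt i a)} - w ` {1..k})) = (\<Sum>a\<in>{1..k}. card ({w a<..v a} - w ` {1..k}))"
    by (rule sum.reindex_bij_witness[where i = "adjt i" and j = "adjt i"])
       (use adjt_image_front[OF assms] in auto)
  then show ?thesis unfolding hops_def im by (simp add: o_apply)
qed

lemma divided_diff_sum_fronts:
  assumes "finite S" "S \<subseteq> fronts k" "1 \<le> i"
  shows "divided_diff i (\<Sum>v\<in>S. schubert v) = (\<Sum>v\<in>{v\<in>S. v (Suc i) < v i}. schubert (v \<circ> adjt i))"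
proof -
  have "divided_diff i (\<Sum>v\<in>S. schubert v) = (\<Sum>v\<in>S. if v (Suc i) < v i then schubert (v \<circ> adjt i) else 0)"
    unfolding divided_diff_sum
  proof (rule sum.cong[OF refl])
    fix v assume "v \<in> S"
    then have v: "v \<in> fronts k" using assms by blast
    have "v i < v (Suc i)" if "\<not> v (Suc i) < v i"
      using that fronts_inj_eq[OF v, of i "Suc i"] by (metis n_not_Suc_n nat_neq_iff)
    then show "divided_diff i (schubert v) = (if v (Suc i) < v i then schubert (v \<circ> adjt i) else 0)"
      using divided_diff_schubert_descent[of v i] divided_diff_schubert_ascent[of v i] fronts_finitary[OF v] assms(3)
      by auto
  qed
  also have "\<dots> = (\<Sum>v\<in>{v\<in>S. v (Suc i) < v i}. schubert (v \<circ> adjt i))"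
    using assms(1) by (simp add: sum.inter_filter)
  finally show ?thesis .
qed

text \<open>A divided difference undoes one sorting swap: \<open>hsym k m\<close> is symmetric and
  passes through it, endpoints ascending at \<open>i\<close> vanish, and
  \<open>pieri_rel_swap\<close> matches the others with the steps from \<open>w\<close>.\<close>

theorem pieri:
  assumes "w \<in> fronts k"
  shows "schubert w * hsym k m = (\<Sum>v\<in>pieri_set k w m. schubert v)"
  using assms
proof (induction rule: fronts_sort_induct)
  case (decreasing w)
  then show ?case by (intro pieri_dominant)
next
  case (swap w i)
  let ?w = "w \<circ> adjt i"
  have d: "?w (Suc i) < ?w i" using swap by simp
  have wf: "?w \<in> fronts k" using swap by (intro fronts_comp_adjt)
  have sw: "divided_diff i (schubert ?w) = schubert w"
    using divided_diff_schubert_descent[OF fronts_finitary[OF wf] swap.hyps(2) d] by simp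
  have "schubert w * hsym k m = divided_diff i (schubert ?w * hsym k m)"
    using divided_diff_mult_sym(1)[OF divided_diff_hsym_low[OF swap.hyps(2,3)]] by (simp only: sw)
  also have "\<dots> = divided_diff i (\<Sum>v\<in>pieri_set k ?w m. schubert v)" by (simp only: swap.IH)
  also have "\<dots> = (\<Sum>v\<in>{v\<in>pieri_set k ?w m. v (Suc i) < v i}. schubert (v \<circ> adjt i))"
    using swap.hyps by (intro divided_diff_sum_fronts[of _ k] finite_pieri_set) (auto simp: pieri_set_def)
  also have "\<dots> = (\<Sum>v\<in>pieri_set k w m. schubert v)"
  proof (rule sum.reindex_bij_witness[where i = "\<lambda>v. v \<circ> adjt i" and j = "\<lambda>v. v \<circ> adjt i"])
    fix v assume "v \<in> {v\<in>pieri_set k ?w m. v (Suc i) < v i}"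
    then show "v \<circ> adjt i \<in> pieri_set k w m"
      using pieri_rel_swap[OF swap.hyps(2,3) d, of v] hops_swap[OF swap.hyps(2,3), of ?w v] swap.hyps
      by (auto simp: pieri_set_def intro: fronts_comp_adjt)
  next
    fix v assume "v \<in> pieri_set k w m"
    then show "v \<circ> adjt i \<in> {v\<in>pieri_set k ?w m. v (Suc i) < v i}"
      using pieri_rel_swap[OF swap.hyps(2,3) d, of "v \<circ> adjt i"] hops_swap[OF swap.hyps(2,3), of w v] swap.hyps
      by (auto simp: pieri_set_def intro: fronts_comp_adjt)
  qed auto
  finally show ?case .
qed

lemma schubert_span_hsym: "f \<in> schubert_span (fronts k) \<Longrightarrow> f * hsym k m \<in> schubert_span (fronts k)"
  by (erule schubert_span_mult)
     (auto simp: pieri pieri_set_def intro!: schubert_span_sum intro: schubert_span.base)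

lemma fronts_subset: "fronts k \<subseteq> finitary_perms"
  by (auto simp: fronts_def)

definition pieri_paths :: "nat \<Rightarrow> (nat \<Rightarrow> nat) \<Rightarrow> (nat \<Rightarrow> nat) \<Rightarrow> int \<Rightarrow> int \<Rightarrow> (nat \<Rightarrow> nat) set" where
  "pieri_paths k w u p q = {x \<in> pieri_set k w p. u \<in> pieri_set k x q}"

lemma scoef_pieri2:
  assumes "w \<in> fronts k"
  shows "scoef u (schubert w * hsym k p * hsym k q) = int (card (pieri_paths k w u p q))"
proof -
  have "scoef u (schubert w * hsym k p * hsym k q) = (\<Sum>x\<in>pieri_set k w p. scoef u (schubert x * hsym k q))"
    by (simp add: pieri[OF assms] sum_distrib_right scoef_sum)
  also have "\<dots> = (\<Sum>x\<in>pieri_set k w p. if u \<in> pieri_set k x q then 1 else 0)"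
  proof (rule sum.cong[OF refl])
    fix x assume "x \<in> pieri_set k w p"
    then have "x \<in> fronts k" by (simp add: pieri_set_def)
    then have "scoef u (schubert x * hsym k q) = (\<Sum>v\<in>pieri_set k x q. if v = u then 1 else 0)"
      by (auto simp: pieri scoef_sum scoef_schubert pieri_set_def fronts_finitary intro!: sum.cong)
    then show "scoef u (schubert x * hsym k q) = (if u \<in> pieri_set k x q then 1 else 0)"
      by (simp add: finite_pieri_set)
  qed
  also have "\<dots> = int (card (pieri_paths k w u p q))"
    unfolding pieri_paths_def by (simp add: finite_pieri_set flip: sum.inter_filter)
  finally show ?thesis .
qed

section \<open>The Monk rule for the last variable\<close>

definition next_free :: "nat \<Rightarrow> (nat \<Rightarrow> nat) \<Rightarrow> nat \<Rightarrow> nat" where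
  "next_free k w r = (LEAST z. w r < z \<and> z \<notin> w ` {1..k})"

text \<open>The positive term of Monk's rule for \<open>X r\<close>. If the front values after
  \<open>r\<close> are smaller than \<open>w r\<close>, the only upward cover that exchanges
  \<open>r\<close> with a later position involves the tail position of the least larger free
  value.\<close>

definition hop_at :: "nat \<Rightarrow> (nat \<Rightarrow> nat) \<Rightarrow> nat \<Rightarrow> nat \<Rightarrow> nat" where
  "hop_at k w r = ext k (w(r := next_free k w r))"

lemma next_free:
  shows "w r < next_free k w r" "next_free k w r \<notin> w ` {1..k}"
    and "\<And>z. w r < z \<Longrightarrow> z < next_free k w r \<Longrightarrow> z \<in> w ` {1..k}"
proof -
  have "infinite ({w r<..} - w ` {1..k})" by (rule Diff_infinite_finite) (auto simp: infinite_Ioi)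
  then have "\<exists>z. w r < z \<and> z \<notin> w ` {1..k}" by (metis Diff_iff finite.emptyI greaterThan_iff ex_in_conv)
  from LeastI_ex[OF this] show "w r < next_free k w r" "next_free k w r \<notin> w ` {1..k}"
    by (auto simp: next_free_def)
  show "\<And>z. w r < z \<Longrightarrow> z < next_free k w r \<Longrightarrow> z \<in> w ` {1..k}"
    unfolding next_free_def using not_less_Least by blast
qed

lemma hop_at:
  assumes "w \<in> fronts k"
  shows "hop_at k w r \<in> fronts k" "\<And>a. 1 \<le> a \<Longrightarrow> a \<le> k \<Longrightarrow> hop_at k w r a = (w(r := next_free k w r)) a"
proof -
  have "inj_on (w(r := next_free k w r)) {1..k}"
    using next_free(2)[of k w r] fronts_inj_eq[OF assms] by (auto simp: inj_on_def) (metis atLeastAtMost_iff imageI)+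
  moreover have "1 \<le> (w(r := next_free k w r)) a" if "1 \<le> a" "a \<le> k" for a
    using fronts_pos[OF assms, of a] next_free(1)[of w r k] that by (auto simp: One_nat_def)
  ultimately show "hop_at k w r \<in> fronts k" "\<And>a. 1 \<le> a \<Longrightarrow> a \<le> k \<Longrightarrow> hop_at k w r a = (w(r := next_free k w r)) a"
    by (auto simp: hop_at_def ext_fronts ext_apply)
qed

text \<open>The positions \<open>a\<close> before \<open>r\<close> for which
  \<open>w \<circ> transpose a r\<close> covers \<open>w\<close> in Bruhat order; they index the
  negative terms of Monk's rule.\<close>

definition monk_covers :: "(nat \<Rightarrow> nat) \<Rightarrow> nat \<Rightarrow> nat set" where
  "monk_covers w r = {a\<in>{1..<r}. w a < w r \<and> (\<forall>e. a < e \<and> e < r \<longrightarrow> \<not> (w a < w e \<and> w e < w r))}"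

lemma monk_covers_subset: "monk_covers w r \<subseteq> {1..<r}"
  by (auto simp: monk_covers_def)

lemma next_free_swap:
  assumes "1 \<le> i" "i < k"
  shows "next_free k (w \<circ> adjt i) r = next_free k w (adjt i r)"
proof -
  have "(w \<circ> adjt i) ` {1..k} = w ` {1..k}"
    by (simp only: image_comp[symmetric] adjt_image_front[OF assms])
  then show ?thesis unfolding next_free_def by (simp add: o_apply)
qed

lemma hop_at_swap:
  assumes w: "w \<in> fronts k" and i: "1 \<le> i" "i < k" and r: "1 \<le> r" "r \<le> k"
  shows "hop_at k (w \<circ> adjt i) r \<circ> adjt i = hop_at k w (adjt i r)"
proof (rule fronts_eqI[of _ k])
  have w': "w \<circ> adjt i \<in> fronts k" using w i by (rule fronts_comp_adjt)
  show "hop_at k (w \<circ> adjt i) r \<circ> adjt i \<in> fronts k"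
    using i hop_at[OF w'] by (intro fronts_comp_adjt) auto
  show "hop_at k w (adjt i r) \<in> fronts k" using hop_at[OF w] by blast
  fix a assume a: "1 \<le> a" "a \<le> k"
  have a': "1 \<le> adjt i a" "adjt i a \<le> k" using a i by (auto simp: transpose_def)
  have "(hop_at k (w \<circ> adjt i) r \<circ> adjt i) a = ((w \<circ> adjt i)(r := next_free k (w \<circ> adjt i) r)) (adjt i a)"
    using hop_at(2)[OF w' a'] by (simp add: o_apply)
  also have "\<dots> = (w(adjt i r := next_free k w (adjt i r))) a"
    by (simp add: next_free_swap[OF i] o_apply) (metis transpose_involutory)
  also have "\<dots> = hop_at k w (adjt i r) a" using hop_at(2)[OF w a] by simp
  finally show "(hop_at k (w \<circ> adjt i) r \<circ> adjt i) a = hop_at k w (adjt i r) a" .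
qed

text \<open>The values from \<open>w r\<close> up to the next free value \<open>z\<close> form a run
  on consecutive positions ending at \<open>r\<close>. Inserting \<open>z\<close> in front of this
  run and dropping \<open>w r\<close> gives a dominant word, and moving \<open>z\<close> along the
  staircase to position \<open>r\<close> gives the hop.\<close>

lemma monk_dominant:
  assumes w: "w \<in> fronts k" and desc: "\<And>i. 1 \<le> i \<Longrightarrow> i < k \<Longrightarrow> w (Suc i) < w i" and r: "1 \<le> r" "r \<le> k"
  shows "X r * schubert w = schubert (hop_at k w r)"
proof -
  have dec: "w b < w a" if "1 \<le> a" "a < b" "b \<le> k" for a b
    using strict_decreasing_less[of 1 k w] desc that by auto
  have wpos: "1 \<le> w a" if "1 \<le> a" for a using fronts_pos[OF w, of a] that by (simp add: One_nat_def)
  define z L where "z = next_free k w r" and "L = next_free k w r - w r - 1"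
  have zr: "w r < z" "z \<notin> w ` {1..k}" "\<And>y. w r < y \<Longrightarrow> y < z \<Longrightarrow> y \<in> w ` {1..k}"
    using next_free[where k = k and w = w and r = r] by (auto simp: z_def)
  have zL: "z = w r + L + 1" using zr(1) by (simp add: L_def z_def)
  \<comment> \<open>All values strictly between \<open>w r\<close> and \<open>z\<close> are
    occupied; as the word decreases, they must stand immediately before \<open>r\<close>, one per
    position.\<close>
  have run: "j < r \<and> w (r - j) = w r + j" if "j \<le> L" for j
    using that
  proof (induction j)
    case (Suc j)
    have IH: "j < r" "w (r - j) = w r + j" using Suc by auto
    obtain b where b: "1 \<le> b" "b \<le> k" "w b = w r + Suc j"
      using zr(3)[of "w r + Suc j"] Suc.prems zL by auto
    have "b < r - j"
    proof (rule ccontr)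
      assume "\<not> b < r - j"
      moreover have "1 \<le> r - j" using IH(1) by simp
      ultimately have "w b \<le> w (r - j)" using dec[of "r - j" b] IH b by (cases "b = r - j") auto
      then show False using b IH by simp
    qed
    moreover have "\<not> b < r - Suc j"
    proof
      assume *: "b < r - Suc j"
      then have "w (r - Suc j) < w b" "w (r - j) < w (r - Suc j)" using b r by (intro dec; auto)+
      then show False using b IH by simp
    qed
    ultimately have "b = r - Suc j" by simp
    then show ?case using b IH by auto
  qed (use r in simp)
  define q where "q = r - L"
  have Lr: "L < r" using run[of L] by simp
  have q: "1 \<le> q" "q + L = r" using Lr by (auto simp: q_def)
  have wq: "w a = z - 1 - (a - q)" if "q \<le> a" "a \<le> r" for a
    using run[of "r - a"] that q zL by (auto simp: q_def)
  have before: "z < w a" if "1 \<le> a" "a < q" for a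
  proof -
    have "w q < w a" using dec[of a q] that q r by auto
    moreover have "w a \<noteq> z" using zr(2) that q r by auto
    ultimately show ?thesis using wq[of q] q zr(1) by auto
  qed
  \<comment> \<open>The dominant word whose staircase move by \<open>L\<close> places is
    \<open>w(r := z)\<close>.\<close>
  define D where "D a = (if a = q then z else if q < a \<and> a \<le> r then w (a - 1) else w a)" for a
  have Ddec: "D (Suc i) < D i" if "1 \<le> i" "i < k" for i
    using that before[of i] dec[of "i - 1" i] dec[of i "Suc i"] dec[of "i - 1" "Suc i"] wq[of q] q r zr(1) zL
    by (auto simp: D_def)
  have Dlt: "D b < D a" if "1 \<le> a" "a < b" "b \<le> k" for a b
    using strict_decreasing_less[of 1 k D] Ddec that by auto
  have "inj_on D {1..k}"
    by (rule inj_onI) (metis Dlt atLeastAtMost_iff less_irrefl nat_neq_iff)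
  moreover have Dpos: "1 \<le> D a" if "1 \<le> a" "a \<le> k" for a
    using wpos[of a] wpos[of "a - 1"] zr(1) that q by (auto simp: D_def)
  ultimately have u: "ext k D \<in> fronts k" "\<And>a. 1 \<le> a \<Longrightarrow> a \<le> k \<Longrightarrow> ext k D a = D a"
    by (auto simp: ext_fronts ext_apply)
  have "schubert (ext k D) = (\<Prod>a=1..k. X a ^ (ext k D a - 1))"
    using u Ddec by (intro schubert_dominant) auto
  also have "\<dots> = (\<Prod>a=1..k. X a ^ (D a - 1))" using u by (intro prod.cong) auto
  finally have su: "schubert (ext k D) = (\<Prod>a=1..k. X a ^ (D a - 1))" .
  have mv: "move_right (ext k D) q L \<in> finitary_perms \<and> schubert (move_right (ext k D) q L)
    = (\<Prod>a=1..k. X a ^ (if q \<le> a \<and> a < q + L then D a - 1 - 1 else D a - 1))"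
  proof (rule schubert_staircase[OF _ _ _ su])
    fix j assume "j \<le> L"
    then show "D (q + j) - 1 + j = D q - 1"
      using wq[of "q + j - 1"] q zL by (auto simp: D_def)
  next
    fix j assume "1 \<le> j" "j \<le> L"
    then show "ext k D (q + j) < ext k D q" using u(2) Dlt[of q "q + j"] q r by auto
  qed (use u q r in \<open>auto simp: fronts_finitary\<close>)
  have "move_right (ext k D) q L = hop_at k w r"
  proof (rule fronts_eqI[of _ k])
    show "move_right (ext k D) q L \<in> fronts k"
      using mv u(1) q r by (auto simp: fronts_def move_right_def)
    show "hop_at k w r \<in> fronts k" using hop_at[OF w] by blast
    fix a assume a: "1 \<le> a" "a \<le> k"
    have "move_right (ext k D) q L a = (w(r := z)) a"
      using a q r u(2)[of a] u(2)[of "Suc a"] u(2)[of q] by (auto simp: move_right_def D_def)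
    then show "move_right (ext k D) q L a = hop_at k w r a"
      using hop_at(2)[OF w a] by (simp add: z_def)
  qed
  then have "schubert (hop_at k w r) = (\<Prod>a=1..k. X a ^ (if q \<le> a \<and> a < q + L then D a - 1 - 1 else D a - 1))"
    using mv by simp
  also have "\<dots> = (\<Prod>a=1..k. X a ^ (if a = r then Suc (w a - 1) else w a - 1))"
  proof (intro prod.cong refl arg_cong2[where f = "(^)"])
    fix a assume "a \<in> {1..k}"
    then show "(if q \<le> a \<and> a < q + L then D a - 1 - 1 else D a - 1) = (if a = r then Suc (w a - 1) else w a - 1)"
      using wq[of a] wq[of "a - 1"] q wpos[of a] zL by (auto simp: D_def)
  qed
  also have "\<dots> = X r * (\<Prod>a=1..k. X a ^ (w a - 1))"
    using r by (simp add: prod.remove[of "{1..k}" r] mult.assoc)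
  finally show ?thesis using schubert_dominant[OF w desc] by simp
qed

lemma comp_transpose_adjt:
  "w \<circ> adjt i \<circ> transpose a r \<circ> adjt i = w \<circ> transpose (adjt i a) (adjt i r)"
  by (rule HOL.ext) (auto simp: o_apply transpose_def)

text \<open>Matches the negative terms for the swapped word that survive the divided difference at
  \<open>i\<close> with the negative terms for \<open>w\<close>. The emptiness test between
  \<open>a\<close> and \<open>r\<close> sees only the set of values there, which the swap preserves
  unless \<open>a\<close> is \<open>i\<close> or \<open>Suc i\<close>.\<close>

lemma monk_covers_swap_low:
  assumes w: "inj w" and i: "1 \<le> i" "Suc i < r" "w i < w (Suc i)"
  shows "adjt i a \<in> monk_covers w r \<longleftrightarrow> a \<in> monk_covers (w \<circ> adjt i) r \<and>
    (w \<circ> adjt i \<circ> transpose a r) (Suc i) < (w \<circ> adjt i \<circ> transpose a r) i"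
proof -
  have ball: "(\<forall>e. b < e \<and> e < r \<longrightarrow> \<not> (x < w (adjt i e) \<and> w (adjt i e) < y)) \<longleftrightarrow>
      (\<forall>e. b < e \<and> e < r \<longrightarrow> \<not> (x < w e \<and> w e < y))" if "b < i \<or> Suc i \<le> b" for b x y
  proof -
    have "b < adjt i e \<and> adjt i e < r \<longleftrightarrow> b < e \<and> e < r" for e
      using that i by (auto simp: transpose_def)
    then show ?thesis by (metis transpose_involutory)
  qed
  have r: "adjt i r = r" using i by (simp add: transpose_def)
  have step: "(\<forall>e. i < e \<and> e < r \<longrightarrow> \<not> Q e) \<longleftrightarrow> \<not> Q (Suc i) \<and> (\<forall>e. Suc i < e \<and> e < r \<longrightarrow> \<not> Q e)" for Q :: "nat \<Rightarrow> bool"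
    using i by (metis Suc_lessI lessI less_trans)
  consider "a = i" | "a = Suc i" | "a \<noteq> i" "a \<noteq> Suc i" by blast
  then show ?thesis
  proof cases
    case 1
    have "(\<forall>e. i < e \<and> e < r \<longrightarrow> \<not> (w (Suc i) < w (adjt i e) \<and> w (adjt i e) < w r)) \<longleftrightarrow>
        (\<forall>e. Suc i < e \<and> e < r \<longrightarrow> \<not> (w (Suc i) < w e \<and> w e < w r))"
      using i step[of "\<lambda>e. w (Suc i) < w (adjt i e) \<and> w (adjt i e) < w r"] ball[of "Suc i" "w (Suc i)" "w r"] by simp
    then show ?thesis
      using i 1 by (auto simp: monk_covers_def o_apply r transpose_def[of _ r])
  next
    case 2
    have "(\<forall>e. i < e \<and> e < r \<longrightarrow> \<not> (w i < w e \<and> w e < w r)) \<longleftrightarrow>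
        \<not> w (Suc i) < w r \<and> (\<forall>e. Suc i < e \<and> e < r \<longrightarrow> \<not> (w i < w e \<and> w e < w r))"
      using i step[of "\<lambda>e. w i < w e \<and> w e < w r"] by simp
    moreover have "w (Suc i) \<noteq> w r" using injD[OF w, of "Suc i" r] i by auto
    ultimately show ?thesis
      using i 2 ball[of "Suc i" "w i" "w r"] by (auto simp: monk_covers_def o_apply r transpose_def[of _ r])
  next
    case 3
    then have a: "adjt i a = a" by (simp add: transpose_def)
    have "a < i \<or> Suc i \<le> a" using 3 by linarith
    from ball[OF this, of "w a" "w r"] show ?thesis
      using i 3 unfolding monk_covers_def by (auto simp: o_apply r a transpose_def[of _ r])
  qed
qed

text \<open>Induction by sorting, applying a divided difference at \<open>i\<close> to the rule for
  the swapped word. The variable stays outside the pair \<open>i\<close>, \<open>Suc i\<close>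
  except when \<open>Suc i = r\<close>.\<close>

theorem monk:
  assumes "w \<in> fronts k" "1 \<le> r" "r \<le> k" "\<And>b. r < b \<Longrightarrow> b \<le> k \<Longrightarrow> w b < w r"
  shows "X r * schubert w = schubert (hop_at k w r) - (\<Sum>a\<in>monk_covers w r. schubert (w \<circ> transpose a r))"
  using assms
proof (induction arbitrary: r rule: fronts_sort_induct)
  case (decreasing w)
  have "monk_covers w r = {}"
    using strict_decreasing_less[of 1 k w _ r] decreasing by (fastforce simp: monk_covers_def)
  then show ?case using decreasing monk_dominant[of w k r] by simp
next
  case (swap w i)
  let ?w = "w \<circ> adjt i"
  have wf: "?w \<in> fronts k" using swap.hyps by (intro fronts_comp_adjt)
  have d: "?w (Suc i) < ?w i" using swap by simp
  have sw: "schubert w = divided_diff i (schubert ?w)"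
    using divided_diff_schubert_descent[OF fronts_finitary[OF wf] swap.hyps(2) d] by simp
  have sum: "divided_diff i (\<Sum>a\<in>C. schubert (?w \<circ> transpose a r'))
     = (\<Sum>a\<in>{a\<in>C. (?w \<circ> transpose a r') (Suc i) < (?w \<circ> transpose a r') i}. schubert (w \<circ> transpose (adjt i a) (adjt i r')))"
    if "C \<subseteq> {1..<r'}" "r' \<le> k" for C r'
  proof -
    have fin: "finite C" using that(1) by (rule finite_subset) simp
    have "divided_diff i (\<Sum>a\<in>C. schubert (?w \<circ> transpose a r'))
      = (\<Sum>a\<in>C. if (?w \<circ> transpose a r') (Suc i) < (?w \<circ> transpose a r') i
          then schubert (w \<circ> transpose (adjt i a) (adjt i r')) else 0)"
      unfolding divided_diff_sum
    proof (rule sum.cong[OF refl])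
      fix a assume "a \<in> C"
      then have f: "?w \<circ> transpose a r' \<in> fronts k" (is "?t \<in> _")
        using that wf by (intro fronts_comp_transpose[OF wf]) auto
      show "divided_diff i (schubert ?t) = (if ?t (Suc i) < ?t i then schubert (w \<circ> transpose (adjt i a) (adjt i r')) else 0)"
        using divided_diff_sum_fronts[of "{?t}" k i] f swap.hyps(2) comp_transpose_adjt[of w i a r']
        by (cases "?t (Suc i) < ?t i") (simp_all add: Collect_conv_if conj_commute cong: conj_cong)
    qed
    also have "\<dots> = (\<Sum>a\<in>{a\<in>C. (?w \<circ> transpose a r') (Suc i) < (?w \<circ> transpose a r') i}. schubert (w \<circ> transpose (adjt i a) (adjt i r')))"
      using fin by (simp add: sum.inter_filter)
    finally show ?thesis .
  qed
  have hop: "divided_diff i (schubert (hop_at k ?w r')) = schubert (hop_at k w (adjt i r'))"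
    if "1 \<le> r'" "r' \<le> k" "r' \<noteq> Suc i" for r'
  proof -
    have "hop_at k ?w r' (Suc i) < hop_at k ?w r' i"
      using that swap.hyps d next_free(1)[of ?w r' k] hop_at(2)[OF wf, of i r'] hop_at(2)[OF wf, of "Suc i" r'] by auto
    then show ?thesis
      using divided_diff_schubert_descent[OF fronts_finitary[OF hop_at(1)[OF wf]] swap.hyps(2)] hop_at_swap[OF swap.hyps(1-3) that(1,2)]
      by metis
  qed
  \<comment> \<open>An ascent at \<open>r\<close> inside the front is excluded, because all later
    front values are smaller than \<open>w r\<close>.\<close>
  have "i \<noteq> r" using swap.prems(3)[of "Suc r"] swap.hyps by auto
  then consider "Suc i < r" | "r < i" | "Suc i = r" by linarith
  then show ?case
  proof cases
    case 3
    \<comment> \<open>The rule for \<open>?w\<close> is taken at position \<open>i\<close>. Its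
      factor \<open>X i\<close> is not symmetric, so the Leibniz rule leaves an additional
      \<open>schubert ?w\<close>; this is the term of the new cover \<open>a = i\<close> of
      \<open>w\<close>.\<close>
    have "X i * schubert ?w = schubert (hop_at k ?w i) - (\<Sum>a\<in>monk_covers ?w i. schubert (?w \<circ> transpose a i))"
    proof (rule swap.IH)
      fix b assume b: "i < b" "b \<le> k"
      then show "?w b < ?w i"
        using swap.prems(3)[of b] swap.hyps 3 by (cases "b = Suc i") (auto simp: o_apply transpose_def)
    qed (use swap.hyps in auto)
    then have "divided_diff i (X i * schubert ?w)
      = schubert (hop_at k w r) - (\<Sum>a\<in>{a\<in>monk_covers ?w i. (?w \<circ> transpose a i) (Suc i) < (?w \<circ> transpose a i) i}. schubert (w \<circ> transpose (adjt i a) r))"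
      using hop[of i] sum[OF monk_covers_subset, of i ?w] swap.hyps 3 by (simp add: divided_diff_diff)
    moreover have "divided_diff i (X i * schubert ?w) = schubert ?w + X r * schubert w"
      using 3 by (simp add: divided_diff_mult divided_diff_X sw)
    moreover have "(\<Sum>a\<in>{a\<in>monk_covers ?w i. (?w \<circ> transpose a i) (Suc i) < (?w \<circ> transpose a i) i}. schubert (w \<circ> transpose (adjt i a) r))
      = (\<Sum>a\<in>{a\<in>monk_covers ?w i. w i < w a}. schubert (w \<circ> transpose a r))"
      by (intro sum.cong) (auto simp: monk_covers_def o_apply transpose_def)
    moreover have "monk_covers w r = insert i {a\<in>monk_covers ?w i. w i < w a}"
    proof -
      have step: "(\<forall>e. a < e \<and> e < r \<longrightarrow> P e) \<longleftrightarrow> (a < i \<longrightarrow> P i) \<and> (\<forall>e. a < e \<and> e < i \<longrightarrow> P e)" for a P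
        using 3 by (metis less_Suc_eq less_trans)
      have "w a \<noteq> w i" if "a < i" for a using fronts_inj_eq[OF swap.hyps(1), of a i] that by simp
      then have "a \<in> monk_covers w r \<longleftrightarrow> a \<in> insert i {a\<in>monk_covers ?w i. w i < w a}" for a
        using 3 swap.hyps unfolding monk_covers_def step
        by (cases "a < i") (auto simp: o_apply transpose_def nat_neq_iff)
      then show ?thesis by blast
    qed
    moreover have "i \<notin> {a\<in>monk_covers ?w i. w i < w a}" "finite {a\<in>monk_covers ?w i. w i < w a}"
      by (auto simp: monk_covers_def)
    moreover have "schubert (w \<circ> transpose i r) = schubert ?w" using 3 by simp
    ultimately show ?thesis by (simp add: algebra_simps)
  next
    case 1
    have r: "adjt i r = r" using 1 by (simp add: transpose_def)
    have "X r * schubert ?w = schubert (hop_at k ?w r) - (\<Sum>a\<in>monk_covers ?w r. schubert (?w \<circ> transpose a r))"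
      using swap.prems 1 by (intro swap.IH) (auto simp: o_apply transpose_def)
    moreover have "divided_diff i (X r * schubert ?w) = X r * schubert w"
      using 1 by (simp add: divided_diff_mult divided_diff_X sw transpose_def)
    ultimately have "X r * schubert w = schubert (hop_at k w r)
       - (\<Sum>a\<in>{a\<in>monk_covers ?w r. (?w \<circ> transpose a r) (Suc i) < (?w \<circ> transpose a r) i}. schubert (w \<circ> transpose (adjt i a) r))"
      using hop[of r] sum[OF monk_covers_subset, of r ?w] swap.prems 1 r by (simp add: divided_diff_diff)
    also have "(\<Sum>a\<in>{a\<in>monk_covers ?w r. (?w \<circ> transpose a r) (Suc i) < (?w \<circ> transpose a r) i}. schubert (w \<circ> transpose (adjt i a) r))
      = (\<Sum>a\<in>monk_covers w r. schubert (w \<circ> transpose a r))"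
    proof (rule sum.reindex_bij_witness[where i = "adjt i" and j = "adjt i"])
      fix a assume "a \<in> {a\<in>monk_covers ?w r. (?w \<circ> transpose a r) (Suc i) < (?w \<circ> transpose a r) i}"
      then show "adjt i a \<in> monk_covers w r"
        using monk_covers_swap_low[OF fronts_inj[OF swap.hyps(1)] swap.hyps(2) 1 swap.hyps(4), of a] by simp
    next
      fix a assume "a \<in> monk_covers w r"
      then show "adjt i a \<in> {a\<in>monk_covers ?w r. (?w \<circ> transpose a r) (Suc i) < (?w \<circ> transpose a r) i}"
        using monk_covers_swap_low[OF fronts_inj[OF swap.hyps(1)] swap.hyps(2) 1 swap.hyps(4), of "adjt i a"] by simp
    qed auto
    finally show ?thesis .
  next
    case 2
    have r: "adjt i r = r" using 2 by (simp add: transpose_def)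
    have "X r * schubert ?w = schubert (hop_at k ?w r) - (\<Sum>a\<in>monk_covers ?w r. schubert (?w \<circ> transpose a r))"
      using swap.prems swap.hyps 2 by (intro swap.IH) (auto simp: o_apply transpose_def)
    moreover have "divided_diff i (X r * schubert ?w) = X r * schubert w"
      using 2 by (simp add: divided_diff_mult divided_diff_X sw transpose_def)
    ultimately have "X r * schubert w = schubert (hop_at k w r)
       - (\<Sum>a\<in>{a\<in>monk_covers ?w r. (?w \<circ> transpose a r) (Suc i) < (?w \<circ> transpose a r) i}. schubert (w \<circ> transpose (adjt i a) r))"
      using hop[of r] sum[OF monk_covers_subset, of r ?w] swap.prems 2 r by (simp add: divided_diff_diff)
    also have "{a\<in>monk_covers ?w r. (?w \<circ> transpose a r) (Suc i) < (?w \<circ> transpose a r) i} = monk_covers w r"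
      using 2 swap.hyps by (auto simp: monk_covers_def o_apply transpose_def)
    also have "(\<Sum>a\<in>monk_covers w r. schubert (w \<circ> transpose (adjt i a) r)) = (\<Sum>a\<in>monk_covers w r. schubert (w \<circ> transpose a r))"
      using 2 by (intro sum.cong) (auto simp: monk_covers_def transpose_def)
    finally show ?thesis .
  qed
qed

section \<open>Two-row Schur polynomials\<close>

definition row_weight :: "nat list \<Rightarrow> zpoly" where
  "row_weight xs = (\<Prod>c<length xs. X (xs ! c))"

lemma row_weight_snoc: "row_weight (xs @ [l]) = row_weight xs * X l"
  by (simp add: row_weight_def nth_append)

definition rows :: "nat \<Rightarrow> nat \<Rightarrow> nat list set" where
  "rows k m = {xs. sorted xs \<and> set xs \<subseteq> {1..k} \<and> length xs = m}"

definition two_rows :: "nat \<Rightarrow> nat \<Rightarrow> nat \<Rightarrow> nat \<Rightarrow> (nat list \<times> nat list) set" where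
  "two_rows k l p q = {(xs, ys). xs \<in> rows k p \<and> ys \<in> rows l q \<and> (\<forall>c<q. xs ! c < ys ! c)}"

text \<open>Two-row tableaux with separate bounds for the rows. Schur polynomials are the case
  \<open>k = l\<close>, but for rows of equal length the column condition lowers the first bound, so
  the recursion leaves that case.\<close>

definition flagged :: "nat \<Rightarrow> nat \<Rightarrow> nat \<Rightarrow> nat \<Rightarrow> zpoly" where
  "flagged k l p q = (\<Sum>(xs, ys)\<in>two_rows k l p q. row_weight xs * row_weight ys)"

lemma finite_rows: "finite (rows k m)"
  by (rule finite_subset[OF _ finite_lists_length_eq[of "{1..k}" m]]) (auto simp: rows_def)

lemma finite_two_rows: "finite (two_rows k l p q)"
  by (rule finite_subset[of _ "rows k p \<times> rows l q"]) (auto simp: two_rows_def finite_rows)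

lemma rows_Suc_cases:
  assumes "xs \<in> rows k (Suc m)"
  obtains "xs \<in> rows (k - 1) (Suc m)" "last xs < k" | zs where "xs = zs @ [k]" "zs \<in> rows k m"
proof -
  have ne: "xs \<noteq> []" using assms by (auto simp: rows_def)
  obtain zs x where xs: "xs = zs @ [x]" using ne by (metis append_butlast_last_id)
  have x: "1 \<le> x" "x \<le> k" "sorted zs" "\<forall>y\<in>set zs. 1 \<le> y \<and> y \<le> x" "length zs = m"
    using assms by (auto simp: rows_def xs sorted_append)
  show ?thesis
  proof (cases "x = k")
    case True
    have "set zs \<subseteq> {1..k}" using x True by auto
    then have "zs \<in> rows k m" using x by (simp add: rows_def)
    then show ?thesis using that(2)[of zs] True xs by simp
  next
    case False
    then have "\<forall>y\<in>set xs. 1 \<le> y \<and> y \<le> k - 1" using x by (auto simp: xs)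
    then have "set xs \<subseteq> {1..k - 1}" by auto
    then have "xs \<in> rows (k - 1) (Suc m)" using assms by (simp add: rows_def)
    then show ?thesis using that(1) x False by (simp add: xs)
  qed
qed

lemma rows_mono: "xs \<in> rows (k - 1) m \<Longrightarrow> xs \<in> rows k m"
proof -
  have "{1..k - 1} \<subseteq> {1..k}" by auto
  then show "xs \<in> rows (k - 1) m \<Longrightarrow> xs \<in> rows k m" unfolding rows_def by blast
qed

lemma rows_snoc: "zs \<in> rows k m \<Longrightarrow> 1 \<le> k \<Longrightarrow> zs @ [k] \<in> rows k (Suc m)"
  by (auto simp: rows_def sorted_append)

lemma rows_nth: "xs \<in> rows k m \<Longrightarrow> c < m \<Longrightarrow> 1 \<le> xs ! c \<and> xs ! c \<le> k"
proof -
  assume a: "xs \<in> rows k m" "c < m"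
  then have "xs ! c \<in> set xs" by (simp add: rows_def)
  moreover have "set xs \<subseteq> {1..k}" using a by (simp add: rows_def)
  ultimately have "xs ! c \<in> {1..k}" by (rule rev_subsetD)
  then show ?thesis by simp
qed

text \<open>Splits by whether the first row ends in \<open>k\<close>. As \<open>q \<le> p\<close>,
  the box at its end has nothing below it and can be deleted freely.\<close>

lemma flagged_first_row:
  assumes "1 \<le> k" "q \<le> p"
  shows "flagged k l (Suc p) q = flagged (k - 1) l (Suc p) q + X k * flagged k l p q"
proof -
  let ?f = "\<lambda>(xs, ys). (xs @ [k], ys :: nat list)"
  have eq: "two_rows k l (Suc p) q = two_rows (k - 1) l (Suc p) q \<union> ?f ` two_rows k l p q"
  proof (intro equalityI subsetI)
    fix z assume "z \<in> two_rows k l (Suc p) q"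
    then obtain xs ys where z: "z = (xs, ys)" "xs \<in> rows k (Suc p)" "ys \<in> rows l q" "\<forall>c<q. xs ! c < ys ! c"
      by (auto simp: two_rows_def)
    from z(2) show "z \<in> two_rows (k - 1) l (Suc p) q \<union> ?f ` two_rows k l p q"
    proof (cases rule: rows_Suc_cases)
      case 1
      then show ?thesis using z by (auto simp: two_rows_def)
    next
      case (2 zs)
      have "length zs = p" using 2 by (simp add: rows_def)
      then have "\<forall>c<q. zs ! c < ys ! c" using z(4) assms by (auto simp: 2 nth_append)
      then have "(zs, ys) \<in> two_rows k l p q" using 2 z by (auto simp: two_rows_def)
      then show ?thesis using z(1) 2 by force
    qed
  next
    fix z assume "z \<in> two_rows (k - 1) l (Suc p) q \<union> ?f ` two_rows k l p q"
    then consider "z \<in> two_rows (k - 1) l (Suc p) q" | zs ys where "z = (zs @ [k], ys)" "(zs, ys) \<in> two_rows k l p q" by auto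
    then show "z \<in> two_rows k l (Suc p) q"
    proof cases
      case 1
      then show ?thesis by (auto simp: two_rows_def intro: rows_mono)
    next
      case 2
      have "length zs = p" using 2 by (simp add: two_rows_def rows_def)
      then show ?thesis using 2 assms rows_snoc[of zs k p] by (auto simp: two_rows_def nth_append)
    qed
  qed
  have disj: "two_rows (k - 1) l (Suc p) q \<inter> ?f ` two_rows k l p q = {}"
    using assms by (auto simp: two_rows_def rows_def)
  have inj: "inj_on ?f (two_rows k l p q)" by (auto simp: inj_on_def)
  have "flagged k l (Suc p) q = flagged (k - 1) l (Suc p) q + (\<Sum>z\<in>?f ` two_rows k l p q. case z of (xs, ys) \<Rightarrow> row_weight xs * row_weight ys)"
    unfolding flagged_def eq using disj by (intro sum.union_disjoint) (auto simp: finite_two_rows)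
  also have "(\<Sum>z\<in>?f ` two_rows k l p q. case z of (xs, ys) \<Rightarrow> row_weight xs * row_weight ys) = X k * flagged k l p q"
    unfolding sum.reindex[OF inj] flagged_def sum_distrib_left
    by (intro sum.cong) (auto simp: row_weight_snoc mult_ac o_apply)
  finally show ?thesis .
qed

text \<open>An entry \<open>l\<close> at the end of the second row exceeds the entry above it
  automatically, since the first row is bounded by \<open>k < l\<close>.\<close>

lemma flagged_second_row:
  assumes "k < l" "q < p"
  shows "flagged k l p (Suc q) = flagged k (l - 1) p (Suc q) + X l * flagged k l p q"
proof -
  let ?f = "\<lambda>(xs :: nat list, ys). (xs, ys @ [l])"
  have eq: "two_rows k l p (Suc q) = two_rows k (l - 1) p (Suc q) \<union> ?f ` two_rows k l p q"
  proof (intro equalityI subsetI)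
    fix z assume "z \<in> two_rows k l p (Suc q)"
    then obtain xs ys where z: "z = (xs, ys)" "xs \<in> rows k p" "ys \<in> rows l (Suc q)" "\<forall>c<Suc q. xs ! c < ys ! c"
      by (auto simp: two_rows_def)
    from z(3) show "z \<in> two_rows k (l - 1) p (Suc q) \<union> ?f ` two_rows k l p q"
    proof (cases rule: rows_Suc_cases)
      case 1
      then show ?thesis using z by (auto simp: two_rows_def)
    next
      case (2 zs)
      have "length zs = q" using 2 by (simp add: rows_def)
      then have "xs ! c < zs ! c" if "c < q" for c using z(4)[rule_format, of c] that by (simp add: 2 nth_append)
      then have "(xs, zs) \<in> two_rows k l p q" using 2 z by (auto simp: two_rows_def)
      then show ?thesis using z(1) 2 by force
    qed
  next
    fix z assume "z \<in> two_rows k (l - 1) p (Suc q) \<union> ?f ` two_rows k l p q"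
    then consider "z \<in> two_rows k (l - 1) p (Suc q)" | xs zs where "z = (xs, zs @ [l])" "(xs, zs) \<in> two_rows k l p q" by auto
    then show "z \<in> two_rows k l p (Suc q)"
    proof cases
      case 1
      then show ?thesis by (auto simp: two_rows_def intro: rows_mono)
    next
      case 2
      have "length zs = q" "xs ! q \<le> k" using 2 assms rows_nth[of xs k p q] by (auto simp: two_rows_def rows_def)
      then show ?thesis using 2 assms rows_snoc[of zs l q] by (auto simp: two_rows_def nth_append less_Suc_eq)
    qed
  qed
  have disj: "two_rows k (l - 1) p (Suc q) \<inter> ?f ` two_rows k l p q = {}"
    using assms by (auto simp: two_rows_def rows_def)
  have inj: "inj_on ?f (two_rows k l p q)" by (auto simp: inj_on_def)
  have "flagged k l p (Suc q) = flagged k (l - 1) p (Suc q) + (\<Sum>z\<in>?f ` two_rows k l p q. case z of (xs, ys) \<Rightarrow> row_weight xs * row_weight ys)"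
    unfolding flagged_def eq using disj by (intro sum.union_disjoint) (auto simp: finite_two_rows)
  also have "(\<Sum>z\<in>?f ` two_rows k l p q. case z of (xs, ys) \<Rightarrow> row_weight xs * row_weight ys) = X l * flagged k l p q"
    unfolding sum.reindex[OF inj] flagged_def sum_distrib_left
    by (intro sum.cong) (auto simp: row_weight_snoc mult_ac o_apply)
  finally show ?thesis .
qed

text \<open>The end of the first row has a box below it, whose entry is at most \<open>k\<close>, so
  it cannot be \<open>k\<close> itself.\<close>

lemma flagged_square:
  assumes "1 \<le> k"
  shows "flagged k k (Suc p) (Suc p) = flagged (k - 1) k (Suc p) (Suc p)"
proof -
  have "two_rows k k (Suc p) (Suc p) = two_rows (k - 1) k (Suc p) (Suc p)"
  proof (intro equalityI subsetI)
    fix z assume "z \<in> two_rows k k (Suc p) (Suc p)"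
    then obtain xs ys where z: "z = (xs, ys)" "xs \<in> rows k (Suc p)" "ys \<in> rows k (Suc p)" "\<forall>c<Suc p. xs ! c < ys ! c"
      by (auto simp: two_rows_def)
    from z(2) show "z \<in> two_rows (k - 1) k (Suc p) (Suc p)"
    proof (cases rule: rows_Suc_cases)
      case 1
      then show ?thesis using z by (auto simp: two_rows_def)
    next
      case (2 zs)
      have "length zs = p" using 2 by (simp add: rows_def)
      then have "xs ! p = k" by (simp add: 2 nth_append)
      then show ?thesis using z(4) rows_nth[OF z(3), of p] by auto
    qed
  next
    fix z assume "z \<in> two_rows (k - 1) k (Suc p) (Suc p)"
    then show "z \<in> two_rows k k (Suc p) (Suc p)" by (auto simp: two_rows_def intro: rows_mono)
  qed
  then show ?thesis by (simp add: flagged_def)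
qed

lemma hsym_nat_rec: "1 \<le> k \<Longrightarrow> hsym k n = hsym (k - 1) n + X k * hsym k (n - 1)"
  using hsym_Suc[of "k - 1" n] by simp

lemma hsym_at_0: "hsym k 0 = 1"
  by (simp add: hsym_def)

text \<open>The determinant satisfies the recursions of \<open>flagged\<close>: expanding the
  \<open>hsym\<close> factors of one row by their last variable gives the two row recursions. For
  equal bounds and equal lengths the terms with \<open>X k\<close> cancel, which gives
  \<open>flagged_square\<close>.\<close>

theorem flagged_jacobi_trudi:
  "k \<le> l \<Longrightarrow> q \<le> p \<Longrightarrow> flagged k l p q = hsym k (int p) * hsym l (int q) - hsym k (int p + 1) * hsym l (int q - 1)"
proof (induction "k + l + p + q" arbitrary: k l p q rule: less_induct)
  case less
  consider "p = 0" | "k = 0" "1 \<le> p" | "1 \<le> k" "q < p" | "k < l" "q = p" "1 \<le> p" | "1 \<le> k" "k = l" "q = p" "1 \<le> p"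
    using less.prems by linarith
  then show ?case
  proof cases
    case 1
    then have "two_rows k l p q = {([], [])}" using less.prems by (auto simp: two_rows_def rows_def)
    then show ?thesis using 1 less.prems by (simp add: flagged_def row_weight_def hsym_at_0)
  next
    case 2
    then have "two_rows k l p q = {}" by (auto simp: two_rows_def rows_def)
    then show ?thesis using 2 by (simp add: flagged_def)
  next
    case 3
    then obtain p' where p: "p = Suc p'" by (cases p) auto
    have e1: "flagged (k - 1) l (Suc p') q = hsym (k - 1) (int p) * hsym l (int q) - hsym (k - 1) (int p + 1) * hsym l (int q - 1)"
      using less.hyps[of "k - 1" l "Suc p'" q] less.prems 3 p by simp
    have e2: "flagged k l p' q = hsym k (int p - 1) * hsym l (int q) - hsym k (int p) * hsym l (int q - 1)"
    proof -
      have "flagged k l p' q = hsym k (int p') * hsym l (int q) - hsym k (int p' + 1) * hsym l (int q - 1)"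
        using less.hyps[of k l p' q] less.prems 3 p by simp
      moreover have "int p' = int p - 1" "int p' + 1 = int p" using p by simp_all
      ultimately show ?thesis by metis
    qed
    have e3: "hsym k (int p) = hsym (k - 1) (int p) + X k * hsym k (int p - 1)"
      "hsym k (int p + 1) = hsym (k - 1) (int p + 1) + X k * hsym k (int p)"
      using hsym_nat_rec[OF 3(1), of "int p"] hsym_nat_rec[OF 3(1), of "int p + 1"] by simp_all
    have e4: "flagged k l p q = flagged (k - 1) l (Suc p') q + X k * flagged k l p' q"
      unfolding p using flagged_first_row[OF 3(1), of q p' l] 3 p by simp
    show ?thesis unfolding e4 e1 e2 unfolding e3 by (simp only: ring_distribs) (simp only: algebra_simps)
  next
    case 4
    then obtain q' where q: "q = Suc q'" by (cases q) auto
    have e1: "flagged k (l - 1) p (Suc q') = hsym k (int p) * hsym (l - 1) (int q) - hsym k (int p + 1) * hsym (l - 1) (int q - 1)"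
      unfolding q[symmetric] by (rule less.hyps) (use less.prems 4 in auto)
    have qi: "int q' = int q - 1" using q by simp
    have e2: "flagged k l p q' = hsym k (int p) * hsym l (int q - 1) - hsym k (int p + 1) * hsym l (int q - 1 - 1)"
      unfolding qi[symmetric] by (rule less.hyps) (use less.prems 4 q in auto)
    have e3: "hsym l (int q) = hsym (l - 1) (int q) + X l * hsym l (int q - 1)"
      "hsym l (int q - 1) = hsym (l - 1) (int q - 1) + X l * hsym l (int q - 1 - 1)"
      by (rule hsym_nat_rec, use 4 in simp)+
    have e4: "flagged k l p q = flagged k (l - 1) p (Suc q') + X l * flagged k l p q'"
      unfolding q using flagged_second_row[OF 4(1), of q' p] 4 q by simp
    show ?thesis unfolding e4 e1 e2 unfolding e3 by (simp only: ring_distribs) (simp only: algebra_simps)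
  next
    case 5
    then obtain p' where p: "p = Suc p'" by (cases p) auto
    have IH: "flagged (k - 1) k p p = hsym (k - 1) (int p) * hsym k (int p) - hsym (k - 1) (int p + 1) * hsym k (int p - 1)"
      using less.hyps[of "k - 1" k p p] 5 by simp
    have "hsym k (int p) = hsym (k - 1) (int p) + X k * hsym k (int p - 1)"
      "hsym k (int p + 1) = hsym (k - 1) (int p + 1) + X k * hsym k (int p)"
      using hsym_nat_rec[OF 5(1), of "int p"] hsym_nat_rec[OF 5(1), of "int p + 1"] by simp_all
    then have "hsym (k - 1) (int p) = hsym k (int p) - X k * hsym k (int p - 1)"
      "hsym (k - 1) (int p + 1) = hsym k (int p + 1) - X k * hsym k (int p)" by simp_all
    then have "flagged (k - 1) k p p = hsym k (int p) * hsym k (int p) - hsym k (int p + 1) * hsym k (int p - 1)"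
      unfolding IH by (simp only:) (simp add: algebra_simps)
    moreover have "flagged k l p q = flagged (k - 1) k p p"
      using flagged_square[OF 5(1), of p'] 5 p by simp
    ultimately show ?thesis using 5 by simp
  qed
qed

lemma young_diagram_two: "young_diagram [p, q] = (\<lambda>c. (0, c)) ` {..<p} \<union> (\<lambda>c. (1, c)) ` {..<q}"
proof (intro equalityI subsetI)
  fix z assume "z \<in> young_diagram [p, q]"
  then obtain r c where z: "z = (r, c)" "r < 2" "c < [p, q] ! r" by (auto simp: young_diagram_def)
  then have "r = 0 \<or> r = 1" by auto
  then show "z \<in> (\<lambda>c. (0, c)) ` {..<p} \<union> (\<lambda>c. (1, c)) ` {..<q}" using z by auto
qed (auto simp: young_diagram_def)

lemma tableau_weight:
  assumes "T \<in> young_diagram [p, q] \<rightarrow>\<^sub>E {1..k}"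
  shows "(\<Prod>i = 1..k. X i ^ card {b \<in> young_diagram [p, q]. T b = i}) = (\<Prod>c<p. X (T (0, c))) * (\<Prod>c<q. X (T (1, c)))"
proof -
  let ?D = "young_diagram [p, q]"
  have fin: "finite ?D" by (simp add: young_diagram_two)
  have "(\<Prod>i = 1..k. X i ^ card {b \<in> ?D. T b = i}) = (\<Prod>i = 1..k. \<Prod>b\<in>{b \<in> ?D. T b = i}. X (T b))"
    by (intro prod.cong) auto
  also have "\<dots> = (\<Prod>b\<in>?D. X (T b))"
    using assms by (intro prod.group fin) auto
  also have "\<dots> = (\<Prod>b\<in>(\<lambda>c. (0, c)) ` {..<p}. X (T b)) * (\<Prod>b\<in>(\<lambda>c. (1, c)) ` {..<q}. X (T b))"
    unfolding young_diagram_two by (intro prod.union_disjoint) auto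
  also have "\<dots> = (\<Prod>c<p. X (T (0, c))) * (\<Prod>c<q. X (T (1, c)))"
    by (simp add: prod.reindex inj_on_def o_apply)
  finally show ?thesis .
qed

lemma schur_two_rows:
  assumes "q \<le> p"
  shows "schur [p, q] k = flagged k k p q"
  unfolding schur_def flagged_def
proof (rule sum.reindex_bij_witness[where
    j = "\<lambda>T. (map (\<lambda>c. T (0, c)) [0..<p], map (\<lambda>c. T (1, c)) [0..<q])" and
    i = "\<lambda>(xs, ys). restrict (\<lambda>(r, c). if r = 0 then xs ! c else ys ! c) (young_diagram [p, q])"])
  let ?D = "young_diagram [p, q]"
  have D: "(0, c) \<in> ?D \<longleftrightarrow> c < p" "(1, c) \<in> ?D \<longleftrightarrow> c < q" "(Suc 0, c) \<in> ?D \<longleftrightarrow> c < q" for c by (auto simp: young_diagram_def)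
  have D01: "r = 0 \<or> r = 1" if "(r, c) \<in> ?D" for r c using that by (auto simp: young_diagram_def)
  {
    fix T assume "T \<in> ssyt [p, q] k"
    then have T: "T \<in> ?D \<rightarrow>\<^sub>E {1..k}"
      and row: "\<And>r c c'. (r, c) \<in> ?D \<Longrightarrow> (r, c') \<in> ?D \<Longrightarrow> c < c' \<Longrightarrow> T (r, c) \<le> T (r, c')"
      and col: "\<And>r r' c. (r, c) \<in> ?D \<Longrightarrow> (r', c) \<in> ?D \<Longrightarrow> r < r' \<Longrightarrow> T (r, c) < T (r', c)"
      unfolding ssyt_def by blast+
    let ?xs = "map (\<lambda>c. T (0, c)) [0..<p]" and ?ys = "map (\<lambda>c. T (1, c)) [0..<q]"
    have range: "T b \<in> {1..k}" if "b \<in> ?D" for b using T that by (rule PiE_mem)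
    have "sorted ?xs" "sorted ?ys"
      using row[of 0] row[of 1] D by (auto simp: sorted_iff_nth_mono_less)
    moreover have "set ?xs \<subseteq> {1..k}" "set ?ys \<subseteq> {1..k}" using range D by (auto simp: One_nat_def)
    ultimately have "(?xs, ?ys) \<in> two_rows k k p q"
      using col[of 0 _ 1] D assms by (auto simp: two_rows_def rows_def)
    then show "(?xs, ?ys) \<in> two_rows k k p q" .
    show "(case (?xs, ?ys) of (xs, ys) \<Rightarrow> restrict (\<lambda>(r, c). if r = 0 then xs ! c else ys ! c) ?D) = T"
    proof (rule HOL.ext)
      fix b :: "nat \<times> nat"
      obtain r c where b: "b = (r, c)" by (cases b)
      show "(case (?xs, ?ys) of (xs, ys) \<Rightarrow> restrict (\<lambda>(r, c). if r = 0 then xs ! c else ys ! c) ?D) b = T b"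
      proof (cases "b \<in> ?D")
        case True
        then show ?thesis using D01[of r c] D b by (auto simp: One_nat_def)
      next
        case False
        then show ?thesis using PiE_arb[OF T False] by simp
      qed
    qed
    show "(case (?xs, ?ys) of (xs, ys) \<Rightarrow> row_weight xs * row_weight ys)
       = (\<Prod>i = 1..k. X i ^ card {b \<in> ?D. T b = i})"
      unfolding tableau_weight[OF T] by (simp add: row_weight_def)
  }
  fix z assume "z \<in> two_rows k k p q"
  then obtain xs ys where z: "z = (xs, ys)" "xs \<in> rows k p" "ys \<in> rows k q" "\<forall>c<q. xs ! c < ys ! c"
    by (auto simp: two_rows_def)
  have len: "length xs = p" "length ys = q" "sorted xs" "sorted ys" using z by (auto simp: rows_def)
  let ?T = "restrict (\<lambda>(r, c). if r = 0 then xs ! c else ys ! c) ?D"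
  have T0: "?T (0, c) = xs ! c" if "c < p" for c using that D by simp
  have T1: "?T (1, c) = ys ! c" if "c < q" for c using that D by simp
  have "?T \<in> ?D \<rightarrow>\<^sub>E {1..k}"
  proof (rule PiE_I)
    fix b assume b: "b \<in> ?D"
    obtain r c where rc: "b = (r, c)" by (cases b)
    show "?T b \<in> {1..k}"
      using b rc D01[of r c] D T0[of c] T1[of c] rows_nth[OF z(2), of c] rows_nth[OF z(3), of c] by auto
  qed simp
  moreover have "?T (r, c) \<le> ?T (r, c')" if "(r, c) \<in> ?D" "(r, c') \<in> ?D" "c < c'" for r c c'
    using D01[OF that(1)]
  proof
    assume r: "r = 0"
    then show ?thesis using that D T0 len sorted_nth_mono[OF len(3), of c c'] by simp
  next
    assume r: "r = 1"
    then have "c < q" "c' < q" using that D by auto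
    then show ?thesis using that T1[of c] T1[of c'] len sorted_nth_mono[OF len(4), of c c'] r by simp
  qed
  moreover have "?T (r, c) < ?T (r', c)" if "(r, c) \<in> ?D" "(r', c) \<in> ?D" "r < r'" for r r' c
  proof -
    have r: "r = 0" "r' = 1" using D01[OF that(1)] D01[OF that(2)] that(3) by auto
    then have "c < q" using that D by simp
    then show ?thesis using T0[of c] T1[of c] r z(4) assms by simp
  qed
  ultimately have "?T \<in> ssyt [p, q] k" unfolding ssyt_def by blast
  then show "(case z of (xs, ys) \<Rightarrow> restrict (\<lambda>(r, c). if r = 0 then xs ! c else ys ! c) ?D) \<in> ssyt [p, q] k"
    by (simp add: z)
  have "map (\<lambda>c. ?T (0, c)) [0..<p] = xs" "map (\<lambda>c. ?T (1, c)) [0..<q] = ys"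
    using D len by (auto intro!: nth_equalityI)
  then show "(map (\<lambda>c. (case z of (xs, ys) \<Rightarrow> restrict (\<lambda>(r, c). if r = 0 then xs ! c else ys ! c) ?D) (0, c)) [0..<p],
      map (\<lambda>c. (case z of (xs, ys) \<Rightarrow> restrict (\<lambda>(r, c). if r = 0 then xs ! c else ys ! c) ?D) (1, c)) [0..<q]) = z"
    by (simp only: z prod.case)
qed

lemma grassmannian_shape_two_rows:
  assumes g: "grassmannian k n \<tau>" and len: "length (grassmannian_shape k \<tau>) = 2"
  obtains p q where "grassmannian_shape k \<tau> = [p, q]" "1 \<le> q" "q \<le> p"
proof -
  let ?\<mu> = "grassmannian_shape k \<tau>"
  have mono: "\<tau> i + (j - i) \<le> \<tau> j" if "1 \<le> i" "i \<le> j" "j \<le> k" for i j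
    using that(2,3)
  proof (induction j rule: dec_induct)
    case (step j)
    have "\<tau> j < \<tau> (Suc j)"
      using g step that(1) unfolding grassmannian_def by (intro strict_mono_onD[of "{1..k}" \<tau>]) auto
    then show ?case using step by auto
  qed simp
  have "sorted_wrt (\<lambda>i j. \<tau> j - j \<le> \<tau> i - i) (rev [1..<k+1])"
    unfolding sorted_wrt_rev
  proof (rule sorted_wrt_mono_rel[OF _ sorted_wrt_upt])
    fix i j assume "i \<in> set [1..<k+1]" "j \<in> set [1..<k+1]" "i < j"
    then show "\<tau> i - i \<le> \<tau> j - j" using mono[of i j] by auto
  qed
  then have "sorted_wrt (\<ge>) (map (\<lambda>j. \<tau> j - j) (rev [1..<k+1]))"
    by (simp add: sorted_wrt_map)
  then have "sorted_wrt (\<ge>) ?\<mu>" unfolding grassmannian_shape_def by (rule sorted_wrt_filter)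
  moreover obtain p q where pq: "?\<mu> = [p, q]" using len by (auto simp: length_Suc_conv numeral_2_eq_2)
  moreover have "q \<noteq> 0"
  proof -
    have "q \<in> set ?\<mu>" using pq by simp
    then show ?thesis unfolding grassmannian_shape_def by simp
  qed
  ultimately show ?thesis using that[of p q] by simp
qed

section \<open>Two Pieri steps\<close>

definition qint :: "nat \<Rightarrow> int poly" where
  "qint n = (\<Sum>s<n. monom 1 s)"

text \<open>If the exponent grows by one from each element to the next, the exponents fill an
  interval without repetition.\<close>

lemma sum_monom_run:
  fixes J :: "nat set" and g :: "nat \<Rightarrow> nat"
  assumes "finite J" "J \<noteq> {}"
    and "\<And>P P'. P \<in> J \<Longrightarrow> P' \<in> J \<Longrightarrow> P < P' \<Longrightarrow> (\<And>Q. Q \<in> J \<Longrightarrow> \<not> (P < Q \<and> Q < P')) \<Longrightarrow> g P' = g P + 1"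
  shows "(\<Sum>P\<in>J. monom (1::int) (g P)) = monom 1 (g (Min J)) * qint (card J) \<and> g (Max J) + 1 = g (Min J) + card J"
  using assms
proof (induction "card J" arbitrary: J)
  case (Suc n)
  show ?case
  proof (cases "J = {Max J}")
    case True
    then obtain P where "J = {P}" by blast
    then show ?thesis by (simp add: qint_def)
  next
    case False
    let ?M = "Max J" and ?K = "J - {Max J}"
    have M: "?M \<in> J" using Suc.prems by simp
    have K: "finite ?K" "?K \<noteq> {}" "card ?K = n" using Suc.prems Suc.hyps(2) False M by auto
    have lt: "P < ?M" if "P \<in> ?K" for P using that Suc.prems(1) by (simp add: order.not_eq_order_implies_strict)
    have IH: "(\<Sum>P\<in>?K. monom (1::int) (g P)) = monom 1 (g (Min ?K)) * qint (card ?K) \<and> g (Max ?K) + 1 = g (Min ?K) + card ?K"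
    proof (rule Suc.hyps(1)[OF K(3)[symmetric] K(1,2)])
      fix P P' assume P: "P \<in> ?K" "P' \<in> ?K" "P < P'" "\<And>Q. Q \<in> ?K \<Longrightarrow> \<not> (P < Q \<and> Q < P')"
      have "\<not> (P < Q \<and> Q < P')" if "Q \<in> J" for Q
        using P(4)[of Q] lt[OF P(2)] that by (cases "Q = ?M") auto
      then show "g P' = g P + 1" using P Suc.prems(3) by blast
    qed
    have min: "Min J = Min ?K"
    proof (rule Min_eqI[OF Suc.prems(1)])
      fix y assume y: "y \<in> J"
      show "Min ?K \<le> y"
        using y K lt[of "Min ?K"] Min_in[OF K(1,2)] by (cases "y = ?M") auto
    next
      show "Min ?K \<in> J" using Min_in[OF K(1,2)] by blast
    qed
    have "g ?M = g (Max ?K) + 1"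
    proof (rule Suc.prems(3))
      show "Max ?K \<in> J" "Max ?K < ?M" using Max_in[OF K(1,2)] lt[of "Max ?K"] by auto
      fix Q assume "Q \<in> J"
      then show "\<not> (Max ?K < Q \<and> Q < ?M)" using Max_ge[OF K(1), of Q] by (cases "Q = ?M") auto
    qed (rule M)
    then have gM: "g ?M = g (Min J) + n" using IH K(3) min by simp
    have "(\<Sum>P\<in>J. monom (1::int) (g P)) = monom 1 (g ?M) + (\<Sum>P\<in>?K. monom (1::int) (g P))"
      using Suc.prems(1) M by (rule sum.remove)
    also have "\<dots> = monom 1 (g (Min J)) * (monom 1 n + qint n)"
      using IH K(3) min gM by (simp add: distrib_left mult_monom)
    finally show ?thesis using gM Suc.hyps(2)[symmetric] by (simp add: qint_def add.commute)
  qed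
qed simp

locale two_step =
  fixes A :: "nat set" and V u :: "nat \<Rightarrow> nat"
  assumes finA: "finite A" and injV: "inj_on V A"
begin

definition midpoints :: "(nat \<Rightarrow> nat) set" where
  "midpoints = {Y \<in> extensional A. pieri_rel A V Y \<and> pieri_rel A Y u}"

definition over :: "nat \<Rightarrow> nat \<Rightarrow> bool" where
  "over a e \<longleftrightarrow> a \<in> A \<and> e \<in> A \<and> V a < V e \<and> u e < u a"

definition moved :: "nat set" where
  "moved = {a\<in>A. V a < u a}"

definition free :: "nat set" where
  "free = {a\<in>moved. \<forall>b. \<not> over b a}"

text \<open>The cluster of \<open>a\<close>. Given a midpoint, the clusters of the free particles
  partition the moved ones, and the place of \<open>a\<close> at the midpoint determines those of
  the particles it overtakes.\<close>

definition cl :: "nat \<Rightarrow> nat set" where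
  "cl a = {e\<in>moved. e = a \<or> over a e}"

definition landings :: "nat \<Rightarrow> nat set" where
  "landings a = (\<lambda>Y. Y a) ` midpoints"

text \<open>Which pairs are inverted is fixed by \<open>V\<close> and \<open>u\<close>. A pair that
  is not inverted stays separated in both steps. If \<open>a\<close> overtakes \<open>e\<close>,
  then \<open>e\<close> makes its whole move in one step and is passed while resting in the other,
  which leaves two alternatives. In this form each pair gives conditions on single values of
  \<open>Y\<close> or a choice between two states.\<close>

lemma midpoints_iff:
  "Y \<in> midpoints \<longleftrightarrow> Y \<in> extensional A \<and> (\<forall>a\<in>A. V a \<le> Y a \<and> Y a \<le> u a) \<and>
    (\<forall>a\<in>A. \<forall>e\<in>A. V a < V e \<longrightarrow> (u a < u e \<and> Y a < V e \<and> u a < Y e) \<or>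
      (u e < u a \<and> e < a \<and> (Y e = u e \<and> Y a < V e \<or> Y e = V e \<and> u e < Y a)))"
  (is "_ \<longleftrightarrow> _ \<and> ?B \<and> ?C")
proof
  assume Y: "Y \<in> midpoints"
  have r: "pieri_rel A V Y" "pieri_rel A Y u" using Y by (auto simp: midpoints_def)
  have le: "V a \<le> Y a \<and> Y a \<le> u a" if "a \<in> A" for a using r that pieri_rel_le by blast
  have "(u a < u e \<and> Y a < V e \<and> u a < Y e) \<or>
      (u e < u a \<and> e < a \<and> (Y e = u e \<and> Y a < V e \<or> Y e = V e \<and> u e < Y a))"
    if a: "a \<in> A" and e: "e \<in> A" and ae: "V a < V e" for a e
    using pieri_relD[OF r(1) a e ae]
  proof
    assume "Y a < V e"
    then show ?thesis using pieri_relD[OF r(2) a e] le[OF a] le[OF e] by auto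
  next
    assume "e < a \<and> Y e = V e \<and> V e < Y a"
    then show ?thesis using pieri_relD[OF r(2) e a] le[OF a] le[OF e] by auto
  qed
  then show "Y \<in> extensional A \<and> ?B \<and> ?C" using Y le by (simp add: midpoints_def)
next
  assume asm: "Y \<in> extensional A \<and> ?B \<and> ?C"
  have le: "V a \<le> Y a" "Y a \<le> u a" if "a \<in> A" for a using asm that by blast+
  have pr: "(u a < u e \<and> Y a < V e \<and> u a < Y e) \<or>
      (u e < u a \<and> e < a \<and> (Y e = u e \<and> Y a < V e \<or> Y e = V e \<and> u e < Y a))"
    if "a \<in> A" "e \<in> A" "V a < V e" for a e using asm that by blast
  have "pieri_rel A V Y"
    unfolding pieri_rel_def
  proof (intro conjI ballI impI le(1))
    fix a e assume ae: "a \<in> A" "e \<in> A" "V a < V e"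
    then show "Y a < V e \<or> e < a \<and> Y e = V e \<and> V e < Y a"
      using pr[OF ae] le[OF ae(2)] by auto
  qed
  moreover have "pieri_rel A Y u"
    unfolding pieri_rel_def
  proof (intro conjI ballI impI le(2))
    fix a e assume ae: "a \<in> A" "e \<in> A" "Y a < Y e"
    then have "V a \<noteq> V e" using injV by (metis inj_onD less_irrefl)
    then consider "V a < V e" | "V e < V a" by linarith
    then show "u a < Y e \<or> e < a \<and> u e = Y e \<and> Y e < u a"
    proof cases
      case 1
      then show ?thesis using pr[OF ae(1,2) 1] le[OF ae(2)] ae(3) by auto
    next
      case 2
      then show ?thesis using pr[OF ae(2,1) 2] le[OF ae(1)] ae(3) by auto
    qed
  qed
  ultimately show "Y \<in> midpoints" using asm by (simp add: midpoints_def)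
qed

lemma midpoints_le: "Y \<in> midpoints \<Longrightarrow> a \<in> A \<Longrightarrow> V a \<le> Y a \<and> Y a \<le> u a"
  using midpoints_iff by blast

lemma midpoints_noninv:
  "Y \<in> midpoints \<Longrightarrow> a \<in> A \<Longrightarrow> e \<in> A \<Longrightarrow> V a < V e \<Longrightarrow> \<not> over a e \<Longrightarrow> u a < u e \<and> Y a < V e \<and> u a < Y e"
  using midpoints_iff[of Y] by (auto simp: over_def)

lemma midpoints_over:
  "Y \<in> midpoints \<Longrightarrow> over a e \<Longrightarrow> e < a \<and> (Y e = u e \<and> Y a < V e \<or> Y e = V e \<and> u e < Y a)"
  using midpoints_iff[of Y] unfolding over_def by (meson less_asym)

lemma midpointsI:
  assumes "Y \<in> extensional A" "\<And>a. a \<in> A \<Longrightarrow> V a \<le> Y a \<and> Y a \<le> u a"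
    and "\<And>a e. a \<in> A \<Longrightarrow> e \<in> A \<Longrightarrow> V a < V e \<Longrightarrow> u a < u e \<Longrightarrow> Y a < V e \<and> u a < Y e"
    and "\<And>a e. over a e \<Longrightarrow> e < a \<and> (Y e = u e \<and> Y a < V e \<or> Y e = V e \<and> u e < Y a)"
    and "\<And>a e. a \<in> A \<Longrightarrow> e \<in> A \<Longrightarrow> V a < V e \<Longrightarrow> u a \<noteq> u e"
  shows "Y \<in> midpoints"
  unfolding midpoints_iff
proof (intro conjI ballI impI)
  fix a e assume ae: "a \<in> A" "e \<in> A" "V a < V e"
  then show "(u a < u e \<and> Y a < V e \<and> u a < Y e) \<or>
      (u e < u a \<and> e < a \<and> (Y e = u e \<and> Y a < V e \<or> Y e = V e \<and> u e < Y a))"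
  proof (cases "u a < u e")
    case True
    then show ?thesis using assms(3)[OF ae] by blast
  next
    case False
    then have "u e < u a" using assms(5)[OF ae] by simp
    then have "over a e" using ae by (simp add: over_def)
    then show ?thesis using assms(4) \<open>u e < u a\<close> by blast
  qed
qed (use assms in auto)

lemma midpoints_u_neq: "Y \<in> midpoints \<Longrightarrow> a \<in> A \<Longrightarrow> e \<in> A \<Longrightarrow> V a < V e \<Longrightarrow> u a \<noteq> u e"
  using midpoints_iff[of Y] by (metis less_irrefl)

lemma over_trans: "over a b \<Longrightarrow> over b c \<Longrightarrow> over a c"
  by (auto simp: over_def)

lemma moved_A: "a \<in> moved \<Longrightarrow> a \<in> A"
  by (simp add: moved_def)

lemma free_A: "a \<in> free \<Longrightarrow> a \<in> A"
  by (simp add: free_def moved_A)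

lemma unmoved: "Y \<in> midpoints \<Longrightarrow> a \<in> A \<Longrightarrow> a \<notin> moved \<Longrightarrow> V a = u a \<and> Y a = V a"
  using midpoints_le[of Y a] by (auto simp: moved_def)

lemma over_moved: "Y \<in> midpoints \<Longrightarrow> over a e \<Longrightarrow> a \<in> moved"
  using midpoints_le[of Y e] by (auto simp: moved_def over_def)

lemma finite_midpoints: "finite midpoints"
proof (rule finite_subset)
  show "midpoints \<subseteq> PiE A (\<lambda>a. {..u a})" using midpoints_iff by (auto simp: PiE_def)
qed (use finA in \<open>auto intro!: finite_PiE\<close>)

lemma finite_moved: "finite moved" "finite free" "finite (cl a)"
  using finA by (auto simp: moved_def free_def cl_def)

lemma free_in_cl: "a \<in> free \<Longrightarrow> a \<in> cl a"
  by (simp add: free_def cl_def)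

lemma free_cl_eq: "b \<in> free \<Longrightarrow> b \<in> cl a \<Longrightarrow> b = a"
  by (auto simp: free_def cl_def)

lemma free_increasing:
  assumes "Y \<in> midpoints" "a \<in> free" "b \<in> free" "V a < V b"
  shows "Y a < V b" "u a < Y b"
  using midpoints_noninv[OF assms(1) free_A[OF assms(2)] free_A[OF assms(3)] assms(4)] assms(3) by (auto simp: free_def)

lemma cl_cover:
  assumes Y: "Y \<in> midpoints" and e: "e \<in> moved"
  shows "\<exists>a\<in>free. e \<in> cl a"
proof (cases "\<exists>b. over b e")
  case False
  then show ?thesis using e by (auto simp: free_def cl_def)
next
  case True
  let ?B = "{b. over b e}"
  have fin: "finite ?B" by (rule finite_subset[OF _ finA]) (auto simp: over_def)
  have "Max (u ` ?B) \<in> u ` ?B" using True fin by (intro Max_in) auto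
  then obtain a where a: "over a e" "u a = Max (u ` ?B)" by auto
  have "\<not> over b a" for b
  proof
    assume b: "over b a"
    then have "over b e" using a over_trans by blast
    then have "u b \<le> u a" using a fin by simp
    then show False using b by (simp add: over_def)
  qed
  then have "a \<in> free" using over_moved[OF Y a(1)] by (simp add: free_def)
  then show ?thesis using a e by (auto simp: cl_def)
qed

text \<open>
  A moved particle overtaken by two free ones would have to move in the second step only (because
  of the upper one) and in the first step only (because of the lower one).
\<close>

lemma cl_unique:
  assumes Y: "Y \<in> midpoints" and a: "a \<in> free" "e \<in> cl a" and b: "b \<in> free" "e \<in> cl b"
  shows "a = b"
proof -
  have e: "e \<in> moved" using a by (simp add: cl_def)
  have no: False if "a \<in> free" "b \<in> free" "over a e" "over b e" "V a < V b" for a b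
  proof -
    have "Y a < V b" "u a < Y b" using free_increasing[OF Y] that by auto
    then show False
      using midpoints_over[OF Y that(3)] midpoints_over[OF Y that(4)] that e by (auto simp: over_def moved_def)
  qed
  consider "e = a" | "e = b" | "over a e" "over b e" using a b by (auto simp: cl_def)
  then show ?thesis
  proof cases
    case 1
    then show ?thesis using a b free_cl_eq by blast
  next
    case 2
    then show ?thesis using a b free_cl_eq by blast
  next
    case 3
    then have "V a = V b" using no[of a b] no[of b a] a b by (meson linorder_neqE_nat)
    then show ?thesis using injV a b free_A by (metis inj_onD)
  qed
qed

lemma over_same_cl:
  assumes Y: "Y \<in> midpoints" and "over b e" "e \<in> moved" "a \<in> free"
  shows "b \<in> cl a \<longleftrightarrow> e \<in> cl a"
proof
  assume "b \<in> cl a"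
  then show "e \<in> cl a" using assms over_trans by (auto simp: cl_def)
next
  assume e: "e \<in> cl a"
  have bm: "b \<in> moved" using over_moved[OF Y assms(2)] .
  then obtain c where c: "c \<in> free" "b \<in> cl c" using cl_cover[OF Y] by blast
  then have "e \<in> cl c" using assms over_trans by (auto simp: cl_def)
  then show "b \<in> cl a" using cl_unique[OF Y assms(4) e c(1)] c by simp
qed

text \<open>The particles \<open>b\<close> and \<open>e\<close> would move in different steps, and
  \<open>a\<close> passes each of them in the step in which it rests. Depending on which one moves
  first, the midpoint place of \<open>a\<close> would lie both below \<open>V b\<close> and above
  \<open>u e\<close>, or both below \<open>V e\<close> and above \<open>u b\<close>.\<close>

lemma no_nested:
  assumes Y: "Y \<in> midpoints" and "over a b" "over b e" "b \<in> moved" "e \<in> moved"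
  shows False
  using midpoints_over[OF Y assms(2)] midpoints_over[OF Y assms(3)] midpoints_over[OF Y over_trans[OF assms(2,3)]]
    assms(2-5) by (auto simp: over_def moved_def)

text \<open>Clusters can be recombined freely: conditions for pairs that are not inverted bound each
  value separately by \<open>V\<close> and \<open>u\<close>, and an overtaken particle that moves
  lies in the same cluster as its overtaker, while a resting one is the same in all
  midpoints.\<close>

lemma midpoints_mix:
  assumes Y: "Y \<in> midpoints" and Y': "Y' \<in> midpoints" and a: "a \<in> free"
  shows "(\<lambda>e. if e \<in> cl a then Y e else Y' e) \<in> midpoints" (is "?Z \<in> _")
proof (rule midpointsI)
  have ext: "Y \<in> extensional A" "Y' \<in> extensional A" using Y Y' midpoints_iff by blast+
  show "?Z \<in> extensional A"
    using ext by (auto simp: extensional_def cl_def moved_def)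
  show "V e \<le> ?Z e \<and> ?Z e \<le> u e" if "e \<in> A" for e using midpoints_le Y Y' that by auto
  show "u b \<noteq> u e" if "b \<in> A" "e \<in> A" "V b < V e" for b e using midpoints_u_neq[OF Y that] .
  show "?Z b < V e \<and> u b < ?Z e" if "b \<in> A" "e \<in> A" "V b < V e" "u b < u e" for b e
    using midpoints_noninv[OF Y that(1-3)] midpoints_noninv[OF Y' that(1-3)] that(4) by (auto simp: over_def)
  fix b e assume o: "over b e"
  show "e < b \<and> (?Z e = u e \<and> ?Z b < V e \<or> ?Z e = V e \<and> u e < ?Z b)"
  proof (cases "e \<in> moved")
    case True
    then have "b \<in> cl a \<longleftrightarrow> e \<in> cl a" using over_same_cl[OF Y o _ a] by blast
    then show ?thesis using midpoints_over[OF Y o] midpoints_over[OF Y' o] by auto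
  next
    case False
    then have "e \<notin> cl a" "e \<in> A" using o by (auto simp: cl_def over_def)
    then show ?thesis
      using midpoints_over[OF Y o] midpoints_over[OF Y' o] unmoved[OF Y _ False] unmoved[OF Y' _ False] by auto
  qed
qed

section \<open>Hops within one cluster\<close>

definition jump :: "nat \<Rightarrow> nat \<Rightarrow> nat" where
  "jump e y = card ({V e<..y} - V ` A)"

text \<open>The hops of a cluster in the first step as a function of the landing \<open>P\<close> of
  its free particle: an overtaken \<open>e\<close> moves in the first step exactly if it has not
  been passed yet, that is, if \<open>P < V e\<close>.\<close>

definition cl_hops :: "nat \<Rightarrow> nat \<Rightarrow> nat" where
  "cl_hops a P = jump a P + (\<Sum>e\<in>cl a - {a}. if P < V e then jump e (u e) else 0)"

lemma cl_over: "e \<in> cl a - {a} \<longleftrightarrow> e \<in> moved \<and> over a e"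
  by (auto simp: cl_def over_def)

lemma hops_cl_hops:
  assumes Y: "Y \<in> midpoints"
  shows "hops A V Y = (\<Sum>a\<in>free. cl_hops a (Y a))"
proof -
  have "hops A V Y = (\<Sum>e\<in>moved. jump e (Y e))"
    unfolding hops_def jump_def
    by (rule sum.mono_neutral_right[OF finA]) (use unmoved[OF Y] in \<open>auto simp: moved_A\<close>)
  also have "moved = (\<Union>a\<in>free. cl a)" using cl_cover[OF Y] by (auto simp: cl_def)
  also have "(\<Sum>e\<in>(\<Union>a\<in>free. cl a). jump e (Y e)) = (\<Sum>a\<in>free. \<Sum>e\<in>cl a. jump e (Y e))"
    using cl_unique[OF Y] by (intro sum.UNION_disjoint) (auto simp: finite_moved)
  also have "\<dots> = (\<Sum>a\<in>free. cl_hops a (Y a))"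
  proof (rule sum.cong[OF refl])
    fix a assume a: "a \<in> free"
    have "(\<Sum>e\<in>cl a. jump e (Y e)) = jump a (Y a) + (\<Sum>e\<in>cl a - {a}. jump e (Y e))"
      using free_in_cl[OF a] finite_moved by (intro sum.remove)
    also have "(\<Sum>e\<in>cl a - {a}. jump e (Y e)) = (\<Sum>e\<in>cl a - {a}. if Y a < V e then jump e (u e) else 0)"
    proof (rule sum.cong[OF refl])
      fix e assume "e \<in> cl a - {a}"
      then have o: "over a e" "e \<in> moved" using cl_over by auto
      show "jump e (Y e) = (if Y a < V e then jump e (u e) else 0)"
        using midpoints_over[OF Y o(1)] o(2) by (auto simp: moved_def jump_def)
    qed
    finally show "(\<Sum>e\<in>cl a. jump e (Y e)) = cl_hops a (Y a)" by (simp add: cl_hops_def)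
  qed
  finally show ?thesis .
qed

text \<open>A vacant site between two landings can fail to be a landing only by lying in the window
  of an overtaken particle, beyond its start but not beyond its end.\<close>

lemma landing_between:
  assumes Y: "Y \<in> midpoints" and Y': "Y' \<in> midpoints" and a: "a \<in> free" and Q: "Y a < Q" "Q < Y' a" "Q \<notin> V ` A"
    and win: "\<And>e. over a e \<Longrightarrow> e \<in> moved \<Longrightarrow> Y a < V e \<Longrightarrow> u e < Y' a \<Longrightarrow> \<not> (V e < Q \<and> Q \<le> u e)"
  shows "Q \<in> landings a"
proof -
  \<comment> \<open>Particles of the cluster starting above \<open>Q\<close> move in the first step,
    those below wait for the second; outside the cluster nothing changes.\<close>
  define Z where "Z e = (if e = a then Q else if e \<in> cl a then if Q < V e then u e else V e else Y e)" for e
  have aA: "a \<in> A" using a free_A by blast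
  have Qe: "Q \<noteq> V e" if "e \<in> A" for e using Q(3) that by auto
  have cle: "Z e = (if Q < V e then Y e else Y' e) \<and> (Q < V e \<or> u e < Q)" if e: "e \<in> cl a" "e \<noteq> a" for e
  proof -
    have o: "over a e" "e \<in> moved" using e cl_over by auto
    then have eA: "e \<in> A" "V e < u e" by (auto simp: moved_def)
    show ?thesis
    proof (cases "Q < V e")
      case True
      then show ?thesis using midpoints_over[OF Y o(1)] Q(1) e eA by (auto simp: Z_def)
    next
      case False
      then have "V e < Q" using Qe[OF eA(1)] by simp
      moreover have "u e < Y' a" using midpoints_over[OF Y' o(1)] \<open>V e < Q\<close> Q(2) by auto
      moreover have "u e < Q" using win[OF o] midpoints_over[OF Y o(1)] calculation Q(1) by force
      ultimately show ?thesis using midpoints_over[OF Y' o(1)] e eA by (auto simp: Z_def)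
    qed
  qed
  have other: "Z e = Y e \<or> Z e = Y' e" if "e \<noteq> a" for e
    using cle[of e] that by (cases "e \<in> cl a") (auto simp: Z_def)
  have Za: "Z a = Q" by (simp add: Z_def)
  have "Z \<in> midpoints"
  proof (rule midpointsI)
    have "Y \<in> extensional A" using Y midpoints_iff by blast
    then show "Z \<in> extensional A" using aA by (auto simp: extensional_def Z_def cl_def moved_def)
    show "V e \<le> Z e \<and> Z e \<le> u e" if "e \<in> A" for e
      using other[of e] midpoints_le[OF Y that] midpoints_le[OF Y' that] Za Q by (cases "e = a") auto
    show "u b \<noteq> u e" if "b \<in> A" "e \<in> A" "V b < V e" for b e using midpoints_u_neq[OF Y that] .
    show "Z b < V e \<and> u b < Z e" if "b \<in> A" "e \<in> A" "V b < V e" "u b < u e" for b e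
    proof -
      have "\<not> over b e" using that by (auto simp: over_def)
      then have *: "Y b < V e \<and> u b < Y e" "Y' b < V e \<and> u b < Y' e"
        using midpoints_noninv[OF Y that(1-3)] midpoints_noninv[OF Y' that(1-3)] by auto
      have "Z b < V e" using * other[of b] Za Q by (cases "b = a") auto
      moreover have "u b < Z e" using * other[of e] Za Q by (cases "e = a") auto
      ultimately show ?thesis by blast
    qed
    fix b e assume o: "over b e"
    have eb: "e < b" using midpoints_over[OF Y o] by blast
    have eA: "e \<in> A" using o by (simp add: over_def)
    have "e \<noteq> a" using o a by (auto simp: free_def)
    show "e < b \<and> (Z e = u e \<and> Z b < V e \<or> Z e = V e \<and> u e < Z b)"
    proof (cases "e \<in> moved")
      case False
      then have "Z e = Y e" by (simp add: Z_def cl_def \<open>e \<noteq> a\<close>)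
      moreover have "V e = u e" "Y e = V e" "Y' e = V e" using unmoved[OF Y eA False] unmoved[OF Y' eA False] by auto
      ultimately show ?thesis
        using eb other[of b] Za Qe[OF eA] midpoints_over[OF Y o] midpoints_over[OF Y' o] by (cases "b = a") auto
    next
      case True
      have same: "b \<in> cl a \<longleftrightarrow> e \<in> cl a" using over_same_cl[OF Y o True a] .
      show ?thesis
      proof (cases "e \<in> cl a")
        case False
        then show ?thesis using same midpoints_over[OF Y o] \<open>e \<noteq> a\<close> free_in_cl[OF a] by (auto simp: Z_def)
      next
        case e: True
        have "b = a"
        proof (rule ccontr)
          assume "b \<noteq> a"
          then have "over a b" "b \<in> moved" using same e cl_over by auto
          then show False using no_nested[OF Y _ o _ True] by blast
        qed
        then show ?thesis using cle[OF e \<open>e \<noteq> a\<close>] e \<open>e \<noteq> a\<close> eb Za by (auto simp: Z_def)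
      qed
    qed
  qed
  then show ?thesis unfolding landings_def using Za by (metis imageI)
qed

lemma landing_free_value:
  assumes Y: "Y \<in> midpoints" and a: "a \<in> A" "V a < Y a"
  shows "Y a \<notin> V ` A"
proof
  assume "Y a \<in> V ` A"
  then obtain f where f: "f \<in> A" "Y a = V f" by auto
  then have "V a < V f" using a by simp
  then show False
    using midpoints_noninv[OF Y a(1) f(1)] midpoints_over[OF Y, of a f] f midpoints_le[OF Y f(1)] by (cases "over a f") auto
qed

text \<open>Going from \<open>P\<close> to the next landing, \<open>a\<close> gains the vacant sites
  in between, and the particles of \<open>E\<close> that it newly passes lose their jumps to the
  second step. The gained sites are \<open>P'\<close> and the vacant sites of the windows of
  \<open>E\<close>, and these windows are disjoint, so the balance is 1.\<close>

lemma cl_hops_consecutive: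
  assumes a: "a \<in> free" and P: "P \<in> landings a" and P': "P' \<in> landings a" and "P < P'"
    and gap: "\<And>Q. Q \<in> landings a \<Longrightarrow> \<not> (P < Q \<and> Q < P')"
  shows "cl_hops a P' = cl_hops a P + 1"
proof -
  obtain Y Y' where Y: "Y \<in> midpoints" "Y a = P" and Y': "Y' \<in> midpoints" "Y' a = P'"
    using P P' by (auto simp: landings_def)
  have aA: "a \<in> A" using a free_A by blast
  have VP: "V a \<le> P" using midpoints_le[OF Y(1) aA] Y by simp
  define E where "E = {e \<in> cl a - {a}. P < V e \<and> u e < P'}"
  have finE: "finite E" unfolding E_def using finite_moved by simp
  have E_over: "over a e" "e \<in> moved" if "e \<in> E" for e using that cl_over by (auto simp: E_def)
  have "(\<Sum>e\<in>cl a - {a}. if P < V e then jump e (u e) else 0)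
    = (\<Sum>e\<in>cl a - {a}. (if P' < V e then jump e (u e) else 0) + (if P < V e \<and> u e < P' then jump e (u e) else 0))"
  proof (rule sum.cong[OF refl])
    fix e assume "e \<in> cl a - {a}"
    then have o: "over a e" "V e < u e" using cl_over by (auto simp: moved_def)
    show "(if P < V e then jump e (u e) else 0) = (if P' < V e then jump e (u e) else 0) + (if P < V e \<and> u e < P' then jump e (u e) else 0)"
      using midpoints_over[OF Y(1) o(1)] midpoints_over[OF Y'(1) o(1)] Y(2) Y'(2) o(2) \<open>P < P'\<close> by auto
  qed
  also have "\<dots> = (\<Sum>e\<in>cl a - {a}. if P' < V e then jump e (u e) else 0) + (\<Sum>e\<in>E. jump e (u e))"
  proof -
    have "(\<Sum>e\<in>E. jump e (u e)) = (\<Sum>e\<in>cl a - {a}. if P < V e \<and> u e < P' then jump e (u e) else 0)"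
      unfolding E_def by (rule sum.inter_filter) (simp add: finite_moved)
    then show ?thesis by (simp only: sum.distrib)
  qed
  finally have 1: "(\<Sum>e\<in>cl a - {a}. if P < V e then jump e (u e) else 0) = \<dots>" .
  have "{V a<..P'} - V ` A = ({V a<..P} - V ` A) \<union> ({P<..P'} - V ` A)"
    using VP \<open>P < P'\<close> by auto
  then have 2: "jump a P' = jump a P + card ({P<..P'} - V ` A)"
    unfolding jump_def by (simp add: card_Un_disjoint disjoint_iff)
  have P'free: "P' \<notin> V ` A" using landing_free_value[OF Y'(1) aA] Y' VP \<open>P < P'\<close> by simp
  \<comment> \<open>Any further vacant site outside all windows would be a landing by
    \<open>landing_between\<close>, against the choice of \<open>P'\<close> as the next one.\<close>
  have "{P<..P'} - V ` A = insert P' (\<Union>e\<in>E. {V e<..u e} - V ` A)"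
  proof (intro equalityI subsetI)
    fix Q assume Q: "Q \<in> {P<..P'} - V ` A"
    show "Q \<in> insert P' (\<Union>e\<in>E. {V e<..u e} - V ` A)"
    proof (rule ccontr)
      assume n: "Q \<notin> insert P' (\<Union>e\<in>E. {V e<..u e} - V ` A)"
      have "Q \<in> landings a"
      proof (rule landing_between[OF Y(1) Y'(1) a])
        fix e assume "over a e" "e \<in> moved" "Y a < V e" "u e < Y' a"
        then have "e \<in> E" using Y Y' cl_over by (auto simp: E_def)
        then show "\<not> (V e < Q \<and> Q \<le> u e)" using n Q by auto
      qed (use Q n Y Y' in auto)
      then show False using gap[of Q] Q n by auto
    qed
  next
    fix Q assume "Q \<in> insert P' (\<Union>e\<in>E. {V e<..u e} - V ` A)"
    then show "Q \<in> {P<..P'} - V ` A" using P'free \<open>P < P'\<close> by (auto simp: E_def)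
  qed
  moreover have "P' \<notin> (\<Union>e\<in>E. {V e<..u e} - V ` A)" by (auto simp: E_def)
  moreover have "card (\<Union>e\<in>E. {V e<..u e} - V ` A) = (\<Sum>e\<in>E. jump e (u e))"
    unfolding jump_def
  proof (rule card_UN_disjoint[OF finE])
    have lt: "u e < V f" if "e \<in> E" "f \<in> E" "V e < V f" for e f
    proof -
      have oe: "over a e" "e \<in> moved" and of: "f \<in> moved" using E_over that by auto
      have "\<not> over e f" using no_nested[OF Y(1) oe(1) _ oe(2) of] by blast
      then have "Y e < V f" using midpoints_noninv[OF Y(1) moved_A[OF oe(2)] moved_A[OF of] that(3)] by blast
      moreover have "Y e = u e" using midpoints_over[OF Y(1) oe(1)] Y(2) that(1) oe(2) by (auto simp: E_def moved_def)
      ultimately show ?thesis by simp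
    qed
    show "\<forall>e\<in>E. \<forall>f\<in>E. e \<noteq> f \<longrightarrow> ({V e<..u e} - V ` A) \<inter> ({V f<..u f} - V ` A) = {}"
    proof (intro ballI impI)
      fix e f assume ef: "e \<in> E" "f \<in> E" "e \<noteq> f"
      then have "V e \<noteq> V f" using injV E_over moved_A by (metis inj_onD)
      then show "({V e<..u e} - V ` A) \<inter> ({V f<..u f} - V ` A) = {}"
        using lt[of e f] lt[of f e] ef by (fastforce simp: nat_neq_iff)
    qed
  qed simp
  ultimately have "card ({P<..P'} - V ` A) = 1 + (\<Sum>e\<in>E. jump e (u e))"
    using finE by simp
  then show ?thesis using 1 2 by (simp add: cl_hops_def)
qed

section \<open>The generating function of the first step as a product\<close>

lemma finite_landings: "finite (landings a)"
  by (simp add: landings_def finite_midpoints)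

lemma midpoints_realize:
  assumes "midpoints \<noteq> {}" "S \<subseteq> free" "\<And>a. a \<in> S \<Longrightarrow> f a \<in> landings a"
  shows "\<exists>Y\<in>midpoints. \<forall>a\<in>S. Y a = f a"
proof -
  have "finite S" using assms(2) finite_moved finite_subset by blast
  then show ?thesis
    using assms(2,3)
  proof (induction S rule: finite_induct)
    case empty
    then show ?case using assms(1) by auto
  next
    case (insert a S)
    then obtain Y' where Y': "Y' \<in> midpoints" "\<forall>b\<in>S. Y' b = f b" by blast
    obtain Y where Y: "Y \<in> midpoints" "Y a = f a" using insert.prems(2)[of a] by (auto simp: landings_def)
    have a: "a \<in> free" using insert.prems by simp
    let ?Z = "\<lambda>e. if e \<in> cl a then Y e else Y' e"
    have "?Z b = f b" if "b \<in> insert a S" for b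
      using that Y(2) Y'(2) free_in_cl[OF a] free_cl_eq[of b a] insert.prems(1) insert.hyps(2) by auto
    then show ?case by (intro bexI[OF _ midpoints_mix[OF Y(1) Y'(1) a]] ballI)
  qed
qed

lemma midpoints_determined:
  assumes Y: "Y \<in> midpoints" and Y': "Y' \<in> midpoints" and eq: "\<And>a. a \<in> free \<Longrightarrow> Y a = Y' a"
  shows "Y = Y'"
proof
  fix e
  show "Y e = Y' e"
  proof (cases "e \<in> A")
    case False
    then show ?thesis using Y Y' midpoints_iff by (metis extensional_arb)
  next
    case eA: True
    show ?thesis
    proof (cases "e \<in> moved")
      case False
      then show ?thesis using unmoved[OF Y eA] unmoved[OF Y' eA] by simp
    next
      case True
      then obtain a where a: "a \<in> free" "e \<in> cl a" using cl_cover[OF Y] by blast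
      show ?thesis
      proof (cases "e = a")
        case False
        then have o: "over a e" using a cl_over by blast
        then show ?thesis using midpoints_over[OF Y o] midpoints_over[OF Y' o] eq[OF a(1)] True by (auto simp: moved_def)
      qed (use eq a in auto)
    qed
  qed
qed

lemma prod_monom: "(\<Prod>a\<in>S. monom (1::int) (f a)) = monom 1 (\<Sum>a\<in>S. f a)"
  by (induction S rule: infinite_finite_induct) (auto simp: mult_monom monom_0 one_pCons)

text \<open>By \<open>midpoints_realize\<close> and \<open>midpoints_determined\<close>, midpoints
  correspond to independent choices of landings for the free particles, so the sum factors. The
  restriction to \<open>B\<close> affects only the factor of \<open>t\<close>; it is later taken to
  be \<open>UNIV\<close> or the single site \<open>u t\<close>.\<close>

lemma sum_midpoints_restricted:
  assumes "midpoints \<noteq> {}" and t: "t \<in> free"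
  shows "(\<Sum>Y\<in>{Y\<in>midpoints. Y t \<in> B}. monom (1::int) (hops A V Y))
    = (\<Sum>P\<in>landings t \<inter> B. monom 1 (cl_hops t P)) * (\<Prod>a\<in>free - {t}. \<Sum>P\<in>landings a. monom 1 (cl_hops a P))"
proof -
  define J where "J a = (if a = t then landings t \<inter> B else landings a)" for a
  have "(\<Sum>P\<in>landings t \<inter> B. monom (1::int) (cl_hops t P)) * (\<Prod>a\<in>free - {t}. \<Sum>P\<in>landings a. monom 1 (cl_hops a P))
    = (\<Prod>a\<in>free. \<Sum>P\<in>J a. monom 1 (cl_hops a P))"
    using t finite_moved(2) by (simp add: prod.remove[of free t] J_def)
  also have "\<dots> = (\<Sum>f\<in>PiE free J. \<Prod>a\<in>free. monom 1 (cl_hops a (f a)))"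
    by (rule prod_sum_PiE) (auto simp: finite_moved J_def finite_landings)
  also have "\<dots> = (\<Sum>Y\<in>{Y\<in>midpoints. Y t \<in> B}. monom (1::int) (hops A V Y))"
  proof (rule sum.reindex_bij_betw[symmetric, THEN trans])
    show "bij_betw (\<lambda>Y. restrict Y free) {Y\<in>midpoints. Y t \<in> B} (PiE free J)"
      unfolding bij_betw_def
    proof (intro conjI inj_onI equalityI subsetI)
      fix Y Y' assume "Y \<in> {Y\<in>midpoints. Y t \<in> B}" "Y' \<in> {Y\<in>midpoints. Y t \<in> B}" and eq: "restrict Y free = restrict Y' free"
      moreover have "Y a = Y' a" if "a \<in> free" for a using fun_cong[OF eq, of a] that by simp
      ultimately show "Y = Y'" using midpoints_determined by blast
    next
      fix f assume "f \<in> (\<lambda>Y. restrict Y free) ` {Y\<in>midpoints. Y t \<in> B}"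
      then show "f \<in> PiE free J" by (auto simp: J_def landings_def)
    next
      fix f assume f: "f \<in> PiE free J"
      have "f a \<in> landings a" if "a \<in> free" for a
        using PiE_mem[OF f that] by (auto simp: J_def split: if_splits)
      then obtain Y where Y: "Y \<in> midpoints" "\<forall>a\<in>free. Y a = f a" using midpoints_realize[OF assms(1), of free f] by blast
      have "Y t \<in> B" using PiE_mem[OF f t] Y t by (simp add: J_def)
      moreover have "restrict Y free = f"
        using Y(2) f by (auto simp: fun_eq_iff restrict_def PiE_def extensional_def)
      ultimately show "f \<in> (\<lambda>Y. restrict Y free) ` {Y\<in>midpoints. Y t \<in> B}" using Y(1) by blast
    qed
  qed (auto intro!: sum.cong simp: prod_monom hops_cl_hops)
  finally show ?thesis by simp
qed

lemma landings_run:
  assumes "midpoints \<noteq> {}" "a \<in> free"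
  shows "(\<Sum>P\<in>landings a. monom (1::int) (cl_hops a P)) = monom 1 (cl_hops a (Min (landings a))) * qint (card (landings a))"
    and "cl_hops a (Max (landings a)) + 1 = cl_hops a (Min (landings a)) + card (landings a)"
  using sum_monom_run[OF finite_landings, of a "cl_hops a"] cl_hops_consecutive[OF assms(2)] assms(1)
  by (auto simp: landings_def)

lemma card_landings_pos: "midpoints \<noteq> {} \<Longrightarrow> 0 < card (landings a)"
  using finite_landings by (auto simp: card_gt_0_iff landings_def)

text \<open>Apart from their starting sites, the landings of free particles other than
  \<open>t\<close> are vacant sites below \<open>V t\<close>, and different particles use different
  ones because their ranges are ordered.\<close>

lemma sum_landings_le:
  assumes ne: "midpoints \<noteq> {}" and t: "t \<in> free" and top: "\<And>a. a \<in> free \<Longrightarrow> a \<noteq> t \<Longrightarrow> V a < V t"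
  shows "(\<Sum>a\<in>free - {t}. card (landings a) - 1) \<le> card ({1..<V t} - V ` A)"
proof -
  obtain Y0 where Y0: "Y0 \<in> midpoints" using ne by blast
  have sub: "landings a - {V a} \<subseteq> {1..<V t} - V ` A" if a: "a \<in> free - {t}" for a
  proof
    fix P assume "P \<in> landings a - {V a}"
    then obtain Y where Y: "Y \<in> midpoints" "Y a = P" "P \<noteq> V a" by (auto simp: landings_def)
    have aA: "a \<in> A" using a free_A by blast
    have "V a < Y a" using midpoints_le[OF Y(1) aA] Y by simp
    moreover have "Y a < V t" using free_increasing(1)[OF Y(1) _ t] a top by blast
    ultimately show "P \<in> {1..<V t} - V ` A" using landing_free_value[OF Y(1) aA] Y by auto
  qed
  have "(\<Sum>a\<in>free - {t}. card (landings a) - 1) \<le> (\<Sum>a\<in>free - {t}. card (landings a - {V a}))"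
  proof (rule sum_mono)
    fix a
    show "card (landings a) - 1 \<le> card (landings a - {V a})"
      using finite_landings by (simp add: card_Diff_singleton_if)
  qed
  also have "\<dots> = card (\<Union>a\<in>free - {t}. landings a - {V a})"
  proof (rule card_UN_disjoint[symmetric])
    have lt: "P < Q" if ab: "a \<in> free" "b \<in> free" "V a < V b" "P \<in> landings a" "Q \<in> landings b" for a b P Q
    proof -
      obtain Y Y' where "Y \<in> midpoints" "Y a = P" "Y' \<in> midpoints" "Y' b = Q" using ab by (auto simp: landings_def)
      then show ?thesis using free_increasing(1)[of Y a b] midpoints_le[of Y' b] ab free_A[of b] by auto
    qed
    show "\<forall>a\<in>free - {t}. \<forall>b\<in>free - {t}. a \<noteq> b \<longrightarrow> (landings a - {V a}) \<inter> (landings b - {V b}) = {}"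
    proof (intro ballI impI)
      fix a b assume ab: "a \<in> free - {t}" "b \<in> free - {t}" "a \<noteq> b"
      then have "V a \<noteq> V b" using injV free_A by (metis DiffD1 inj_onD)
      then consider "V a < V b" | "V b < V a" by linarith
      then have "\<not> (z \<in> landings a \<and> z \<in> landings b)" for z
        by cases (use lt[of a b z z] lt[of b a z z] ab in blast)+
      then show "(landings a - {V a}) \<inter> (landings b - {V b}) = {}" by blast
    qed
  qed (auto simp: finite_moved finite_landings)
  also have "\<dots> \<le> card ({1..<V t} - V ` A)"
    using sub by (intro card_mono) auto
  finally show ?thesis .
qed

end

section \<open>Unimodality of the path counts\<close>

text \<open>The possible products of q-integers \<open>qint n\<close> with positive \<open>n\<close>
  whose total excess, the sum of the \<open>n - 1\<close>, is at most \<open>r\<close>, for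
  \<open>r \<le> 2\<close>.\<close>

definition qshape :: "nat \<Rightarrow> int poly \<Rightarrow> bool" where
  "qshape r Q \<longleftrightarrow> Q = 1 \<or> (1 \<le> r \<and> Q = qint 2) \<or> (2 \<le> r \<and> (Q = qint 3 \<or> Q = qint 2 * qint 2))"

lemma qint_1: "qint (Suc 0) = 1"
  by (simp add: qint_def)

lemma prod_qint_qshape:
  assumes "finite S" "\<And>a. a \<in> S \<Longrightarrow> 0 < n a" "(\<Sum>a\<in>S. n a - 1) \<le> r" "r \<le> (2::nat)"
  shows "qshape r (\<Prod>a\<in>S. qint (n a))"
  using assms
proof (induction S arbitrary: r rule: finite_induct)
  case (insert a S)
  let ?P = "\<Prod>a\<in>S. qint (n a)"
  have le: "(\<Sum>a\<in>S. n a - 1) \<le> r - (n a - 1)" "n a - 1 \<le> r" using insert by auto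
  have IH: "qshape (r - (n a - 1)) ?P" using insert le by (intro insert.IH) auto
  have prod: "(\<Prod>a\<in>insert a S. qint (n a)) = qint (n a) * ?P" using insert.hyps by simp
  have "0 < n a" using insert by simp
  then consider "n a = Suc 0" | "n a = 2" "1 \<le> r" | "n a = 3" "r = 2" using le(2) insert.prems(3) by linarith
  then show ?case
  proof cases
    case 1
    then show ?thesis using IH unfolding prod by (simp add: qint_1)
  next
    case 2
    then show ?thesis using IH insert.prems(3) unfolding prod by (auto simp: qshape_def)
  next
    case 3
    then show ?thesis using IH unfolding prod by (auto simp: qshape_def)
  qed
qed (simp add: qshape_def)

lemma coeff_qint: "coeff (qint n) s = (if s < n then 1 else 0)"
  by (simp add: qint_def coeff_sum)

lemma coeff_qint2_mult: "coeff (qint 2 * P) s = coeff P s + (if 1 \<le> s then coeff P (s - 1) else 0)"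
proof -
  have "qint 2 = monom 1 0 + monom 1 1" by (simp add: qint_def numeral_2_eq_2 One_nat_def)
  then show ?thesis by (simp add: distrib_right coeff_monom_mult)
qed

lemma coeff_qint3_mult:
  "coeff (qint 3 * P) s = coeff P s + (if 1 \<le> s then coeff P (s - 1) else 0) + (if 2 \<le> s then coeff P (s - 2) else 0)"
proof -
  have "qint 3 = monom 1 0 + monom 1 1 + monom 1 2" by (simp add: qint_def numeral_3_eq_3 numeral_2_eq_2 One_nat_def)
  then show ?thesis by (simp add: distrib_right coeff_monom_mult)
qed

text \<open>Reflection maps the ends \<open>L\<close> and \<open>M\<close> of the support to each
  other. This computes the abstract degree \<open>D\<close> from an explicit coefficient
  formula.\<close>

lemma palindrome_center:
  fixes c :: "nat \<Rightarrow> int"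
  assumes sym: "\<And>p. p \<le> D \<Longrightarrow> c p = c (D - p)" and zero: "\<And>p. D < p \<Longrightarrow> c p = 0"
    and lo: "c L \<noteq> 0" "\<And>p. p < L \<Longrightarrow> c p = 0" and hi: "c M \<noteq> 0" "\<And>p. M < p \<Longrightarrow> c p = 0"
  shows "D = L + M"
proof -
  have "L \<le> D" "M \<le> D" using zero lo hi by (meson not_less)+
  moreover have "\<not> M < D - L" using sym[OF \<open>L \<le> D\<close>] lo hi by metis
  moreover have "\<not> D - M < L" using sym[OF \<open>M \<le> D\<close>] lo hi by metis
  ultimately show ?thesis by linarith
qed

text \<open>In each shape the coefficients are written out, and the palindromic symmetry serves to
  locate the centre. Multiplying by \<open>1 - t\<close> turns \<open>qint (Suc m)\<close> into
  \<open>1 - t ^ Suc m\<close>, so past the centre the drops are bounded by the coefficients of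
  \<open>Q\<close>; only \<open>qint 2 * qint 2\<close> has a coefficient 2.\<close>

lemma qshape_bound:
  assumes Q: "qshape r Q" and P: "P = monom 1 U * (Q * qint (Suc m))"
    and sym: "\<And>p. p \<le> D \<Longrightarrow> coeff P p = coeff P (D - p)" and zero: "\<And>p. D < p \<Longrightarrow> coeff P p = 0"
    and p: "D \<le> 2 * p"
  shows "0 \<le> coeff P p - coeff P (Suc p) \<and> coeff P p - coeff P (Suc p) \<le> (if r \<le> 1 then 1 else 2)"
proof -
  have c: "coeff P s = (if U \<le> s then coeff (Q * qint (Suc m)) (s - U) else 0)" for s
    unfolding P by (simp add: coeff_monom_mult)
  consider (a) "Q = 1" | (b) "Q = qint 2" | (c) "2 \<le> r" "Q = qint 3" | (d) "2 \<le> r" "Q = qint 2 * qint 2"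
    using Q by (auto simp: qshape_def)
  then show ?thesis
  proof cases
    case a
    have cc: "coeff P s = (if U \<le> s \<and> s \<le> U + m then 1 else 0)" for s
      unfolding c a by (auto simp: coeff_qint)
    have "D = U + (U + m)"
      by (rule palindrome_center[of D "coeff P", OF sym zero]) (auto simp: cc)
    then show ?thesis using p by (auto simp: cc)
  next
    case b
    have cc: "coeff P s = (if U \<le> s \<and> s \<le> U + m then 1 else 0) + (if U + 1 \<le> s \<and> s \<le> U + m + 1 then 1 else 0)" for s
      unfolding c b by (auto simp: coeff_qint2_mult coeff_qint)
    have "D = U + (U + m + 1)"
      by (rule palindrome_center[of D "coeff P", OF sym zero]) (auto simp: cc)
    then show ?thesis using p by (auto simp: cc)
  next
    case c3: c
    have cc: "coeff P s = (if U \<le> s \<and> s \<le> U + m then 1 else 0) + (if U + 1 \<le> s \<and> s \<le> U + m + 1 then 1 else 0)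
      + (if U + 2 \<le> s \<and> s \<le> U + m + 2 then 1 else 0)" for s
      unfolding c c3 by (auto simp: coeff_qint3_mult coeff_qint)
    have "D = U + (U + m + 2)"
      by (rule palindrome_center[of D "coeff P", OF sym zero]) (auto simp: cc)
    then show ?thesis using p c3(1) by (auto simp: cc)
  next
    case d
    have cc: "coeff P s = (if U \<le> s \<and> s \<le> U + m then 1 else 0) + 2 * (if U + 1 \<le> s \<and> s \<le> U + m + 1 then 1 else 0)
      + (if U + 2 \<le> s \<and> s \<le> U + m + 2 then 1 else 0)" for s
      unfolding c d by (auto simp: mult.assoc coeff_qint2_mult coeff_qint)
    have "D = U + (U + m + 2)"
      by (rule palindrome_center[of D "coeff P", OF sym zero]) (auto simp: cc)
    then show ?thesis using p d(1) by (auto simp: cc)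
  qed
qed

text \<open>The sites a particle advances over are either initially vacant, counted by
  \<open>hops\<close>, or occupied; each occupied one belongs to a particle that is passed and so
  creates an inversion.\<close>

lemma hops_inversions:
  assumes "finite A" "inj_on V A" "pieri_rel A V Y"
  shows "hops A V Y + card {(a, e) \<in> A \<times> A. V a < V e \<and> Y e < Y a} = (\<Sum>a\<in>A. Y a - V a)"
proof -
  have "{(a, e) \<in> A \<times> A. V a < V e \<and> Y e < Y a} = (SIGMA a:A. {e\<in>A. V a < V e \<and> Y e < Y a})" by auto
  then have "card {(a, e) \<in> A \<times> A. V a < V e \<and> Y e < Y a} = (\<Sum>a\<in>A. card {e\<in>A. V a < V e \<and> Y e < Y a})"
    using assms(1) by (simp add: card_SigmaI)
  moreover have "card ({V a<..Y a} - V ` A) + card {e\<in>A. V a < V e \<and> Y e < Y a} = Y a - V a" if a: "a \<in> A" for a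
  proof -
    have "V e \<le> Y a \<longleftrightarrow> Y e < Y a" if "e \<in> A" "V a < V e" for e
      using pieri_relD[OF assms(3) a that] pieri_rel_le[OF assms(3) that(1)] by auto
    then have "{e\<in>A. V a < V e \<and> Y e < Y a} = {e\<in>A. V a < V e \<and> V e \<le> Y a}" by auto
    moreover have "V ` {e\<in>A. V a < V e \<and> V e \<le> Y a} = {V a<..Y a} \<inter> V ` A" by auto
    moreover have "card (V ` {e\<in>A. V a < V e \<and> V e \<le> Y a}) = card {e\<in>A. V a < V e \<and> V e \<le> Y a}"
      by (intro card_image inj_on_subset[OF assms(2)]) auto
    ultimately have "card {e\<in>A. V a < V e \<and> Y e < Y a} = card ({V a<..Y a} \<inter> V ` A)" by (simp only:)
    moreover have "card ({V a<..Y a} - V ` A) + card ({V a<..Y a} \<inter> V ` A) = card {V a<..Y a}"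
    proof -
      have "card ({V a<..Y a} - V ` A) + card ({V a<..Y a} \<inter> V ` A) = card (({V a<..Y a} - V ` A) \<union> ({V a<..Y a} \<inter> V ` A))"
        by (rule card_Un_disjoint[symmetric]) auto
      also have "({V a<..Y a} - V ` A) \<union> ({V a<..Y a} \<inter> V ` A) = {V a<..Y a}" by (rule Un_Diff_Int)
      finally show ?thesis .
    qed
    ultimately show ?thesis by simp
  qed
  ultimately show ?thesis by (simp add: hops_def sum.distrib[symmetric])
qed

context two_step
begin

text \<open>Total displacement minus total inversions between \<open>V\<close> and \<open>u\<close>.
  By \<open>hops_inversions\<close> for both steps this is the number of hops altogether, the same
  for every midpoint.\<close>

definition deg :: nat where
  "deg = (\<Sum>a\<in>A. u a - V a) - card {(a, e). over a e}"

lemma hops_total: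
  assumes Y: "Y \<in> midpoints"
  shows "hops A V Y + hops A Y u = deg"
proof -
  have r: "pieri_rel A V Y" "pieri_rel A Y u" using Y by (auto simp: midpoints_def)
  have injY: "inj_on Y A" using pieri_rel_inj[OF r(1) injV] .
  let ?P1 = "{(a, e) \<in> A \<times> A. V a < V e \<and> Y e < Y a}" and ?P2 = "{(a, e) \<in> A \<times> A. Y a < Y e \<and> u e < u a}"
  have "over a e \<longleftrightarrow> (a, e) \<in> ?P1 \<union> ?P2" for a e
  proof
    assume o: "over a e"
    then have A: "a \<in> A" "e \<in> A" "V a < V e" "u e < u a" by (auto simp: over_def)
    then have "Y a \<noteq> Y e" using injY by (metis inj_onD less_irrefl)
    then show "(a, e) \<in> ?P1 \<union> ?P2" using A by auto
  next
    assume "(a, e) \<in> ?P1 \<union> ?P2"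
    then consider "a \<in> A" "e \<in> A" "V a < V e" "Y e < Y a" | "a \<in> A" "e \<in> A" "Y a < Y e" "u e < u a" by auto
    then show "over a e"
    proof cases
      case 1
      then show ?thesis using midpoints_noninv[OF Y 1(1-3)] midpoints_le[OF Y 1(2)] by force
    next
      case 2
      then have "V a \<noteq> V e" using injV by (metis inj_onD less_irrefl)
      moreover have "\<not> V e < V a"
      proof
        assume "V e < V a"
        then show False
          using midpoints_noninv[OF Y 2(2,1)] midpoints_le[OF Y 2(1)] 2 by (auto simp: over_def)
      qed
      ultimately show ?thesis using 2 by (auto simp: over_def)
    qed
  qed
  then have "{(a, e). over a e} = ?P1 \<union> ?P2" by auto
  moreover have "?P1 \<inter> ?P2 = {}" by auto
  moreover have "finite ?P1" "finite ?P2"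
    by (rule finite_subset[of _ "A \<times> A"]; use finA in auto)+
  ultimately have c: "card {(a, e). over a e} = card ?P1 + card ?P2" by (simp add: card_Un_disjoint)
  have "(\<Sum>a\<in>A. Y a - V a) + (\<Sum>a\<in>A. u a - Y a) = (\<Sum>a\<in>A. u a - V a)"
    using midpoints_le[OF Y] by (auto simp: sum.distrib[symmetric] intro!: sum.cong)
  then show ?thesis
    using hops_inversions[OF finA injV r(1)] hops_inversions[OF finA injY r(2)] c by (simp add: deg_def)
qed

definition gen :: "nat set \<Rightarrow> nat \<Rightarrow> int poly" where
  "gen B t = (\<Sum>Y\<in>{Y\<in>midpoints. Y t \<in> B}. monom 1 (hops A V Y))"

lemma coeff_gen: "coeff (gen B t) p = int (card {Y\<in>midpoints. Y t \<in> B \<and> hops A V Y = p})"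
proof -
  have "coeff (gen B t) p = (\<Sum>Y\<in>{Y\<in>midpoints. Y t \<in> B}. if hops A V Y = p then 1 else 0)"
    by (simp add: gen_def coeff_sum)
  also have "\<dots> = (\<Sum>Y\<in>{Y\<in>{Y\<in>midpoints. Y t \<in> B}. hops A V Y = p}. 1)"
    using finite_midpoints by (intro sum.inter_filter[symmetric]) auto
  finally show ?thesis by (simp add: conj_assoc)
qed

definition count :: "int \<Rightarrow> int \<Rightarrow> int" where
  "count p q = int (card {Y\<in>midpoints. int (hops A V Y) = p \<and> int (hops A Y u) = q})"

lemma count_eq_coeff: "count p q = (if 0 \<le> p \<and> p + q = int deg then coeff (gen UNIV t) (nat p) else 0)"
proof -
  have "{Y\<in>midpoints. int (hops A V Y) = p \<and> int (hops A Y u) = q}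
     = (if 0 \<le> p \<and> p + q = int deg then {Y\<in>midpoints. hops A V Y = nat p} else {})"
  proof -
    have "int (hops A V Y) = p \<and> int (hops A Y u) = q \<longleftrightarrow> 0 \<le> p \<and> p + q = int deg \<and> hops A V Y = nat p"
      if "Y \<in> midpoints" for Y
      using hops_total[OF that] by auto
    then show ?thesis by auto
  qed
  then show ?thesis by (simp add: count_def coeff_gen)
qed

lemma coeff_gen_high: "deg < p \<Longrightarrow> coeff (gen B t) p = 0"
proof -
  assume "deg < p"
  then have "\<not> (Y \<in> midpoints \<and> hops A V Y = p)" for Y using hops_total[of Y] by auto
  then have "{Y\<in>midpoints. Y t \<in> B \<and> hops A V Y = p} = {}" by blast
  then show ?thesis by (simp only: coeff_gen card.empty of_nat_0)
qed

lemma gen_empty: "midpoints = {} \<Longrightarrow> gen B t = 0"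
  by (simp add: gen_def)

definition is_top :: "nat \<Rightarrow> bool" where
  "is_top t \<longleftrightarrow> t \<in> moved \<and> (\<forall>e\<in>moved. u e \<le> u t)"

text \<open>An overtaker of \<open>t\<close> would end higher, which is excluded. A free particle
  starting above \<open>t\<close> would end below it and be overtaken by it, contradicting
  freeness.\<close>

lemma top_free:
  assumes "Y \<in> midpoints" "is_top t"
  shows "t \<in> free" "\<And>a. a \<in> free \<Longrightarrow> a \<noteq> t \<Longrightarrow> V a < V t"
proof -
  have no: "\<not> over b t" for b
  proof
    assume o: "over b t"
    then have "u b \<le> u t" using over_moved[OF assms(1)] assms(2) unfolding is_top_def by blast
    then show False using o by (simp add: over_def)
  qed
  then show t: "t \<in> free" using assms(2) by (simp add: free_def is_top_def)
  fix a assume a: "a \<in> free" "a \<noteq> t"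
  have aA: "a \<in> A" "t \<in> A" using a t free_A by auto
  have "V a \<noteq> V t" using injV aA a by (metis inj_onD)
  moreover have "\<not> V t < V a"
  proof
    assume "V t < V a"
    moreover have "u t \<noteq> u a" using midpoints_u_neq[OF assms(1) aA(2,1)] calculation by blast
    moreover have "u a \<le> u t" using assms(2) a by (auto simp: is_top_def free_def)
    ultimately have "over t a" using aA by (auto simp: over_def)
    then show False using a by (auto simp: free_def)
  qed
  ultimately show "V a < V t" by simp
qed

lemma gen_factor:
  assumes Y: "Y \<in> midpoints" and t: "is_top t" and r: "card ({1..<V t} - V ` A) \<le> r" "r \<le> 2"
  shows "\<exists>U Q. qshape r Q \<and>
    (\<forall>B. gen B t = (\<Sum>P\<in>landings t \<inter> B. monom 1 (cl_hops t P)) * (monom 1 U * Q))"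
proof -
  have ne: "midpoints \<noteq> {}" using Y by blast
  note tf = top_free[OF Y t]
  let ?Q = "\<Prod>a\<in>free - {t}. qint (card (landings a))" and ?U = "\<Sum>a\<in>free - {t}. cl_hops a (Min (landings a))"
  have "(\<Prod>a\<in>free - {t}. \<Sum>P\<in>landings a. monom (1::int) (cl_hops a P)) = (\<Prod>a\<in>free - {t}. monom 1 (cl_hops a (Min (landings a))) * qint (card (landings a)))"
    using landings_run(1)[OF ne] by (intro prod.cong) auto
  also have "\<dots> = monom 1 ?U * ?Q" by (simp add: prod.distrib prod_monom)
  finally have *: "(\<Prod>a\<in>free - {t}. \<Sum>P\<in>landings a. monom (1::int) (cl_hops a P)) = monom 1 ?U * ?Q" .
  have "qshape r ?Q"
    using sum_landings_le[OF ne tf] r finite_moved(2) card_landings_pos[OF ne] by (intro prod_qint_qshape) auto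
  moreover have "gen B t = (\<Sum>P\<in>landings t \<inter> B. monom 1 (cl_hops t P)) * (monom 1 ?U * ?Q)" for B
    unfolding gen_def using sum_midpoints_restricted[OF ne tf(1)] * by simp
  ultimately show ?thesis by blast
qed

text \<open>If \<open>u t\<close> is a landing, it is the last one and carries the top exponent of
  the run of \<open>t\<close>, so adding its contribution shifted by one degree prolongs the run by
  one. This second polynomial is the one that describes \<open>core\<close> in
  \<open>core_top\<close>.\<close>

lemma gen_shapes:
  assumes Y: "Y \<in> midpoints" and t: "is_top t" and r: "card ({1..<V t} - V ` A) \<le> r" "r \<le> 2"
  obtains U m Q where "qshape r Q" "gen UNIV t = monom 1 U * (Q * qint (Suc m))"
    "gen UNIV t + monom 1 1 * gen {u t} t \<in> {monom 1 U * (Q * qint (Suc m)), monom 1 U * (Q * qint (Suc (Suc m)))}"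
proof -
  obtain U0 Q where Q: "qshape r Q"
    and g: "\<And>B. gen B t = (\<Sum>P\<in>landings t \<inter> B. monom 1 (cl_hops t P)) * (monom 1 U0 * Q)"
    using gen_factor[OF assms] by blast
  have ne: "midpoints \<noteq> {}" using Y by blast
  have tf: "t \<in> free" using top_free[OF Y t] by blast
  obtain m where m: "card (landings t) = Suc m" using card_landings_pos[OF ne, of t] gr0_implies_Suc by blast
  define c0 where "c0 = cl_hops t (Min (landings t))"
  define U where "U = c0 + U0"
  have run: "(\<Sum>P\<in>landings t. monom (1::int) (cl_hops t P)) = monom 1 c0 * qint (Suc m)" "cl_hops t (Max (landings t)) = c0 + m"
    using landings_run[OF ne tf] m by (auto simp: c0_def)
  have bounds: "V t \<le> P \<and> P \<le> u t" if "P \<in> landings t" for P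
    using that midpoints_le free_A[OF tf] by (auto simp: landings_def)
  have mm: "monom (1::int) (a + b) = monom 1 a * monom 1 b" for a b by (simp add: mult_monom)
  have mS: "monom (1::int) (Suc a) = monom 1 1 * monom 1 a" for a by (simp add: mult_monom One_nat_def)
  have all: "gen UNIV t = monom 1 U * (Q * qint (Suc m))"
    using g[of UNIV] run(1) by (simp add: U_def mm mult_ac)
  have qS: "qint (Suc n) = qint n + monom 1 n" for n by (simp add: qint_def)
  have "gen UNIV t + monom 1 1 * gen {u t} t \<in> {monom 1 U * (Q * qint (Suc m)), monom 1 U * (Q * qint (Suc (Suc m)))}"
  proof (cases "u t \<in> landings t")
    case True
    then have "Max (landings t) = u t" using bounds finite_landings by (intro Max_eqI) auto
    then have gu: "gen {u t} t = monom 1 (c0 + m) * (monom 1 U0 * Q)" using g[of "{u t}"] True run(2) by simp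
    have "monom 1 1 * gen {u t} t = monom 1 U * (Q * monom 1 (Suc m))"
      unfolding gu U_def mS[of m] mm by (simp only: mult_ac)
    then have "gen UNIV t + monom 1 1 * gen {u t} t = monom 1 U * (Q * qint (Suc (Suc m)))"
      unfolding all qS[of "Suc m"] by (simp add: distrib_left)
    then show ?thesis by simp
  next
    case False
    then have "gen {u t} t = 0" using g[of "{u t}"] by simp
    then show ?thesis using all by simp
  qed
  then show ?thesis using that Q all by blast
qed

lemma top_exists:
  assumes "moved \<noteq> {}"
  obtains t where "is_top t"
proof -
  have "Max (u ` moved) \<in> u ` moved" using assms finite_moved by (intro Max_in) auto
  then obtain t where "t \<in> moved" "u t = Max (u ` moved)" by auto
  moreover have "u e \<le> Max (u ` moved)" if "e \<in> moved" for e using that finite_moved by (intro Max_ge) auto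
  ultimately have "is_top t" by (simp add: is_top_def)
  then show ?thesis by (rule that)
qed

text \<open>The factors other than that of the top particle have total excess at most the number of
  missing values, which \<open>r\<close> bounds. Symmetry is a hypothesis because it comes from
  polynomials: see \<open>count_sym\<close>.\<close>

theorem count_bound:
  assumes r: "card ({1..n} - V ` A) \<le> r" "r \<le> 2" and Vn: "V ` A \<subseteq> {..n}"
    and sym: "\<And>p q. count p q = count q p" and pq: "q \<le> p"
  shows "0 \<le> count p q - count (p + 1) (q - 1) \<and> count p q - count (p + 1) (q - 1) \<le> (if r \<le> 1 then 1 else 2)"
proof (cases "midpoints = {} \<or> p + q \<noteq> int deg \<or> q < 0")
  case True
  then show ?thesis
  proof (elim disjE)
    assume "q < 0"
    then have "count q p = 0" "count (q - 1) (p + 1) = 0" by (simp_all add: count_eq_coeff[of _ _ 0])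
    then show ?thesis using sym by simp
  qed (auto simp: count_eq_coeff[of _ _ 0] gen_empty)
next
  case False
  then have pos: "0 \<le> p" "0 \<le> q" "p + q = int deg" using pq by auto
  obtain Y where Y: "Y \<in> midpoints" using False by blast
  define P where "P = gen UNIV 0"
  have gen_eq: "gen UNIV t = P" for t by (simp add: P_def gen_def)
  have cnt: "count p' q' = (if 0 \<le> p' \<and> p' + q' = int deg then coeff P (nat p') else 0)" for p' q'
    unfolding P_def by (rule count_eq_coeff)
  have symP: "coeff P s = coeff P (deg - s)" if "s \<le> deg" for s
  proof -
    have "nat (int deg - int s) = deg - s" by linarith
    then show ?thesis using sym[of "int s" "int deg - int s"] that by (simp add: cnt)
  qed
  have zeroP: "coeff P s = 0" if "deg < s" for s unfolding P_def by (rule coeff_gen_high[OF that])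
  have dp: "deg \<le> 2 * nat p" using pos pq by linarith
  have "\<exists>U m Q. qshape r Q \<and> P = monom 1 U * (Q * qint (Suc m))"
  proof (cases "moved = {}")
    case True
    have "Y' = Y" if "Y' \<in> midpoints" for Y'
      using midpoints_determined[OF that Y] True by (simp add: free_def)
    then have "midpoints = {Y}" using Y by blast
    moreover have "hops A V Y = 0"
      unfolding hops_def using unmoved[OF Y] True by (auto intro!: sum.neutral)
    ultimately have "P = monom 1 0" by (simp add: P_def gen_def Collect_conv_if)
    then show ?thesis by (intro exI[of _ 0] exI[of _ 1]) (simp add: qshape_def qint_1)
  next
    case False
    then obtain t where t: "is_top t" using top_exists by blast
    have "V t \<le> n" using t Vn by (auto simp: is_top_def moved_def)
    then have "card ({1..<V t} - V ` A) \<le> card ({1..n} - V ` A)" by (intro card_mono) auto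
    then have "card ({1..<V t} - V ` A) \<le> r" using r(1) by simp
    from gen_shapes[OF Y t this r(2)] show ?thesis unfolding gen_eq by metis
  qed
  then obtain U m Q where "qshape r Q" "P = monom 1 U * (Q * qint (Suc m))" by blast
  from qshape_bound[OF this symP zeroP dp] show ?thesis
    using pos by (simp add: cnt nat_add_distrib)
qed

end

section \<open>Structure constants as path counts\<close>

lemma scoef_not_front:
  assumes "f \<in> schubert_span (fronts k)" "u \<notin> fronts k"
  shows "scoef u f = 0"
  using assms(1)
proof induction
  case (base w)
  then have "w \<in> finitary_perms" "w \<noteq> u" using assms(2) fronts_finitary by auto
  then show ?case by (simp add: scoef_schubert)
qed (simp_all add: scoef_0 scoef_add scoef_uminus)

lemma two_step_fronts: "V \<in> fronts k \<Longrightarrow> two_step {1..k} V"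
  by (simp add: two_step_def fronts_inj_on)

text \<open>\<open>restrict\<close> and \<open>ext\<close> translate between intermediate
  permutations of the two Pieri steps and midpoints, which are words on the front; positivity and
  injectivity of a midpoint are inherited from \<open>V\<close>.\<close>

lemma scoef_eq_count:
  assumes V: "V \<in> fronts k" and u: "u \<in> fronts k"
  shows "scoef u (schubert V * hsym k p * hsym k q) = two_step.count {1..k} V u p q"
proof -
  let ?A = "{1..k}"
  interpret T: two_step ?A V u by (rule two_step_fronts[OF V])
  let ?M = "{Y \<in> T.midpoints. int (hops ?A V Y) = p \<and> int (hops ?A Y u) = q}"
  have r: "restrict x ?A a = x a" if "a \<in> ?A" for x :: "nat \<Rightarrow> nat" and a using that by simp
  have "bij_betw (\<lambda>x. restrict x ?A) (pieri_paths k V u p q) ?M"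
  proof (rule bij_betw_byWitness[where f' = "ext k"])
    show "\<forall>x\<in>pieri_paths k V u p q. ext k (restrict x ?A) = x"
      by (auto simp: pieri_paths_def pieri_set_def intro!: ext_eqI)
    have Y: "ext k Y \<in> fronts k \<and> (\<forall>a\<in>?A. ext k Y a = Y a)" if "Y \<in> ?M" for Y
    proof -
      have rel: "pieri_rel ?A V Y" using that by (simp add: T.midpoints_def)
      have inj: "inj_on Y ?A" by (rule pieri_rel_inj[OF rel T.injV])
      have pos: "1 \<le> Y a" if "1 \<le> a" "a \<le> k" for a
        using pieri_rel_le[OF rel, of a] fronts_pos[OF V, of a] that by simp
      show ?thesis using ext_fronts[OF inj pos] ext_apply[OF inj pos] by simp
    qed
    show "\<forall>Y\<in>?M. restrict (ext k Y) ?A = Y"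
    proof
      fix Y assume M: "Y \<in> ?M"
      have "Y \<in> extensional ?A" using M by (simp add: T.midpoints_def)
      then show "restrict (ext k Y) ?A = Y"
        using Y[OF M] by (intro extensionalityI[of _ ?A]) auto
    qed
    show "(\<lambda>x. restrict x ?A) ` pieri_paths k V u p q \<subseteq> ?M"
    proof (rule image_subsetI)
      fix x assume "x \<in> pieri_paths k V u p q"
      then have x: "pieri_rel ?A V x" "int (hops ?A V x) = p" "pieri_rel ?A x u" "int (hops ?A x u) = q"
        by (simp_all add: pieri_paths_def pieri_set_def)
      have "pieri_rel ?A V (restrict x ?A)" "pieri_rel ?A (restrict x ?A) u"
        using x pieri_rel_cong[of ?A V V "restrict x ?A" x] pieri_rel_cong[of ?A "restrict x ?A" x u u] r by blast+
      moreover have "hops ?A V (restrict x ?A) = hops ?A V x" by (rule hops_cong[OF refl r])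
      moreover have "hops ?A (restrict x ?A) u = hops ?A x u" by (rule hops_cong[OF r refl])
      ultimately show "restrict x ?A \<in> ?M" using x by (simp add: T.midpoints_def)
    qed
    show "ext k ` ?M \<subseteq> pieri_paths k V u p q"
    proof (rule image_subsetI)
      fix Y assume M: "Y \<in> ?M"
      have e: "ext k Y a = Y a" if "a \<in> ?A" for a using Y[OF M] that by blast
      have rel: "pieri_rel ?A V Y" "pieri_rel ?A Y u" using M by (simp_all add: T.midpoints_def)
      have "pieri_rel ?A V (ext k Y)" "pieri_rel ?A (ext k Y) u"
        using rel pieri_rel_cong[of ?A V V "ext k Y" Y] pieri_rel_cong[of ?A "ext k Y" Y u u] e by blast+
      moreover have "hops ?A V (ext k Y) = hops ?A V Y" by (rule hops_cong[OF refl e])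
      moreover have "hops ?A (ext k Y) u = hops ?A Y u" by (rule hops_cong[OF e refl])
      ultimately show "ext k Y \<in> pieri_paths k V u p q"
        using M Y[OF M] u by (simp add: pieri_paths_def pieri_set_def)
    qed
  qed
  then have "card (pieri_paths k V u p q) = card ?M" by (rule bij_betw_same_card)
  then show ?thesis by (simp add: scoef_pieri2[OF V] T.count_def)
qed

text \<open>Multiplication by \<open>hsym k p\<close> and by \<open>hsym k q\<close> commutes; the
  symmetry is not visible in the particle description.\<close>

lemma count_sym:
  assumes "V \<in> fronts k" "u \<in> fronts k"
  shows "two_step.count {1..k} V u p q = two_step.count {1..k} V u q p"
  unfolding scoef_eq_count[OF assms, symmetric] by (simp add: mult_ac)

lemma schubert_span_hsym2: "V \<in> fronts k \<Longrightarrow> schubert V * hsym k p * hsym k q \<in> schubert_span (fronts k)"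
  by (intro schubert_span_hsym schubert_span.base)

lemma scoef_no_midpoints:
  assumes V: "V \<in> fronts k" and none: "\<And>Y. Y \<in> two_step.midpoints {1..k} V u \<Longrightarrow> False"
  shows "scoef u (schubert V * hsym k p * hsym k q) = 0"
proof (cases "u \<in> fronts k")
  case True
  interpret T: two_step "{1..k}" V u by (rule two_step_fronts[OF V])
  have "T.midpoints = {}" using none by blast
  then show ?thesis using scoef_eq_count[OF V True] by (simp add: T.count_def)
qed (rule scoef_not_front[OF schubert_span_hsym2[OF V]])

lemma scoef_not_above:
  assumes V: "V \<in> fronts k" and e: "1 \<le> e" "e \<le> k" "u e < V e"
  shows "scoef u (schubert V * hsym k p * hsym k q) = 0"
proof (rule scoef_no_midpoints[OF V])
  interpret T: two_step "{1..k}" V u by (rule two_step_fronts[OF V])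
  fix Y assume "Y \<in> T.midpoints"
  then show False using T.midpoints_le[of Y e] e by simp
qed

section \<open>The bound for increasing tails\<close>

definition jt :: "nat \<Rightarrow> int \<Rightarrow> int \<Rightarrow> zpoly" where
  "jt k p q = hsym k p * hsym k q - hsym k (p + 1) * hsym k (q - 1)"

lemma schubert_jt: "schubert V * jt k p q = schubert V * hsym k p * hsym k q - schubert V * hsym k (p + 1) * hsym k (q - 1)"
  by (simp add: jt_def algebra_simps)

lemma front_bound:
  assumes V: "V \<in> fronts k" and r: "card ({1..n} - V ` {1..k}) \<le> r" "r \<le> 2" "V ` {1..k} \<subseteq> {..n}" and "q \<le> p"
  shows "scoef u (schubert V * jt k p q) \<in> {0..if r \<le> 1 then 1 else 2}"
proof (cases "u \<in> fronts k")
  case True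
  interpret T: two_step "{1..k}" V u by (rule two_step_fronts[OF V])
  show ?thesis
    using T.count_bound[OF r count_sym[OF V True] \<open>q \<le> p\<close>]
    by (simp add: schubert_jt scoef_diff scoef_eq_count[OF V True])
next
  case False
  then show ?thesis by (simp add: schubert_jt scoef_diff scoef_not_front[OF schubert_span_hsym2[OF V]])
qed

section \<open>Multiplication by the last variable\<close>

lemma schubert_span_X_last:
  assumes "f \<in> schubert_span (fronts k)" "1 \<le> k"
  shows "X k * f \<in> schubert_span (fronts k)"
proof -
  have "f * X k \<in> schubert_span (fronts k)"
    using assms(1)
  proof (rule schubert_span_mult)
    fix w assume w: "w \<in> fronts k"
    have "schubert (hop_at k w k) - (\<Sum>a\<in>monk_covers w k. schubert (w \<circ> transpose a k)) \<in> schubert_span (fronts k)"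
      using w assms(2) monk_covers_subset[of w k]
      by (intro schubert_span_diff schubert_span_sum schubert_span.base hop_at(1)[OF w] fronts_comp_transpose) auto
    then show "schubert w * X k \<in> schubert_span (fronts k)"
      using monk[OF w, of k] assms(2) by (simp add: mult.commute)
  qed
  then show ?thesis by (simp add: mult.commute)
qed

text \<open>If two words hop to the same one and start from different last values, the larger of
  these lies below the common target, hence is occupied in the other word at an earlier position,
  where both words agree; that contradicts injectivity. So \<open>hop_preds\<close> has at most one
  element.\<close>

lemma hop_at_last_inj:
  assumes "1 \<le> k"
  shows "inj_on (\<lambda>U. hop_at k U k) (fronts k)"
proof (rule inj_onI)
  have le: "U k \<le> U' k" if U: "U \<in> fronts k" and U': "U' \<in> fronts k" and eq: "hop_at k U k = hop_at k U' k" for U U'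
  proof (rule ccontr)
    assume "\<not> U k \<le> U' k"
    then have lt: "U' k < U k" by simp
    have nf: "next_free k U k = next_free k U' k"
      using hop_at(2)[OF U, of k k] hop_at(2)[OF U', of k k] eq assms by simp
    have "U k \<in> U' ` {1..k}"
      using next_free(3)[where w = U' and r = k and z = "U k" and k = k] next_free(1)[of U k k] lt nf by simp
    then obtain e where e: "1 \<le> e" "e \<le> k" "U k = U' e" by auto
    then have ek: "e \<noteq> k" using lt by auto
    then have "U e = U' e"
      using hop_at(2)[OF U e(1,2), of k] hop_at(2)[OF U' e(1,2), of k] eq by simp
    then show False using e(3) fronts_inj_eq[OF U, of e k] ek by simp
  qed
  fix U U' assume U: "U \<in> fronts k" "U' \<in> fronts k" "hop_at k U k = hop_at k U' k"
  show "U = U'"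
  proof (rule fronts_eqI[OF U(1,2)])
    fix a assume a: "1 \<le> a" "a \<le> k"
    show "U a = U' a"
      using hop_at(2)[OF U(1) a, of k] hop_at(2)[OF U(2) a, of k] U(3) le[OF U] le[OF U(2,1) U(3)[symmetric]]
      by (cases "a = k") auto
  qed
qed

text \<open>Together with \<open>cover_preds\<close> this reads Monk's rule backwards: the sources
  from which multiplication by \<open>X k\<close> reaches \<open>u\<close> with sign plus, and below
  those with sign minus.\<close>

definition hop_preds :: "nat \<Rightarrow> (nat \<Rightarrow> nat) \<Rightarrow> (nat \<Rightarrow> nat) set" where
  "hop_preds k u = {U \<in> fronts k. hop_at k U k = u}"

definition cover_preds :: "nat \<Rightarrow> (nat \<Rightarrow> nat) \<Rightarrow> nat set" where
  "cover_preds k u = {a \<in> {1..<k}. a \<in> monk_covers (u \<circ> transpose a k) k}"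

lemma finite_hop_preds: "1 \<le> k \<Longrightarrow> finite (hop_preds k u)"
proof -
  assume k: "1 \<le> k"
  have "inj_on (\<lambda>U. hop_at k U k) (hop_preds k u)"
    by (rule inj_on_subset[OF hop_at_last_inj[OF k]]) (auto simp: hop_preds_def)
  moreover have "(\<lambda>U. hop_at k U k) ` hop_preds k u \<subseteq> {u}" by (auto simp: hop_preds_def)
  ultimately show ?thesis using inj_on_finite[of _ "hop_preds k u" "{u}"] by blast
qed

lemma cover_predsD:
  assumes "b \<in> cover_preds k u"
  shows "1 \<le> b" "b < k" "u k < u b"
  using assms by (auto simp: cover_preds_def monk_covers_def o_apply)

lemma hop_predsD:
  assumes "U \<in> hop_preds k u" "1 \<le> k"
  shows "U \<in> fronts k" "\<And>a. 1 \<le> a \<Longrightarrow> a < k \<Longrightarrow> U a = u a" "U k < u k" "u k = next_free k U k"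
proof -
  show U: "U \<in> fronts k" using assms by (simp add: hop_preds_def)
  have eq: "hop_at k U k = u" using assms by (simp add: hop_preds_def)
  show "U a = u a" if "1 \<le> a" "a < k" for a using hop_at(2)[OF U, of a k] that eq by simp
  show "u k = next_free k U k" using hop_at(2)[OF U, of k k] assms(2) eq by simp
  then show "U k < u k" using next_free(1) by simp
qed

lemma scoef_X_last:
  assumes "f \<in> schubert_span (fronts k)" "1 \<le> k" "u \<in> fronts k"
  shows "scoef u (X k * f) = (\<Sum>U\<in>hop_preds k u. scoef U f) - (\<Sum>a\<in>cover_preds k u. scoef (u \<circ> transpose a k) f)"
  using assms(1)
proof induction
  case (base U)
  have Uf: "U \<in> finitary_perms" by (rule fronts_finitary[OF base])
  have finc: "finite (monk_covers U k)" by (rule finite_subset[OF monk_covers_subset]) simp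
  have tt: "x \<circ> transpose a k \<circ> transpose a k = x" for x :: "nat \<Rightarrow> nat" and a
    by (simp add: comp_assoc)
  have invol: "U \<circ> transpose a k = u \<longleftrightarrow> U = u \<circ> transpose a k" for a
    using tt[of U a] tt[of u a] by auto
  have "scoef u (X k * schubert U) = scoef u (schubert (hop_at k U k)) - (\<Sum>a\<in>monk_covers U k. scoef u (schubert (U \<circ> transpose a k)))"
    using monk[OF base, of k] assms(2) by (simp add: scoef_diff scoef_sum finc)
  also have "scoef u (schubert (hop_at k U k)) = (if hop_at k U k = u then 1 else 0)"
    by (rule scoef_schubert[OF fronts_finitary[OF hop_at(1)[OF base]]])
  also have "\<dots> = (\<Sum>U'\<in>hop_preds k u. if U = U' then 1 else 0)"
    using base finite_hop_preds[OF assms(2), of u] by (simp add: hop_preds_def)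
  also have "\<dots> = (\<Sum>U'\<in>hop_preds k u. scoef U' (schubert U))"
    by (simp add: scoef_schubert[OF Uf])
  also have "(\<Sum>a\<in>monk_covers U k. scoef u (schubert (U \<circ> transpose a k))) = (\<Sum>a\<in>monk_covers U k. if U = u \<circ> transpose a k then 1 else 0)"
  proof (rule sum.cong[OF refl])
    fix a assume "a \<in> monk_covers U k"
    then have "1 \<le> a" "a \<le> k" using monk_covers_subset[of U k] by auto
    then have "U \<circ> transpose a k \<in> finitary_perms"
      using base assms(2) by (intro fronts_finitary[of _ k] fronts_comp_transpose) auto
    then show "scoef u (schubert (U \<circ> transpose a k)) = (if U = u \<circ> transpose a k then 1 else 0)"
      by (simp add: scoef_schubert invol)
  qed
  also have "\<dots> = (\<Sum>a\<in>{1..<k}. if a \<in> monk_covers U k then if U = u \<circ> transpose a k then 1 else 0 else 0)"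
    using monk_covers_subset[of U k] by (intro sum.mono_neutral_cong_left) auto
  also have "\<dots> = (\<Sum>a\<in>{1..<k}. if a \<in> monk_covers (u \<circ> transpose a k) k then if U = u \<circ> transpose a k then 1 else 0 else 0)"
    by (rule sum.cong) auto
  also have "\<dots> = (\<Sum>a\<in>cover_preds k u. if U = u \<circ> transpose a k then 1 else 0)"
    unfolding cover_preds_def by (rule sum.inter_filter[symmetric]) simp
  also have "\<dots> = (\<Sum>a\<in>cover_preds k u. scoef (u \<circ> transpose a k) (schubert U))"
    by (simp add: scoef_schubert[OF Uf])
  finally show ?case .
qed (simp_all add: scoef_0 scoef_add scoef_uminus sum.distrib distrib_left sum_negf)

section \<open>A front with one missing value\<close>

text \<open>The case \<open>K = k + 1\<close> with \<open>W = w\<close> and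
  \<open>j = w (K + 1)\<close>: the front misses only \<open>j\<close> among the first
  \<open>K + 1\<close> values, and \<open>j < W K\<close> is the descent after position
  \<open>k\<close>.\<close>

locale gapped_front =
  fixes K j :: nat and W :: "nat \<Rightarrow> nat"
  assumes K: "1 \<le> K" and W: "W \<in> fronts K" and img: "W ` {1..K} = {1..Suc K} - {j}"
    and j: "1 \<le> j" "j < W K"
begin

definition G :: "int \<Rightarrow> int \<Rightarrow> zpoly" where
  "G p q = schubert W * hsym K p * hsym K q"

text \<open>Replacing \<open>hsym k\<close> by \<open>hsym K\<close> in both factors turns the
  product with \<open>W\<close> into \<open>G p q\<close> minus \<open>X K\<close> times a cofactor;
  \<open>core u p q\<close> is the coefficient of \<open>u\<close> in that cofactor. See
  \<open>hsym_product_expansion\<close>.\<close>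

definition core :: "(nat \<Rightarrow> nat) \<Rightarrow> int \<Rightarrow> int \<Rightarrow> int" where
  "core u p q = scoef u (G (p - 1) q) + scoef u (G p (q - 1)) - scoef u (X K * G (p - 1) (q - 1))"

lemma G_sym: "G p q = G q p"
  by (simp add: G_def mult_ac)

lemma core_sym: "core u p q = core u q p"
  by (simp add: core_def G_sym[of q] G_sym[of "q - 1"])

lemma G_span: "G p q \<in> schubert_span (fronts K)"
  unfolding G_def by (rule schubert_span_hsym2[OF W])

lemma W_le: "a \<in> {1..K} \<Longrightarrow> W a \<le> Suc K"
proof -
  assume "a \<in> {1..K}"
  then have "W a \<in> W ` {1..K}" by (rule imageI)
  then show ?thesis unfolding img by simp
qed

lemma W_range: "z \<in> {1..Suc K} \<Longrightarrow> z \<noteq> j \<Longrightarrow> z \<in> W ` {1..K}"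
  using img by blast

lemma G_bound:
  assumes "q \<le> p"
  shows "0 \<le> scoef u (G p q) - scoef u (G (p + 1) (q - 1)) \<and> scoef u (G p q) - scoef u (G (p + 1) (q - 1)) \<le> 1"
proof -
  have "{1..Suc K} - W ` {1..K} \<subseteq> {j}" unfolding img by blast
  then have "card ({1..Suc K} - W ` {1..K}) \<le> 1" using card_mono[of "{j}" "{1..Suc K} - W ` {1..K}"] by simp
  moreover have "W ` {1..K} \<subseteq> {..Suc K}" unfolding img by auto
  ultimately show ?thesis using front_bound[OF W, of "Suc K" 1 q p u] assms
    by (simp add: schubert_jt scoef_diff G_def)
qed

lemma scoef_G_no_midpoints:
  "(\<And>Y. Y \<in> two_step.midpoints {1..K} W u \<Longrightarrow> False) \<Longrightarrow> scoef u (G p q) = 0"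
  unfolding G_def by (rule scoef_no_midpoints[OF W])

lemma scoef_G_not_above: "1 \<le> e \<Longrightarrow> e \<le> K \<Longrightarrow> u e < W e \<Longrightarrow> scoef u (G p q) = 0"
  unfolding G_def by (rule scoef_not_above[OF W])

lemma two_step_W: "two_step {1..K} W"
  by (rule two_step_fronts[OF W])

lemma core_end:
  assumes "u \<in> fronts K"
  shows "core u p q = scoef u (G (p - 1) q) + scoef u (G p (q - 1)) - (\<Sum>U\<in>hop_preds K u. scoef U (G (p - 1) (q - 1)))
    + (\<Sum>b\<in>cover_preds K u. scoef (u \<circ> transpose b K) (G (p - 1) (q - 1)))"
  by (simp add: core_def scoef_X_last[OF G_span K assms])

subsection \<open>Unblocked endpoints\<close>

text \<open>Monk's rule is applied to the start \<open>W\<close>, and every term dies. After a hop,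
  \<open>K\<close> starts above all others; since it does not end on top, some earlier particle
  would have to overtake it, which only later positions can do. After an exchange with
  \<open>a\<close>, position \<open>a\<close> starts at \<open>W K\<close>, above its end.\<close>

lemma core_unblocked:
  assumes unblocked: "\<And>c. 1 \<le> c \<Longrightarrow> c < K \<Longrightarrow> W c < W K \<Longrightarrow> u c < W K"
    and ntop: "\<not> two_step.is_top {1..K} W u K"
  shows "core u p q = scoef u (G (p - 1) q) + scoef u (G p (q - 1))"
proof -
  interpret T: two_step "{1..K}" W u by (rule two_step_W)
  let ?W = "hop_at K W K"
  have W': "?W \<in> fronts K" by (rule hop_at(1)[OF W])
  have WK: "?W K = next_free K W K" using hop_at(2)[OF W, of K K] K by simp
  have We: "?W e = W e" if "1 \<le> e" "e < K" for e using hop_at(2)[OF W, of e K] that by simp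
  have big: "Suc K < ?W K"
  proof (rule ccontr)
    assume "\<not> Suc K < ?W K"
    moreover have "W K < ?W K" using next_free(1)[of W K K] WK by simp
    ultimately have "?W K \<in> W ` {1..K}" using j by (intro W_range) auto
    then show False using next_free(2)[of K W K] WK by simp
  qed
  have hop0: "scoef u (schubert ?W * hsym K p * hsym K q) = 0" for p q
  proof (rule scoef_no_midpoints[OF W'])
    interpret T': two_step "{1..K}" ?W u by (rule two_step_fronts[OF W'])
    fix Y assume Y: "Y \<in> T'.midpoints"
    have "?W K \<le> u K" using T'.midpoints_le[OF Y, of K] K by simp
    then have uK: "W K < u K" using big W_le[of K] K by simp
    then have "K \<in> T.moved" using K by (simp add: T.moved_def)
    then obtain e where e: "e \<in> T.moved" "u K < u e" using ntop unfolding T.is_top_def by (meson leI)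
    then have e': "1 \<le> e" "e < K" by (auto simp: T.moved_def nat_less_le)
    have "W e \<noteq> W K" using e' fronts_inj_eq[OF W, of e K] by simp
    moreover have "\<not> W e < W K" using unblocked[OF e'] uK e(2) by fastforce
    ultimately have "T'.over e K" using e' e(2) We[OF e'] W_le[of e] big K by (simp add: T'.over_def)
    then show False using T'.midpoints_over[OF Y] e' by fastforce
  qed
  have cov0: "scoef u (schubert (W \<circ> transpose a K) * hsym K p * hsym K q) = 0" if a: "a \<in> monk_covers W K" for a p q
  proof -
    have a': "1 \<le> a" "a < K" "W a < W K" using a by (auto simp: monk_covers_def)
    have "W \<circ> transpose a K \<in> fronts K" using a' K by (intro fronts_comp_transpose W) auto
    then show ?thesis
      using a' unblocked[OF a'] by (intro scoef_not_above[of _ K a]) (auto simp: o_apply)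
  qed
  have fin: "finite (monk_covers W K)" by (rule finite_subset[OF monk_covers_subset]) simp
  have "X K * G (p - 1) (q - 1) = (X K * schubert W) * (hsym K (p - 1) * hsym K (q - 1))"
    by (simp add: G_def mult_ac)
  also have "X K * schubert W = schubert ?W - (\<Sum>a\<in>monk_covers W K. schubert (W \<circ> transpose a K))"
    using K by (intro monk[OF W]) auto
  also have "\<dots> * (hsym K (p - 1) * hsym K (q - 1)) = schubert ?W * hsym K (p - 1) * hsym K (q - 1)
      - (\<Sum>a\<in>monk_covers W K. schubert (W \<circ> transpose a K) * hsym K (p - 1) * hsym K (q - 1))"
    by (simp add: left_diff_distrib sum_distrib_right mult.assoc)
  finally have "scoef u (X K * G (p - 1) (q - 1)) = 0"
    by (simp add: scoef_diff scoef_sum fin hop0 cov0)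
  then show ?thesis by (simp add: core_def)
qed

text \<open>A sum of two differences for one missing value, each between 0 and 1.\<close>

lemma core_bound_unblocked:
  assumes "\<And>c. 1 \<le> c \<Longrightarrow> c < K \<Longrightarrow> W c < W K \<Longrightarrow> u c < W K"
    and "\<not> two_step.is_top {1..K} W u K" and "q \<le> p"
  shows "core u p q - core u (p + 1) (q - 1) \<in> {0..2}"
proof -
  have 1: "core u p q = scoef u (G (p - 1) q) + scoef u (G p (q - 1))"
    and 2: "core u (p + 1) (q - 1) = scoef u (G p (q - 1)) + scoef u (G (p + 1) (q - 1 - 1))"
    using core_unblocked[OF assms(1,2), of p q] core_unblocked[OF assms(1,2), of "p + 1" "q - 1"] by simp_all
  have 3: "0 \<le> scoef u (G p (q - 1)) - scoef u (G (p + 1) (q - 1 - 1)) \<and> scoef u (G p (q - 1)) - scoef u (G (p + 1) (q - 1 - 1)) \<le> 1"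
    using assms(3) by (intro G_bound) simp
  have 4: "0 \<le> scoef u (G (p - 1) q) - scoef u (G p (q - 1)) \<and> scoef u (G (p - 1) q) - scoef u (G p (q - 1)) \<le> 1"
  \<comment> \<open>On the diagonal the indices \<open>(p - 1, p)\<close> lie before the centre,
    where \<open>G_bound\<close> does not apply, but the two terms agree by symmetry.\<close>
  proof (cases "q = p")
    case True
    then show ?thesis using G_sym[of "p - 1" p] by simp
  next
    case False
    then show ?thesis using G_bound[of q "p - 1" u] assms(3) by simp
  qed
  show ?thesis unfolding 1 2 using 3 4 by simp
qed

subsection \<open>Blocked endpoints\<close>

text \<open>The last position cannot be overtaken by an earlier one, so \<open>K\<close> must clear
  the end of \<open>c\<close> in the first step. Between \<open>j\<close> and \<open>K + 1\<close>
  no site is vacant, so it lands beyond all starting sites and has then passed the end of every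
  other particle.\<close>

lemma blocked_last:
  assumes Y: "Y \<in> two_step.midpoints {1..K} W s" and c: "1 \<le> c" "c < K" "W c < W K" "W K \<le> s c"
  shows "W K < Y K" "Y K \<le> s K" "\<And>e. 1 \<le> e \<Longrightarrow> e < K \<Longrightarrow> s e < Y K"
proof -
  interpret T: two_step "{1..K}" W s by (rule two_step_W)
  have no: "\<not> T.over e K" if "e < K" for e using T.midpoints_over[OF Y, of e K] that by auto
  have "s c < Y K" using T.midpoints_noninv[OF Y, of c K] no[OF c(2)] c K by simp
  then show WY: "W K < Y K" using c by simp
  show "Y K \<le> s K" using T.midpoints_le[OF Y, of K] K by simp
  have "Y K \<notin> W ` {1..K}" using T.landing_free_value[OF Y _ WY] K by simp
  then have big: "Suc K < Y K" using W_range[of "Y K"] WY j by (cases "Y K \<le> Suc K") auto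
  fix e assume e: "1 \<le> e" "e < K"
  have "W e \<noteq> W K" using e fronts_inj_eq[OF W, of e K] by simp
  then consider "W e < W K" | "W K < W e" by linarith
  then show "s e < Y K"
  proof cases
    case 1
    then show ?thesis using T.midpoints_noninv[OF Y, of e K] no[OF e(2)] e K by simp
  next
    case 2
    have "\<not> Y K < W e" using big W_le[of e] e by simp
    moreover have "T.over K e"
      using T.midpoints_noninv[OF Y _ _ 2] calculation e K by auto
    ultimately show ?thesis using T.midpoints_over[OF Y, of K e] by blast
  qed
qed

lemma is_topI: "W K < u K \<Longrightarrow> (\<And>e. 1 \<le> e \<Longrightarrow> e < K \<Longrightarrow> u e \<le> u K) \<Longrightarrow> two_step.is_top {1..K} W u K"
proof -
  interpret T: two_step "{1..K}" W u by (rule two_step_W)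
  assume "W K < u K" and le: "\<And>e. 1 \<le> e \<Longrightarrow> e < K \<Longrightarrow> u e \<le> u K"
  moreover have "u e \<le> u K" if "e \<in> T.moved" for e
    using le[of e] that by (cases "e = K") (auto simp: T.moved_def)
  ultimately show ?thesis using K by (auto simp: T.is_top_def T.moved_def)
qed

text \<open>A midpoint for the endpoint exchanged at \<open>b\<close> puts \<open>K\<close> on top
  at the value \<open>u b\<close>, which therefore exceeds the other front values before
  \<open>K\<close>; two such positions contradict each other. If \<open>c\<close> is itself
  exchanged, its end changes, and either the other position blocks in its place or the new end still
  lies above \<open>W K\<close>.\<close>

lemma blocked_unique:
  assumes c: "1 \<le> c" "c < K" "W c < W K" "W K \<le> u c"
    and b: "b \<in> cover_preds K u" "Y \<in> two_step.midpoints {1..K} W (u \<circ> transpose b K)"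
    and b': "b' \<in> cover_preds K u" "Y' \<in> two_step.midpoints {1..K} W (u \<circ> transpose b' K)"
  shows "b = b'"
proof (rule ccontr)
  assume ne: "b \<noteq> b'"
  have max: "u e < u a"
    if a: "a \<in> cover_preds K u" "Z \<in> two_step.midpoints {1..K} W (u \<circ> transpose a K)"
      and d: "1 \<le> d" "d < K" "W d < W K" "W K \<le> (u \<circ> transpose a K) d" and e: "1 \<le> e" "e < K" "e \<noteq> a" for a Z d e
    using blocked_last(2,3)[OF a(2) d] e cover_predsD[OF a(1)] by (force simp: o_apply)
  have contra: False
    if a: "a \<in> cover_preds K u" "Z \<in> two_step.midpoints {1..K} W (u \<circ> transpose a K)"
      and a': "a' \<in> cover_preds K u" "Z' \<in> two_step.midpoints {1..K} W (u \<circ> transpose a' K)" and "a \<noteq> a'" "c = a" for a a' Z Z'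
  proof -
    interpret T: two_step "{1..K}" W "u \<circ> transpose a' K" by (rule two_step_W)
    note d = cover_predsD[OF a(1)] and d' = cover_predsD[OF a'(1)]
    have lt: "u a < u a'" using that d d' c by (intro max[OF a' c(1-3)]) (auto simp: o_apply)
    have le: "W a' \<le> u K" using T.midpoints_le[OF a'(2), of a'] d' by (simp add: o_apply)
    have "W a' \<noteq> W K" using d' fronts_inj_eq[OF W, of a' K] by simp
    then consider "W a' < W K" | "W K < W a'" by linarith
    then have "u a' < u a"
    proof cases
      case 1
      then show ?thesis using that d d' lt c by (intro max[OF a d'(1,2) 1]) (auto simp: o_apply)
    next
      case 2
      then show ?thesis using that d d' le c by (intro max[OF a c(1-3)]) (auto simp: o_apply)
    qed
    then show False using lt by simp
  qed
  note d = cover_predsD[OF b(1)] and d' = cover_predsD[OF b'(1)]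
  consider "c = b" | "c = b'" | "c \<noteq> b" "c \<noteq> b'" by blast
  then show False
  proof cases
    case 1
    then show ?thesis using contra[OF b b' ne] by simp
  next
    case 2
    then show ?thesis using contra[OF b' b] ne by simp
  next
    case 3
    have "u b' < u b" using 3 ne d d' c by (intro max[OF b c(1-3)]) (auto simp: o_apply)
    moreover have "u b < u b'" using 3 ne d d' c by (intro max[OF b' c(1-3)]) (auto simp: o_apply)
    ultimately show False by simp
  qed
qed

text \<open>Any midpoint for \<open>u\<close> or for a hop predecessor would make \<open>K\<close>
  end on top, which is excluded. One cover predecessor at most contributes, so \<open>core\<close>
  is either zero or a single coefficient of \<open>G (p - 1) (q - 1)\<close>.\<close>

lemma core_bound_blocked:
  assumes u: "u \<in> fronts K" and c: "1 \<le> c" "c < K" "W c < W K" "W K \<le> u c"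
    and ntop: "\<not> two_step.is_top {1..K} W u K" and pq: "q \<le> p"
  shows "core u p q - core u (p + 1) (q - 1) \<in> {0..1}"
proof -
  have u0: "scoef u (G p q) = 0" for p q
  proof (rule scoef_G_no_midpoints)
    fix Y assume "Y \<in> two_step.midpoints {1..K} W u"
    note B = blocked_last[OF this c]
    have "u e \<le> u K" if "1 \<le> e" "e < K" for e using B(2) B(3)[OF that] by simp
    then show False using ntop is_topI[of u] B by simp
  qed
  have U0: "scoef U (G p q) = 0" if U: "U \<in> hop_preds K u" for U p q
  proof (rule scoef_G_no_midpoints)
    note D = hop_predsD[OF U K]
    fix Y assume Y: "Y \<in> two_step.midpoints {1..K} W U"
    have "W K \<le> U c" using c D(2)[OF c(1,2)] by simp
    note B = blocked_last[OF Y c(1-3) this]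
    have "u e \<le> u K" if "1 \<le> e" "e < K" for e using B(2) B(3)[OF that] D(2)[OF that] D(3) by simp
    then show False using ntop is_topI[of u] B D(3) by simp
  qed
  have core: "core u p q = (\<Sum>b\<in>cover_preds K u. scoef (u \<circ> transpose b K) (G (p - 1) (q - 1)))" for p q
    using core_end[OF u, of p q] u0 U0 by simp
  have fin: "finite (cover_preds K u)" by (simp add: cover_preds_def)
  show ?thesis
  proof (cases "\<exists>b\<in>cover_preds K u. two_step.midpoints {1..K} W (u \<circ> transpose b K) \<noteq> {}")
    case True
    then obtain b Y where b: "b \<in> cover_preds K u" "Y \<in> two_step.midpoints {1..K} W (u \<circ> transpose b K)" by blast
    have "core u p q = scoef (u \<circ> transpose b K) (G (p - 1) (q - 1))" for p q
    proof -
      have "scoef (u \<circ> transpose b' K) (G (p - 1) (q - 1)) = 0" if "b' \<in> cover_preds K u - {b}" for b'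
        using blocked_unique[OF c b, of b'] that by (intro scoef_G_no_midpoints) blast
      then have "(\<Sum>b'\<in>cover_preds K u - {b}. scoef (u \<circ> transpose b' K) (G (p - 1) (q - 1))) = 0" by (rule sum.neutral[OF ballI])
      then show ?thesis unfolding core using sum.remove[OF fin b(1), of "\<lambda>b. scoef (u \<circ> transpose b K) (G (p - 1) (q - 1))"] by simp
    qed
    then show ?thesis using G_bound[of "q - 1" "p - 1" "u \<circ> transpose b K"] pq by simp
  next
    case False
    have "core u p q = 0" for p q
      unfolding core
    proof (rule sum.neutral[OF ballI])
      fix b assume "b \<in> cover_preds K u"
      then show "scoef (u \<circ> transpose b K) (G (p - 1) (q - 1)) = 0" using False by (intro scoef_G_no_midpoints) blast
    qed
    then show ?thesis by simp
  qed
qed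

end

subsection \<open>Endpoints with the last position on top\<close>

lemma hop_preds_between:
  assumes U: "U \<in> hop_preds k u" and k: "1 \<le> k" and z: "U k < z" "z < u k"
  shows "\<exists>b. 1 \<le> b \<and> b < k \<and> z = u b"
proof -
  note D = hop_predsD[OF U k]
  have "z \<in> U ` {1..k}" using next_free(3)[where w = U and r = k and z = z and k = k] z D(4) by simp
  then obtain b where b: "1 \<le> b" "b \<le> k" "z = U b" by auto
  then have "b \<noteq> k" using z by auto
  then show ?thesis using b D(2)[of b] by (intro exI[of _ b]) simp
qed

text \<open>\<open>U\<close> arises from \<open>u\<close> by pulling the last particle back to the
  next vacant value, and the sites it skips are ends of other particles. Particles ending above
  \<open>u k\<close> must already be in place, since the shorter move no longer tests against
  them.\<close>

lemma hop_preds_rel: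
  assumes U: "U \<in> hop_preds k u" and k: "1 \<le> k" and u: "u \<in> fronts k" and inj: "inj_on Y {1..k}"
    and fixed: "\<And>a. 1 \<le> a \<Longrightarrow> a < k \<Longrightarrow> u k < u a \<Longrightarrow> u a \<le> Y a"
  shows "pieri_rel {1..k} Y U \<longleftrightarrow> pieri_rel {1..k} Y u \<and> Y k \<noteq> u k"
proof
  note D = hop_predsD[OF U k]
  have Uu: "U a = u a" if "a \<in> {1..k}" "a \<noteq> k" for a using D(2)[of a] that by simp
  have neq: "Y a \<noteq> Y e" if "a \<in> {1..k}" "e \<in> {1..k}" "a \<noteq> e" for a e using inj that by (meson inj_onD)
  {
    assume r: "pieri_rel {1..k} Y U"
    have le: "Y a \<le> U a" if "a \<in> {1..k}" for a using pieri_rel_le[OF r that] .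
    have Yk: "Y k < u k" using le[of k] D(3) k by simp
    have le': "Y a \<le> u a" if "a \<in> {1..k}" for a
      using le[OF that] Uu[OF that] Yk by (cases "a = k") auto
    have "u a < Y e \<or> e < a \<and> u e = Y e \<and> Y e < u a" if a: "a \<in> {1..k}" and e: "e \<in> {1..k}" and lt: "Y a < Y e" for a e
    proof (cases "a = k")
      case False
      show ?thesis
      proof (cases "e = k")
        case True
        then show ?thesis using pieri_relD[OF r a e lt] Uu[OF a False] a by auto
      next
        case ek: False
        show ?thesis using pieri_relD[OF r a e lt] Uu[OF a False] Uu[OF e ek] by simp
      qed
    next
      case True
      then have ek: "e \<noteq> k" using lt by auto
      have e': "1 \<le> e" "e < k" using e ek by auto
      note Ue = Uu[OF e ek]
      have une: "u e \<noteq> u k" using fronts_inj_eq[OF u] ek by simp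
      from pieri_relD[OF r a e lt] consider "U k < Y e" | "U e = Y e" "Y e < U k" using True by blast
      then show ?thesis
      proof cases
        case 1
        consider "u k < u e" | "u e < u k" using une by linarith
        then show ?thesis
        proof cases
          case 1
          then show ?thesis using fixed[OF e' 1] True by simp
        next
          case 2
          have "Y e < u k" using le'[OF e] 2 by simp
          then obtain b where b: "1 \<le> b" "b < k" "Y e = u b" using hop_preds_between[OF U k 1] by blast
          have "u e = Y e"
          proof (cases "b = e")
            case False
            have bA: "b \<in> {1..k}" using b by simp
            have "Y b < Y e" using le'[OF bA] b neq[OF bA e False] by simp
            from pieri_relD[OF r bA e this] show ?thesis using Uu[OF bA] b Ue by auto
          qed (use b in simp)
          then show ?thesis using 2 True e' by simp
        qed
      next
        case 2
        then show ?thesis using Ue D(3) True e' by simp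
      qed
    qed
    then show "pieri_rel {1..k} Y u \<and> Y k \<noteq> u k" using le' Yk by (auto simp: pieri_rel_def)
  }
  {
    assume "pieri_rel {1..k} Y u \<and> Y k \<noteq> u k"
    then have r: "pieri_rel {1..k} Y u" and "Y k \<noteq> u k" by simp_all
    have le: "Y a \<le> u a" if "a \<in> {1..k}" for a using pieri_rel_le[OF r that] .
    have kA: "k \<in> {1..k}" using k by simp
    have Yk: "Y k < u k" using le[OF kA] \<open>Y k \<noteq> u k\<close> by simp
    have YU: "Y k \<le> U k"
    proof (rule ccontr)
      assume "\<not> Y k \<le> U k"
      then obtain b where b: "1 \<le> b" "b < k" "Y k = u b" using hop_preds_between[OF U k _ Yk] by auto
      have bA: "b \<in> {1..k}" using b by simp
      have "Y b < Y k" using le[OF bA] b neq[OF bA kA] by simp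
      from pieri_relD[OF r bA kA this] show False using b by simp
    qed
    have "U a < Y e \<or> e < a \<and> U e = Y e \<and> Y e < U a" if a: "a \<in> {1..k}" and e: "e \<in> {1..k}" and lt: "Y a < Y e" for a e
    proof (cases "a = k")
      case False
      show ?thesis
      proof (cases "e = k")
        case True
        then show ?thesis using pieri_relD[OF r a e lt] Uu[OF a False] a by auto
      next
        case ek: False
        show ?thesis using pieri_relD[OF r a e lt] Uu[OF a False] Uu[OF e ek] by simp
      qed
    next
      case True
      then have ek: "e \<noteq> k" using lt by auto
      have "U e \<noteq> U k" using fronts_inj_eq[OF D(1)] ek by simp
      then show ?thesis using pieri_relD[OF r a e lt] Uu[OF e ek] True D(3) by auto
    qed
    moreover have "Y a \<le> U a" if "a \<in> {1..k}" for a using le[OF that] Uu[OF that] YU by (cases "a = k") auto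
    ultimately show "pieri_rel {1..k} Y U" by (auto simp: pieri_rel_def)
  }
qed

text \<open>Between the two ends the last particle only passes ends of other particles. The Pieri
  relation forces each of these to be occupied already at the start of the step, so
  \<open>u k\<close> is the only additional vacant site.\<close>

lemma hop_preds_hops:
  assumes U: "U \<in> hop_preds k u" and k: "1 \<le> k" and r: "pieri_rel {1..k} Y u" "pieri_rel {1..k} Y U" and inj: "inj_on Y {1..k}"
  shows "hops {1..k} Y u = Suc (hops {1..k} Y U)"
proof -
  note D = hop_predsD[OF U k]
  have kA: "k \<in> {1..k}" using k by simp
  have Yk: "Y k \<le> U k" by (rule pieri_rel_le[OF r(2) kA])
  have "{Y k<..u k} - Y ` {1..k} = insert (u k) ({Y k<..U k} - Y ` {1..k})"
  proof (intro equalityI subsetI)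
    fix z assume z: "z \<in> {Y k<..u k} - Y ` {1..k}"
    show "z \<in> insert (u k) ({Y k<..U k} - Y ` {1..k})"
    proof (rule ccontr)
      assume n: "z \<notin> insert (u k) ({Y k<..U k} - Y ` {1..k})"
      then have zz: "U k < z" "z < u k" using z by auto
      then obtain b where b: "1 \<le> b" "b < k" "z = u b" using hop_preds_between[OF U k] by blast
      have bA: "b \<in> {1..k}" using b by simp
      have "Y b \<noteq> z" using z bA by auto
      then have Yb: "Y b < z" using pieri_rel_le[OF r(1) bA] b by simp
      have "Y b \<noteq> Y k" using inj bA kA b by (metis inj_onD less_irrefl)
      then consider "Y b < Y k" | "Y k < Y b" by linarith
      then show False
      proof cases
        case 1
        then show ?thesis using pieri_relD[OF r(1) bA kA 1] b zz Yk by simp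
      next
        case 2
        then show ?thesis using pieri_relD[OF r(1) kA bA 2] b zz Yb by simp
      qed
    qed
  next
    fix z assume z: "z \<in> insert (u k) ({Y k<..U k} - Y ` {1..k})"
    have "u k \<notin> Y ` {1..k}"
    proof
      assume "u k \<in> Y ` {1..k}"
      then obtain b where b: "b \<in> {1..k}" "u k = Y b" by blast
      then have "Y k < Y b" using Yk D(3) by simp
      from pieri_relD[OF r(1) kA b(1) this] show False using b by simp
    qed
    then show "z \<in> {Y k<..u k} - Y ` {1..k}" using z Yk D(3) by auto
  qed
  then have "card ({Y k<..u k} - Y ` {1..k}) = Suc (card ({Y k<..U k} - Y ` {1..k}))" using D(3) by simp
  moreover have "(\<Sum>a\<in>{1..k} - {k}. card ({Y a<..u a} - Y ` {1..k})) = (\<Sum>a\<in>{1..k} - {k}. card ({Y a<..U a} - Y ` {1..k}))"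
  proof (rule sum.cong[OF refl])
    fix a assume "a \<in> {1..k} - {k}"
    then have "1 \<le> a" "a < k" by auto
    then show "card ({Y a<..u a} - Y ` {1..k}) = card ({Y a<..U a} - Y ` {1..k})" using D(2) by simp
  qed
  ultimately show ?thesis unfolding hops_def by (simp add: sum.remove[OF _ kA])
qed

lemma hop_preds_exists:
  assumes k: "1 \<le> k" and u: "u \<in> fronts k" and z: "1 \<le> z" "z < u k" "z \<notin> u ` {1..k}"
  shows "hop_preds k u \<noteq> {}"
proof -
  let ?S = "{z. 1 \<le> z \<and> z < u k \<and> z \<notin> u ` {1..k}}"
  have fin: "finite ?S" by simp
  \<comment> \<open>The largest value below \<open>u k\<close> missing from the front, so that the
    next free value after it is \<open>u k\<close>.\<close>
  define m where "m = Max ?S"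
  have "m \<in> ?S" unfolding m_def using z by (intro Max_in fin) blast
  then have m: "1 \<le> m" "m < u k" "m \<notin> u ` {1..k}" by simp_all
  have max: "y \<le> m" if "1 \<le> y" "y < u k" "y \<notin> u ` {1..k}" for y unfolding m_def using that by (intro Max_ge fin) simp
  have "inj_on (u(k := m)) {1..k}"
    using m(3) fronts_inj_on[OF u, of "{1..k}"] by (intro inj_on_fun_updI) auto
  moreover have "1 \<le> (u(k := m)) a" if "1 \<le> a" "a \<le> k" for a using fronts_pos[OF u, of a] that m(1) by auto
  ultimately have U: "ext k (u(k := m)) \<in> fronts k" "\<And>a. 1 \<le> a \<Longrightarrow> a \<le> k \<Longrightarrow> ext k (u(k := m)) a = (u(k := m)) a"
    using ext_fronts ext_apply by simp_all
  define U where "U = ext k (u(k := m))"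
  have Uk: "U k = m" using U(2)[of k] k by (simp add: U_def)
  have Ua: "U a = u a" if "1 \<le> a" "a < k" for a using U(2)[of a] that by (simp add: U_def)
  have mem: "y \<in> U ` {1..k} \<longleftrightarrow> y = m \<or> (\<exists>a. 1 \<le> a \<and> a < k \<and> y = u a)" for y
  proof
    assume "y \<in> U ` {1..k}"
    then obtain a where "1 \<le> a" "a \<le> k" "y = U a" by auto
    then show "y = m \<or> (\<exists>a. 1 \<le> a \<and> a < k \<and> y = u a)" using Uk Ua[of a] by (cases "a = k") auto
  next
    assume "y = m \<or> (\<exists>a. 1 \<le> a \<and> a < k \<and> y = u a)"
    then show "y \<in> U ` {1..k}"
    proof
      assume "y = m"
      then show ?thesis using Uk k by (intro image_eqI[of _ _ k]) auto
    next
      assume "\<exists>a. 1 \<le> a \<and> a < k \<and> y = u a"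
      then obtain a where "1 \<le> a" "a < k" "y = u a" by blast
      then show ?thesis using Ua[of a] by (intro image_eqI[of _ _ a]) auto
    qed
  qed
  have "next_free k U k = u k"
    unfolding next_free_def Uk
  proof (rule Least_equality)
    show "m < u k \<and> u k \<notin> U ` {1..k}" unfolding mem using m(2) fronts_inj_eq[OF u, of k] by auto
    fix y assume y: "m < y \<and> y \<notin> U ` {1..k}"
    show "u k \<le> y"
    proof (rule ccontr)
      assume n: "\<not> u k \<le> y"
      have "y \<notin> u ` {1..k}"
      proof
        assume "y \<in> u ` {1..k}"
        then obtain a where a: "1 \<le> a" "a \<le> k" "y = u a" by auto
        then have "a \<noteq> k" using n by auto
        then have "a < k" using a(2) by simp
        then show False using y a unfolding mem by blast
      qed
      then show False using max[of y] y n m(1) by simp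
    qed
  qed
  note nf = this
  have UF: "U \<in> fronts k" using U(1) by (simp add: U_def)
  have "hop_at k U k = u"
  proof (rule fronts_eqI[OF hop_at(1)[OF UF] u])
    fix a assume a: "1 \<le> a" "a \<le> k"
    show "hop_at k U k a = u a"
      using hop_at(2)[OF UF a, of k] nf Ua[of a] a by (cases "a = k") auto
  qed
  then show ?thesis using UF by (auto simp: hop_preds_def)
qed

context gapped_front
begin

context
  fixes u
  assumes u: "u \<in> fronts K" and top: "two_step.is_top {1..K} W u K"
begin

interpretation T: two_step "{1..K}" W u by (rule two_step_W)

lemma top_unmoved:
  assumes "1 \<le> a" "a < K" "u K < u a"
  shows "u a \<le> W a"
proof (rule ccontr)
  assume "\<not> u a \<le> W a"
  then have "a \<in> T.moved" using assms by (simp add: T.moved_def)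
  then have "u a \<le> u K" using top by (simp add: T.is_top_def)
  then show False using assms by simp
qed

text \<open>After the exchange, position \<open>b\<close> ends at \<open>u K < u b\<close>. As
  \<open>K\<close> is on top, \<open>b\<close> did not move upwards in \<open>u\<close>, so its new
  end is below its start.\<close>

lemma top_cover_preds:
  assumes "b \<in> cover_preds K u"
  shows "scoef (u \<circ> transpose b K) (G p q) = 0"
proof -
  note d = cover_predsD[OF assms]
  show ?thesis using d top_unmoved[OF d] by (intro scoef_G_not_above[of b]) (auto simp: o_apply)
qed

lemma top_midpoints:
  assumes U: "U \<in> hop_preds K u"
  shows "Y \<in> two_step.midpoints {1..K} W U \<longleftrightarrow> Y \<in> T.midpoints \<and> Y K \<noteq> u K"
proof -
  interpret S: two_step "{1..K}" W U by (rule two_step_W)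
  have "pieri_rel {1..K} Y U \<longleftrightarrow> pieri_rel {1..K} Y u \<and> Y K \<noteq> u K" if r: "pieri_rel {1..K} W Y"
  proof (rule hop_preds_rel[OF U K u])
    show "inj_on Y {1..K}" by (rule pieri_rel_inj[OF r T.injV])
    fix a assume a: "1 \<le> a" "a < K" "u K < u a"
    have "W a \<le> Y a" using a by (intro pieri_rel_le[OF r]) simp
    then show "u a \<le> Y a" using top_unmoved[OF a] by simp
  qed
  then show ?thesis unfolding S.midpoints_def T.midpoints_def by blast
qed

lemma top_midpoints_hops:
  assumes U: "U \<in> hop_preds K u" and Y: "Y \<in> T.midpoints" "Y K \<noteq> u K"
  shows "hops {1..K} Y u = Suc (hops {1..K} Y U)"
proof -
  have "Y \<in> two_step.midpoints {1..K} W U" using top_midpoints[OF U] Y by blast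
  then have r: "pieri_rel {1..K} W Y" "pieri_rel {1..K} Y U" by (simp_all add: two_step.midpoints_def[OF two_step_W])
  have r': "pieri_rel {1..K} Y u" using Y by (simp add: T.midpoints_def)
  show ?thesis by (rule hop_preds_hops[OF U K r' r(2) pieri_rel_inj[OF r(1) T.injV]])
qed

lemma top_hop_preds_exists:
  assumes Y: "Y \<in> T.midpoints" "Y K \<noteq> u K"
  shows "hop_preds K u \<noteq> {}"
proof (rule hop_preds_exists[OF K u, of "Y K"])
  have KA: "K \<in> {1..K}" using K by simp
  have r: "pieri_rel {1..K} W Y" "pieri_rel {1..K} Y u" using Y by (simp_all add: T.midpoints_def)
  show "1 \<le> Y K" using pieri_rel_le[OF r(1) KA] j by simp
  show "Y K < u K" using pieri_rel_le[OF r(2) KA] Y(2) by simp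
  show "Y K \<notin> u ` {1..K}"
  proof
    assume "Y K \<in> u ` {1..K}"
    then obtain b where b: "b \<in> {1..K}" "Y K = u b" by blast
    then have "b \<noteq> K" using Y(2) by auto
    moreover have "inj_on Y {1..K}" by (rule pieri_rel_inj[OF r(1) T.injV])
    ultimately have "Y b \<noteq> Y K" using b(1) KA by (meson inj_onD)
    then have "Y b < Y K" using pieri_rel_le[OF r(2) b(1)] b(2) by simp
    from pieri_relD[OF r(2) b(1) KA this] show False using b by simp
  qed
qed

lemma top_hop_sum:
  "(\<Sum>U\<in>hop_preds K u. scoef U (G p q)) =
    int (card {Y \<in> T.midpoints. Y K \<noteq> u K \<and> int (hops {1..K} W Y) = p \<and> int (hops {1..K} Y u) = q + 1})"
proof (cases "hop_preds K u = {}")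
  case True
  then have "{Y \<in> T.midpoints. Y K \<noteq> u K \<and> int (hops {1..K} W Y) = p \<and> int (hops {1..K} Y u) = q + 1} = {}"
    using top_hop_preds_exists by blast
  then show ?thesis using True by (simp only: sum.empty card.empty of_nat_0)
next
  case False
  then obtain U where U: "U \<in> hop_preds K u" by blast
  interpret S: two_step "{1..K}" W U by (rule two_step_W)
  have "U' = U" if "U' \<in> hop_preds K u" for U'
    using inj_onD[OF hop_at_last_inj[OF K], of U' U] that U by (simp add: hop_preds_def)
  then have eq: "hop_preds K u = {U}" using U by blast
  have "{Y \<in> S.midpoints. int (hops {1..K} W Y) = p \<and> int (hops {1..K} Y U) = q}
    = {Y \<in> T.midpoints. Y K \<noteq> u K \<and> int (hops {1..K} W Y) = p \<and> int (hops {1..K} Y u) = q + 1}"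
  proof (rule Collect_cong)
    fix Y
    have "int (hops {1..K} Y u) = q + 1 \<longleftrightarrow> int (hops {1..K} Y U) = q" if "Y \<in> T.midpoints" "Y K \<noteq> u K"
      using top_midpoints_hops[OF U that] by simp
    then show "Y \<in> S.midpoints \<and> int (hops {1..K} W Y) = p \<and> int (hops {1..K} Y U) = q \<longleftrightarrow>
      Y \<in> T.midpoints \<and> Y K \<noteq> u K \<and> int (hops {1..K} W Y) = p \<and> int (hops {1..K} Y u) = q + 1"
      using top_midpoints[OF U, of Y] by blast
  qed
  then show ?thesis
    unfolding eq using scoef_eq_count[OF W hop_predsD(1)[OF U K]] by (simp add: G_def S.count_def)
qed

text \<open>By \<open>top_hop_sum\<close> the hop predecessor removes from
  \<open>count (p - 1) q\<close> all midpoints with \<open>Y K \<noteq> u K\<close>. What remains is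
  \<open>count p (q - 1)\<close> plus the midpoints with \<open>Y K = u K\<close>, shifted by one
  degree; the total degree becomes \<open>deg + 1\<close>.\<close>

lemma core_top:
  "core u p q = (if 0 \<le> p \<and> p + q = int T.deg + 1 then coeff (T.gen UNIV K + monom 1 1 * T.gen {u K} K) (nat p) else 0)"
proof -
  let ?S = "\<lambda>P. {Y \<in> T.midpoints. P (Y K) \<and> int (hops {1..K} W Y) = p - 1 \<and> int (hops {1..K} Y u) = q}"
  have fin: "finite (?S P)" for P using T.finite_midpoints by simp
  have "{Y \<in> T.midpoints. int (hops {1..K} W Y) = p - 1 \<and> int (hops {1..K} Y u) = q} = ?S (\<lambda>y. y = u K) \<union> ?S (\<lambda>y. y \<noteq> u K)"
    by blast
  then have "T.count (p - 1) q = int (card (?S (\<lambda>y. y = u K))) + int (card (?S (\<lambda>y. y \<noteq> u K)))"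
    unfolding T.count_def using card_Un_disjoint[OF fin fin, of "\<lambda>y. y = u K" "\<lambda>y. y \<noteq> u K"] by fastforce
  moreover have "(\<Sum>U\<in>hop_preds K u. scoef U (G (p - 1) (q - 1))) = int (card (?S (\<lambda>y. y \<noteq> u K)))"
    using top_hop_sum[of "p - 1" "q - 1"] by simp
  moreover have "scoef u (G p q) = T.count p q" for p q unfolding G_def by (rule scoef_eq_count[OF W u])
  ultimately have core: "core u p q = T.count p (q - 1) + int (card (?S (\<lambda>y. y = u K)))"
    using core_end[OF u, of p q] top_cover_preds by simp
  have "?S (\<lambda>y. y = u K) = (if 1 \<le> p \<and> p + q = int T.deg + 1 then {Y \<in> T.midpoints. Y K \<in> {u K} \<and> hops {1..K} W Y = nat p - 1} else {})"
  proof -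
    have "int (hops {1..K} W Y) = p - 1 \<and> int (hops {1..K} Y u) = q \<longleftrightarrow> 1 \<le> p \<and> p + q = int T.deg + 1 \<and> hops {1..K} W Y = nat p - 1"
      if "Y \<in> T.midpoints" for Y using T.hops_total[OF that] by auto
    then show ?thesis by auto
  qed
  then have "int (card (?S (\<lambda>y. y = u K))) = (if 1 \<le> p \<and> p + q = int T.deg + 1 then coeff (T.gen {u K} K) (nat p - 1) else 0)"
    by (simp add: T.coeff_gen)
  then show ?thesis unfolding core T.count_eq_coeff[of _ _ K] by (auto simp: coeff_monom_mult nat_le_iff Suc_le_eq One_nat_def)
qed

text \<open>The argument of \<open>count_bound\<close> for the polynomial of
  \<open>core_top\<close>: its shape comes from \<open>gen_shapes\<close> with \<open>r = 1\<close>,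
  since only \<open>j\<close> is missing below \<open>W K\<close>, and its symmetry from
  \<open>core_sym\<close>.\<close>

lemma core_bound_top:
  assumes pq: "q \<le> p"
  shows "core u p q - core u (p + 1) (q - 1) \<in> {0..1}"
proof (cases "T.midpoints = {} \<or> p + q \<noteq> int T.deg + 1 \<or> q < 0")
  case True
  then show ?thesis
  proof (elim disjE)
    assume "q < 0"
    then have "core u q p = 0" "core u (q - 1) (p + 1) = 0" by (simp_all add: core_top)
    then show ?thesis by (simp add: core_sym[of u p] core_sym[of u "p + 1"])
  qed (auto simp: core_top T.gen_empty)
next
  case False
  then have pos: "0 \<le> p" "0 \<le> q" "p + q = int T.deg + 1" using pq by auto
  obtain Y where Y: "Y \<in> T.midpoints" using False by blast
  define P where "P = T.gen UNIV K + monom 1 1 * T.gen {u K} K"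
  have cnt: "core u p' q' = (if 0 \<le> p' \<and> p' + q' = int T.deg + 1 then coeff P (nat p') else 0)" for p' q'
    unfolding P_def by (rule core_top)
  have symP: "coeff P s = coeff P (Suc T.deg - s)" if "s \<le> Suc T.deg" for s
  proof -
    have "nat (int T.deg + 1 - int s) = Suc T.deg - s" by linarith
    then show ?thesis using core_sym[of u "int s" "int T.deg + 1 - int s"] that by (simp add: cnt)
  qed
  have zeroP: "coeff P s = 0" if "Suc T.deg < s" for s
    unfolding P_def using that by (simp add: coeff_monom_mult T.coeff_gen_high)
  have dp: "Suc T.deg \<le> 2 * nat p" using pos pq by linarith
  have "{1..<W K} - W ` {1..K} \<subseteq> {j}" unfolding img using W_le[of K] K by auto
  then have "card ({1..<W K} - W ` {1..K}) \<le> 1" using card_mono[of "{j}" "{1..<W K} - W ` {1..K}"] by simp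
  then have "\<exists>U m Q. qshape 1 Q \<and> P = monom 1 U * (Q * qint (Suc m))"
    using T.gen_shapes[OF Y top, of 1] unfolding P_def[symmetric] by (metis insertE one_le_numeral singletonD)
  then obtain U m Q where "qshape 1 Q" "P = monom 1 U * (Q * qint (Suc m))" by blast
  from qshape_bound[OF this symP zeroP dp] show ?thesis
    using pos by (simp add: cnt nat_add_distrib)
qed

end

theorem core_bound:
  assumes u: "u \<in> fronts K" and "q \<le> p"
  shows "core u p q - core u (p + 1) (q - 1) \<in> {0..2}"
proof (cases "two_step.is_top {1..K} W u K")
  case True
  then show ?thesis using core_bound_top[OF u True assms(2)] by simp
next
  case False
  show ?thesis
  proof (cases "\<exists>c. 1 \<le> c \<and> c < K \<and> W c < W K \<and> W K \<le> u c")
    case True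
    then obtain c where "1 \<le> c" "c < K" "W c < W K" "W K \<le> u c" by blast
    from core_bound_blocked[OF u this False assms(2)] show ?thesis by simp
  next
    case nb: False
    show ?thesis using nb by (intro core_bound_unblocked[OF _ False assms(2)]) (meson not_le)
  qed
qed

end

section \<open>The coefficients\<close>

lemma initial_image:
  assumes k: "1 \<le> k" and v: "v \<in> fronts k" and asc: "v k < v (Suc k)"
  shows "v ` {e \<in> {1..k}. v e < v k} = {1..<v k}"
proof (intro equalityI subsetI)
  fix y assume "y \<in> v ` {e \<in> {1..k}. v e < v k}"
  then obtain e where "1 \<le> e" "v e < v k" "y = v e" by auto
  then show "y \<in> {1..<v k}" using fronts_pos[OF v, of e] by simp
next
  fix y assume y: "y \<in> {1..<v k}"
  obtain e where e: "v e = y" using finitary_perms_surj[OF fronts_finitary[OF v]] by blast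
  have "e \<noteq> 0"
  proof
    assume "e = 0"
    then show False using e y finitary_perms_0[OF fronts_finitary[OF v]] by simp
  qed
  moreover have "e \<le> k"
  proof (rule ccontr)
    assume "\<not> e \<le> k"
    then have "v (Suc k) \<le> v e" using fronts_tail_less[OF v, of "Suc k" e] by (cases "e = Suc k") auto
    then show False using e y asc by simp
  qed
  ultimately show "y \<in> v ` {e \<in> {1..k}. v e < v k}" using e y by auto
qed

text \<open>On the positions where \<open>v\<close> is below \<open>v k\<close>, \<open>w\<close> is
  injective and bounded by \<open>v\<close>, so by counting it already takes all values below
  \<open>v k\<close> there. Any other position of \<open>w\<close> then starts at \<open>v k\<close>
  or above.\<close>

lemma initial_values:
  assumes k: "1 \<le> k" and v: "v \<in> fronts k" and asc: "v k < v (Suc k)" and w: "w \<in> fronts k"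
    and a: "a \<in> {1..k}" "v k \<le> v a" "s a \<le> v k"
    and s: "\<And>e. e \<in> {1..k} \<Longrightarrow> v e < v k \<Longrightarrow> s e = v e" and le: "\<And>e. e \<in> {1..k} \<Longrightarrow> w e \<le> s e"
  shows "w a = v k" "{1..<v k} \<subseteq> w ` {1..k}"
proof -
  let ?E = "{e \<in> {1..k}. v e < v k}"
  have "card (v ` ?E) = card ?E" "card (w ` ?E) = card ?E"
    by (intro card_image fronts_inj_on[OF v] fronts_inj_on[OF w])+
  then have card: "card (w ` ?E) = card {1..<v k}" using initial_image[OF k v asc] by simp
  have "w ` ?E \<subseteq> {1..<v k}"
  proof (rule image_subsetI)
    fix e assume e: "e \<in> ?E"
    then have "w e \<le> v e" "v e < v k" "1 \<le> e" using le[of e] s[of e] by auto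
    then show "w e \<in> {1..<v k}" using fronts_pos[OF w, of e] by simp
  qed
  from card_subset_eq[OF _ this card] have eq: "w ` ?E = {1..<v k}" by simp
  then show "{1..<v k} \<subseteq> w ` {1..k}" by blast
  have "w a \<notin> w ` ?E" using a(2) fronts_inj_eq[OF w] by auto
  then have "\<not> w a < v k" using eq fronts_pos[OF w, of a] a(1) by auto
  then show "w a = v k" using le[OF a(1)] a(3) by simp
qed

context gapped_front
begin

lemma hsym_product_expansion:
  assumes "K = Suc k"
  shows "schubert W * hsym k p * hsym k q
    = G p q - X K * G (p - 1) q - X K * G p (q - 1) + X K * (X K * G (p - 1) (q - 1))"
proof -
  have h: "hsym k n = hsym K n - X K * hsym K (n - 1)" for n
    using hsym_Suc[of k n] assms by simp
  show ?thesis unfolding h[of p] h[of q] G_def by (simp add: algebra_simps)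
qed

lemma hsym_product_span:
  assumes "K = Suc k"
  shows "schubert W * hsym k p * hsym k q \<in> schubert_span (fronts K)"
  unfolding hsym_product_expansion[OF assms]
  by (intro schubert_span.add schubert_span_diff schubert_span_X_last G_span K)

context
  fixes v
  assumes v: "v \<in> fronts K" and asc: "v K < v (Suc K)"
begin

lemma hop_preds_ascent: "hop_preds K v = {}"
proof (rule ccontr)
  assume "hop_preds K v \<noteq> {}"
  then obtain U where "U \<in> hop_preds K v" by blast
  note D = hop_predsD[OF this K]
  have "U K \<in> {1..<v K}" using D(3) fronts_pos[OF D(1), of K] K by simp
  then have "U K \<in> v ` {e \<in> {1..K}. v e < v K}" using initial_image[OF K v asc] by simp
  then obtain e where e: "1 \<le> e" "e \<le> K" "v e < v K" "U K = v e" by auto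
  then have ne: "e \<noteq> K" by auto
  then have "U e = U K" using D(2)[of e] e by simp
  then show False using fronts_inj_eq[OF D(1)] ne by simp
qed

lemma scoef_X_ascent:
  "f \<in> schubert_span (fronts K) \<Longrightarrow> scoef v (X K * f) = - (\<Sum>a\<in>cover_preds K v. scoef (v \<circ> transpose a K) f)"
  by (simp add: scoef_X_last[OF _ K v] hop_preds_ascent)

text \<open>If \<open>v\<close> were reachable from \<open>W\<close>, counting would give
  \<open>W K = v K\<close> with all smaller values in the front, but \<open>j < W K\<close> is
  missing.\<close>

lemma scoef_G_ascent: "scoef v (G p q) = 0"
proof (cases "\<exists>e\<in>{1..K}. v e < W e")
  case True
  then obtain e where "1 \<le> e" "e \<le> K" "v e < W e" by auto
  then show ?thesis by (rule scoef_G_not_above)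
next
  case False
  then have le: "W e \<le> v e" if "e \<in> {1..K}" for e using that by (meson not_le)
  have KA: "K \<in> {1..K}" using K by simp
  note I = initial_values[OF K v asc W KA order_refl order_refl refl le]
  have "j \<in> W ` {1..K}" using I j by auto
  then show ?thesis unfolding img by simp
qed

text \<open>Stated for a general \<open>s\<close> because it is applied to the exchanged endpoint as
  well as to its hop and cover predecessors, which all keep the values of \<open>v\<close> below
  \<open>v K\<close> and have \<open>v K\<close> at position \<open>a\<close>.\<close>

lemma scoef_G_swapped:
  assumes a: "1 \<le> a" "a < K" "v K < v a" "W a \<noteq> v K" and s: "s a = v K" "\<And>e. e \<in> {1..K} \<Longrightarrow> v e < v K \<Longrightarrow> s e = v e"
  shows "scoef s (G p q) = 0"
proof (cases "\<exists>e\<in>{1..K}. s e < W e")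
  case True
  then obtain e where "1 \<le> e" "e \<le> K" "s e < W e" by auto
  then show ?thesis by (rule scoef_G_not_above)
next
  case False
  then have le: "W e \<le> s e" if "e \<in> {1..K}" for e using that by (meson not_le)
  have "W a = v K" by (rule initial_values(1)[OF K v asc W _ _ _ s(2) le]) (use a s in auto)
  then show ?thesis using a(4) by simp
qed

lemma core_swapped_0:
  assumes a: "a \<in> cover_preds K v" and ne: "W a \<noteq> v K"
  shows "core (v \<circ> transpose a K) p q = 0"
proof -
  note d = cover_predsD[OF a]
  let ?u = "v \<circ> transpose a K"
  have u: "?u \<in> fronts K" using d K by (intro fronts_comp_transpose v) auto
  have ua: "?u a = v K" "?u K = v a" by (simp_all add: o_apply)
  have ue: "?u e = v e" if "e \<noteq> a" "e \<noteq> K" for e using that by (simp add: o_apply)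
  have small: "?u e = v e \<and> e < K \<and> e \<noteq> a" if "e \<in> {1..K}" "v e < v K" for e
  proof -
    have "e \<noteq> a" "e \<noteq> K" using that d by auto
    then show ?thesis using ue that by simp
  qed
  have 1: "scoef ?u (G p q) = 0" for p q
    using small by (intro scoef_G_swapped[OF d ne]) (auto simp: ua)
  have 2: "scoef U (G p q) = 0" if U: "U \<in> hop_preds K ?u" for U p q
  proof (rule scoef_G_swapped[OF d ne])
    note D = hop_predsD[OF U K]
    show "U a = v K" using D(2)[OF d(1,2)] ua by simp
    show "U e = v e" if "e \<in> {1..K}" "v e < v K" for e using D(2)[of e] small[OF that] that by simp
  qed
  have 3: "scoef (?u \<circ> transpose b K) (G p q) = 0" if b: "b \<in> cover_preds K ?u" for b p q
  proof (rule scoef_G_swapped[OF d ne])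
    note db = cover_predsD[OF b]
    have "b \<noteq> a" using db(3) d ua by auto
    then show "(?u \<circ> transpose b K) a = v K" using d ua by (simp add: o_apply[of ?u])
    show "(?u \<circ> transpose b K) e = v e" if e: "e \<in> {1..K}" "v e < v K" for e
    proof -
      have "e \<noteq> b"
      proof
        assume "e = b"
        then show False using db(3) small[OF e] ua d e by simp
      qed
      then show ?thesis using small[OF e] by (simp add: o_apply[of ?u])
    qed
  qed
  show ?thesis by (simp add: core_end[OF u] 1 2 3)
qed

text \<open>\<open>G p q\<close> does not reach \<open>v\<close>. The cofactor enters with a minus
  sign, and so do the only surviving terms of multiplication by \<open>X K\<close>, those of the
  covers; the signs cancel.\<close>

lemma scoef_ascent:
  assumes "K = Suc k"
  shows "scoef v (schubert W * hsym k p * hsym k q) = (\<Sum>a\<in>cover_preds K v. core (v \<circ> transpose a K) p q)"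
  unfolding hsym_product_expansion[OF assms]
  by (simp add: scoef_diff scoef_add scoef_G_ascent scoef_X_ascent G_span schubert_span_X_last K core_def
      sum.distrib sum_subtractf)

text \<open>Only the position \<open>a\<close> with \<open>W a = v K\<close> can contribute, and
  injectivity of \<open>W\<close> allows at most one, so the sum is a single
  \<open>core\<close>.\<close>

lemma bound_ascent:
  assumes k: "K = Suc k" and pq: "q \<le> p"
  shows "scoef v (schubert W * jt k p q) \<in> {0..2}"
proof (cases "\<exists>a\<in>cover_preds K v. W a = v K")
  case True
  then obtain a where a: "a \<in> cover_preds K v" "W a = v K" by blast
  note d = cover_predsD[OF a(1)]
  have fin: "finite (cover_preds K v)" by (simp add: cover_preds_def)
  have "scoef v (schubert W * hsym k p * hsym k q) = core (v \<circ> transpose a K) p q" for p q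
  proof -
    have "core (v \<circ> transpose b K) p q = 0" if b: "b \<in> cover_preds K v - {a}" for b
    proof (rule core_swapped_0)
      show "W b \<noteq> v K" using a(2) fronts_inj_eq[OF W, of a b] b by auto
    qed (use b in simp)
    then have "(\<Sum>b\<in>cover_preds K v - {a}. core (v \<circ> transpose b K) p q) = 0" by (rule sum.neutral[OF ballI])
    then show ?thesis
      unfolding scoef_ascent[OF k] using sum.remove[OF fin a(1), of "\<lambda>b. core (v \<circ> transpose b K) p q"] by simp
  qed
  moreover have "v \<circ> transpose a K \<in> fronts K" using d K by (intro fronts_comp_transpose v) auto
  ultimately show ?thesis using core_bound[OF _ pq, of "v \<circ> transpose a K"] by (simp add: schubert_jt scoef_diff)
next
  case False
  then have "scoef v (schubert W * hsym k p * hsym k q) = 0" for p q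
    unfolding scoef_ascent[OF k] using core_swapped_0 by (intro sum.neutral) blast
  then show ?thesis by (simp add: schubert_jt scoef_diff)
qed

end

end

lemma perm_fronts:
  assumes w: "w permutes {1..n}" and inc: "\<And>i. k < i \<Longrightarrow> i < n \<Longrightarrow> w i < w (Suc i)"
  shows "w \<in> fronts k"
  unfolding fronts_def
proof (safe)
  show "w \<in> finitary_perms" using w by (auto simp: finitary_perms_def)
  fix i assume i: "k < i"
  consider "i < n" | "i = n" | "n < i" by linarith
  then show "w i < w (Suc i)"
  proof cases
    case 1
    then show ?thesis using inc i by simp
  next
    case 2
    then have "w i \<in> {1..n}" "w (Suc i) = Suc i" using permutes_in_image[OF w, of i] permutes_not_in[OF w, of "Suc i"] i by auto
    then show ?thesis using 2 by simp
  next
    case 3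
    then show ?thesis using permutes_not_in[OF w, of i] permutes_not_in[OF w, of "Suc i"] by simp
  qed
qed

lemma perm_bound:
  assumes w: "w permutes {1..n}" and f: "w \<in> fronts k" and k: "k \<le> n" "n \<le> k + r" and "r \<le> 2" "q \<le> p"
  shows "scoef v (schubert w * jt k p q) \<in> {0..if r \<le> 1 then 1 else 2}"
proof (rule front_bound[OF f _ \<open>r \<le> 2\<close> _ \<open>q \<le> p\<close>])
  have sub: "w ` {1..k} \<subseteq> {1..n}" using image_mono[of "{1..k}" "{1..n}" w] permutes_image[OF w] k(1) by simp
  then show "w ` {1..k} \<subseteq> {..n}" by auto
  have "card ({1..n} - w ` {1..k}) = n - k"
    using card_Diff_subset[OF _ sub] card_image[OF fronts_inj_on[OF f, of "{1..k}"]] by simp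
  then show "card ({1..n} - w ` {1..k}) \<le> r" using k(2) by simp
qed

lemma perm_bound_descent:
  assumes w: "w permutes {1..Suc (Suc k)}" and desc: "w (Suc (Suc k)) < w (Suc k)" and pq: "q \<le> p"
  shows "schubert w * jt k p q \<in> schubert_span finitary_perms" "v \<in> finitary_perms \<Longrightarrow> scoef v (schubert w * jt k p q) \<in> {0..2}"
proof -
  let ?K = "Suc k"
  have inj: "inj w" by (rule permutes_inj[OF w])
  have wf: "w \<in> fronts ?K" by (rule perm_fronts[OF w]) simp
  have "gapped_front ?K (w (Suc ?K)) w"
  proof
    have "{1..Suc ?K} = insert (Suc ?K) {1..?K}" by auto
    then have "w ` insert (Suc ?K) {1..?K} = {1..Suc ?K}" using permutes_image[OF w] by (simp only:)
    then have eq: "insert (w (Suc ?K)) (w ` {1..?K}) = {1..Suc ?K}" by (simp only: image_insert)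
    have "w (Suc ?K) \<notin> w ` {1..?K}" using inj_eq[OF inj] by auto
    then show "w ` {1..?K} = {1..Suc ?K} - {w (Suc ?K)}" unfolding eq[symmetric] by blast
    show "1 \<le> w (Suc ?K)" using fronts_pos[OF wf, of "Suc ?K"] by simp
  qed (use desc wf in auto)
  then interpret gapped_front ?K "w (Suc ?K)" w .
  have spanK: "schubert w * jt k p q \<in> schubert_span (fronts ?K)"
    unfolding schubert_jt by (intro schubert_span_diff hsym_product_span refl)
  then show span: "schubert w * jt k p q \<in> schubert_span finitary_perms"
    by (rule schubert_span_mono[OF _ fronts_subset])
  assume v: "v \<in> finitary_perms"
  have "v ?K \<noteq> v (Suc ?K)" using inj_eq[OF finitary_perms_inj[OF v]] by simp
  then consider "v \<notin> fronts ?K" | "v (Suc ?K) < v ?K" | "v \<in> fronts ?K" "v ?K < v (Suc ?K)" by linarith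
  then show "scoef v (schubert w * jt k p q) \<in> {0..2}"
  proof cases
    case 1
    then show ?thesis using scoef_not_front[OF spanK] by simp
  next
    case 2
    \<comment> \<open>Polynomials \<open>hsym k m\<close> are symmetric in the two variables after
      \<open>X k\<close>, so the divided difference acts on \<open>schubert w\<close> alone and
      turns it into one that increases after \<open>k\<close>, with at most two missing
      values.\<close>
    have w': "w \<circ> adjt ?K permutes {1..Suc ?K}"
      by (rule permutes_compose[OF permutes_swap_id w]) auto
    have f': "w \<circ> adjt ?K \<in> fronts k"
    proof (rule perm_fronts[OF w'])
      fix i assume "k < i" "i < Suc ?K"
      then have "i = ?K" by simp
      then show "(w \<circ> adjt ?K) i < (w \<circ> adjt ?K) (Suc i)" using desc by (simp add: o_apply)
    qed
    have "divided_diff ?K (jt k p q) = 0"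
      unfolding jt_def by (simp add: divided_diff_diff divided_diff_mult divided_diff_hsym_high)
    then have "divided_diff ?K (schubert w * jt k p q) = schubert (w \<circ> adjt ?K) * jt k p q"
      using divided_diff_schubert_descent[OF fronts_finitary[OF wf], of ?K] desc by (simp add: divided_diff_mult_sym)
    then have "scoef v (schubert w * jt k p q) = scoef (v \<circ> adjt ?K) (schubert (w \<circ> adjt ?K) * jt k p q)"
      using scoef_divided_diff[OF span v _ 2] by simp
    then show ?thesis using perm_bound[OF w' f', of 2 q p "v \<circ> adjt ?K"] pq by simp
  next
    case 3
    then show ?thesis by (intro bound_ascent[OF 3 refl pq])
  qed
qed

lemma front_span:
  assumes "w \<in> fronts k"
  shows "schubert w * jt k p q \<in> schubert_span finitary_perms"
proof -
  have "schubert w * jt k p q \<in> schubert_span (fronts k)"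
    unfolding schubert_jt by (intro schubert_span_diff schubert_span_hsym2 assms)
  then show ?thesis by (rule schubert_span_mono[OF _ fronts_subset])
qed

theorem theorem1p1:
  fixes n1 n2 k :: nat and \<tau> w :: "nat \<Rightarrow> nat" and \<mu> :: "nat list"
  assumes "n1 \<ge> 1" and "n2 \<ge> 1"
    and "grassmannian k n1 \<tau>"
    and "\<mu> = grassmannian_shape k \<tau>"
    and "length \<mu> = 2"
    and "w permutes {1..n2}"
  shows "(k = n2 \<longrightarrow>
            (\<forall>v\<in>finitary_perms. schubert_coeff (schubert w * schur \<mu> k) v \<in> {0, 1})) \<and>
         (k + 1 = n2 \<longrightarrow>
            (\<forall>v\<in>finitary_perms. schubert_coeff (schubert w * schur \<mu> k) v \<in> {0, 1})) \<and>
         (k + 2 = n2 \<longrightarrow>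
            (\<forall>v\<in>finitary_perms. schubert_coeff (schubert w * schur \<mu> k) v \<in> {0, 1, 2}))"
proof -
  obtain p q where \<mu>: "\<mu> = [p, q]" and q: "q \<le> p"
    using grassmannian_shape_two_rows[OF assms(3)] assms(4,5) by metis
  have schur: "schur \<mu> k = jt k (int p) (int q)"
    unfolding \<mu> schur_two_rows[OF q] jt_def using flagged_jacobi_trudi[OF order_refl q] by blast
  have pq: "int q \<le> int p" using q by simp
  have front: "schubert_coeff (schubert w * schur \<mu> k) v \<in> {0..if r \<le> 1 then 1 else 2}"
    if "w \<in> fronts k" "k \<le> n2" "n2 \<le> k + r" "r \<le> 2" for v r
    using perm_bound[OF assms(6) that pq] schubert_coeff_eq_scoef[OF front_span[OF that(1)]]
    unfolding schur by simp
  have small: "schubert_coeff (schubert w * schur \<mu> k) v \<in> {0, 1}" if "k = n2 \<or> k + 1 = n2" for v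
  proof -
    \<comment> \<open>At most one value follows position \<open>k\<close> within
      \<open>{1..n2}\<close>, so there is no descent to exclude, and \<open>r = 1\<close> serves
      both cases.\<close>
    have "w \<in> fronts k" by (rule perm_fronts[OF assms(6)]) (use that in auto)
    then have "schubert_coeff (schubert w * schur \<mu> k) v \<in> {0..1}" using front[of 1 v] that by auto
    then show ?thesis by auto
  qed
  have large: "schubert_coeff (schubert w * schur \<mu> k) v \<in> {0, 1, 2}" if n: "k + 2 = n2" and v: "v \<in> finitary_perms" for v
  proof -
    have w: "w permutes {1..Suc (Suc k)}" using assms(6) n by auto
    have "w (Suc k) \<noteq> w (Suc (Suc k))" using inj_eq[OF permutes_inj[OF w]] by simp
    then consider "w (Suc k) < w (Suc (Suc k))" | "w (Suc (Suc k)) < w (Suc k)" by linarith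
    then have "schubert_coeff (schubert w * schur \<mu> k) v \<in> {0..2}"
    proof cases
      case 1
      have "w \<in> fronts k"
      proof (rule perm_fronts[OF w])
        fix i assume "k < i" "i < Suc (Suc k)"
        then have "i = Suc k" by simp
        then show "w i < w (Suc i)" using 1 by simp
      qed
      then show ?thesis using front[of 2 v] n by auto
    next
      case 2
      show ?thesis
        unfolding schur schubert_coeff_eq_scoef[OF perm_bound_descent(1)[OF w 2 pq]]
        by (rule perm_bound_descent(2)[OF w 2 pq v])
    qed
    then show ?thesis by auto
  qed
  show ?thesis using small large by blast
qed

end
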